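(* Let $K$ be a field, let $I\subset S=K[Y_1,\dots,Y_r]$ be a squarefree monomial ideal and let $\Delta$ be the simplicial complex such that $K[\Delta]=S/I$. Let $P$ be a monomial prime ideal of $K[\Delta]$. Then for all $i$, the local cohomology module $H_P^i(K[\Delta])$ is tame.
   Context: A monomial prime ideal $P$ of $R=S/I$ is a prime ideal generated by the residue classes of some of the variables $Y_1,\dots,Y_r$; fix a set of variables whose residue classes generate $P$. $R$ is given the grading in which the residue classes of the chosen variables generating $P$ have degree $1$ and the residue classes of the remaining variables have degree $0$; the local cohomology modules $H^i_P(R)$ inherit this $\mathbb{Z}$-grading, and tameness refers to it. A graded module $N$ over a positively graded Noetherian ring is called tame if there exists an integer $j_0$ such that either $N_j=0$ for all $j\le j_0$, or $N_j\ne0$ for all $j\le j_0$. *)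

theory Defs
  imports "HOL-Algebra.Algebra" "HOL-Algebra.Algebraic_Closure_Type" "HOL-Library.Poly_Mapping"
begin

section \<open>Graded rings, graded modules and their homomorphisms\<close>

record 'a graded_ring = "'a ring" +
  rgrade :: "int \<Rightarrow> 'a set"

record ('a, 'm) graded_module = "('a, 'm) module" +
  mgrade :: "int \<Rightarrow> 'm set"

text \<open>The second axiom says that the underlying group is the internal direct sum of its
  homogeneous components.\<close>

locale graded_module =
  module R M
  for R :: "('a, 'r) graded_ring_scheme" (structure)
    and M :: "('a, 'm, 'x) graded_module_scheme" (structure) +
  assumes mgrade_subgroup: "additive_subgroup (mgrade M j) M"
    and mgrade_direct_sum: "x \<in> carrier M \<Longrightarrow>
      \<exists>!f. (\<forall>j. f j \<in> mgrade M j) \<and> finite {j. f j \<noteq> \<zero>\<^bsub>M\<^esub>} \<and>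
           x = (\<Oplus>\<^bsub>M\<^esub>j\<in>{j. f j \<noteq> \<zero>\<^bsub>M\<^esub>}. f j)"
    and mgrade_smult: "a \<in> rgrade R i \<Longrightarrow> x \<in> mgrade M j \<Longrightarrow> a \<odot>\<^bsub>M\<^esub> x \<in> mgrade M (i + j)"

definition regular_module :: "('a, 'r) graded_ring_scheme \<Rightarrow> ('a, 'a) graded_module" where
  "regular_module R =
    \<lparr>carrier = carrier R, monoid.mult = monoid.mult R, one = one R, ring.zero = ring.zero R, ring.add = ring.add R,
     module.smult = monoid.mult R, mgrade = rgrade R\<rparr>"

text \<open>Homomorphisms are homogeneous of degree \<open>0\<close>.\<close>

definition graded_hom ::
  "('a, 'r) graded_ring_scheme \<Rightarrow> ('a, 'm, 'x) graded_module_scheme \<Rightarrow>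
   ('a, 'n, 'y) graded_module_scheme \<Rightarrow> ('m \<Rightarrow> 'n) set" where
  "graded_hom R M N =
    {f. f \<in> carrier M \<rightarrow> carrier N \<and>
        (\<forall>x\<in>carrier M. \<forall>y\<in>carrier M. f (x \<oplus>\<^bsub>M\<^esub> y) = f x \<oplus>\<^bsub>N\<^esub> f y) \<and>
        (\<forall>a\<in>carrier R. \<forall>x\<in>carrier M. f (a \<odot>\<^bsub>M\<^esub> x) = a \<odot>\<^bsub>N\<^esub> f x) \<and>
        (\<forall>j. f ` mgrade M j \<subseteq> mgrade N j)}"

text \<open>Injective objects of the category of graded \<open>R\<close>-modules. A definition cannot quantify over
  all carrier types of the test modules \<open>A\<close>, \<open>B\<close>, so these live on the type \<^typ>\<open>nat \<Rightarrow> 'a\<close>.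
  Nothing is lost: by Baer's criterion the graded ideals of the degree shifts of \<open>R\<close> suffice as
  test objects, and this type contains isomorphic copies of them.\<close>

definition graded_injective ::
  "('a, 'r) graded_ring_scheme \<Rightarrow> ('a, 'm, 'x) graded_module_scheme \<Rightarrow> bool" where
  "graded_injective R E \<longleftrightarrow> graded_module R E \<and>
    (\<forall>(A :: ('a, nat \<Rightarrow> 'a) graded_module) (B :: ('a, nat \<Rightarrow> 'a) graded_module) u f.
       graded_module R A \<and> graded_module R B \<and>
       u \<in> graded_hom R A B \<and> inj_on u (carrier A) \<and> f \<in> graded_hom R A E \<longrightarrow>
       (\<exists>g \<in> graded_hom R B E. \<forall>x\<in>carrier A. g (u x) = f x))"

text \<open>\<open>0 \<rightarrow> M \<rightarrow> E 0 \<rightarrow> E 1 \<rightarrow> \<dots>\<close> is exact with graded injective \<open>E q\<close>;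
  \<open>e\<close> is the augmentation and \<open>d q\<close> the differential from \<open>E q\<close> to \<open>E (q + 1)\<close>.\<close>

definition graded_injective_resolution ::
  "('a, 'r) graded_ring_scheme \<Rightarrow> ('a, 'n, 'y) graded_module_scheme \<Rightarrow> ('n \<Rightarrow> 'm) \<Rightarrow>
   (nat \<Rightarrow> ('a, 'm) graded_module) \<Rightarrow> (nat \<Rightarrow> 'm \<Rightarrow> 'm) \<Rightarrow> bool" where
  "graded_injective_resolution R M e E d \<longleftrightarrow>
    graded_module R M \<and>
    (\<forall>q. graded_injective R (E q)) \<and>
    e \<in> graded_hom R M (E 0) \<and> inj_on e (carrier M) \<and>
    (\<forall>q. d q \<in> graded_hom R (E q) (E (Suc q))) \<and>
    e ` carrier M = a_kernel (E 0) (E 1) (d 0) \<and>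
    (\<forall>q. d q ` carrier (E q) = a_kernel (E (Suc q)) (E (Suc (Suc q))) (d (Suc q)))"


section \<open>Cohomology, local cohomology, tameness\<close>

definition graded_restrict ::
  "('a, 'm) graded_module \<Rightarrow> 'm set \<Rightarrow> ('a, 'm) graded_module" where
  "graded_restrict M U = M\<lparr>carrier := U, mgrade := (\<lambda>j. mgrade M j \<inter> U)\<rparr>"

text \<open>The fields \<^const>\<open>monoid.mult\<close> and \<^const>\<open>one\<close> of a module record carry no meaning.\<close>

definition graded_quotient ::
  "('a, 'm) graded_module \<Rightarrow> 'm set \<Rightarrow> ('a, 'm set) graded_module" where
  "graded_quotient M N =
    \<lparr>carrier = a_rcosets\<^bsub>M\<^esub> N, monoid.mult = (\<lambda>_ _. N), one = N, ring.zero = N, ring.add = set_add M,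
     module.smult = (\<lambda>a C. \<Union>x\<in>C. N +>\<^bsub>M\<^esub> (a \<odot>\<^bsub>M\<^esub> x)),
     mgrade = (\<lambda>j. (\<lambda>x. N +>\<^bsub>M\<^esub> x) ` mgrade M j)\<rparr>"

text \<open>Cohomology of a complex \<open>0 \<rightarrow> C 0 \<rightarrow> C 1 \<rightarrow> \<dots>\<close>.\<close>

fun coboundaries ::
  "(nat \<Rightarrow> ('a, 'm) graded_module) \<Rightarrow> (nat \<Rightarrow> 'm \<Rightarrow> 'm) \<Rightarrow> nat \<Rightarrow> 'm set" where
  "coboundaries C d 0 = {\<zero>\<^bsub>C 0\<^esub>}"
| "coboundaries C d (Suc i) = d i ` carrier (C i)"

definition cohomology ::
  "(nat \<Rightarrow> ('a, 'm) graded_module) \<Rightarrow> (nat \<Rightarrow> 'm \<Rightarrow> 'm) \<Rightarrow> nat \<Rightarrow> ('a, 'm set) graded_module" where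
  "cohomology C d i =
    graded_quotient (graded_restrict (C i) (a_kernel (C i) (C (Suc i)) (d i))) (coboundaries C d i)"

text \<open>The \<open>P\<close>-torsion submodule \<open>\<Gamma>\<^sub>P(M)\<close>: all elements annihilated by some power of the ideal \<open>P\<close>.\<close>

definition torsion_submodule ::
  "('a, 'r) graded_ring_scheme \<Rightarrow> 'a set \<Rightarrow> ('a, 'm) graded_module \<Rightarrow> ('a, 'm) graded_module" where
  "torsion_submodule R P M =
    graded_restrict M
      {x \<in> carrier M. \<exists>n::nat. \<forall>a \<in> P [^]\<^bsub>ideals_set R\<^esub> n. a \<odot>\<^bsub>M\<^esub> x = \<zero>\<^bsub>M\<^esub>}"

text \<open>The \<open>i\<close>-th right derived functor of \<open>\<Gamma>\<^sub>P\<close> with its grading, computed from a graded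
  injective resolution \<open>(E, d)\<close>. It depends on the resolution only up to isomorphism of graded
  modules.\<close>

definition local_cohomology ::
  "('a, 'r) graded_ring_scheme \<Rightarrow> 'a set \<Rightarrow> (nat \<Rightarrow> ('a, 'm) graded_module) \<Rightarrow>
   (nat \<Rightarrow> 'm \<Rightarrow> 'm) \<Rightarrow> nat \<Rightarrow> ('a, 'm set) graded_module" where
  "local_cohomology R P E d i = cohomology (\<lambda>q. torsion_submodule R P (E q)) d i"

definition tame :: "('a, 'm, 'x) graded_module_scheme \<Rightarrow> bool" where
  "tame N \<longleftrightarrow> (\<exists>j0. (\<forall>j\<le>j0. mgrade N j = {\<zero>\<^bsub>N\<^esub>}) \<or> (\<forall>j\<le>j0. mgrade N j \<noteq> {\<zero>\<^bsub>N\<^esub>}))"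


section \<open>Squarefree monomial ideals and Stanley--Reisner rings\<close>

text \<open>The variables \<open>Y\<^sub>1, \<dots>, Y\<^sub>r\<close> are indexed by a finite type \<open>'v\<close> with \<open>r\<close> elements.\<close>

type_synonym ('v, 'k) mpoly = "('v \<Rightarrow>\<^sub>0 nat) \<Rightarrow>\<^sub>0 'k"

abbreviation polynomial_ring :: "('v, 'k::field) mpoly ring" where
  "polynomial_ring \<equiv> ring_of_type_algebra"

definition monomial :: "('v \<Rightarrow>\<^sub>0 nat) \<Rightarrow> ('v, 'k::field) mpoly" where
  "monomial m = Poly_Mapping.single m 1"

definition mvar :: "'v \<Rightarrow> ('v, 'k::field) mpoly" where
  "mvar v = monomial (Poly_Mapping.single v 1)"

definition squarefree_monomial_ideal :: "('v, 'k::field) mpoly set \<Rightarrow> bool" where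
  "squarefree_monomial_ideal I \<longleftrightarrow>
    (\<exists>G. (\<forall>m\<in>G. \<forall>v. Poly_Mapping.lookup m v \<le> 1) \<and> I = Idl\<^bsub>polynomial_ring\<^esub> (monomial ` G))"

text \<open>Not every \<open>v\<close> is required to be a vertex, so that \<open>I\<close> may contain variables.\<close>

definition simplicial_complex :: "'v::finite set set \<Rightarrow> bool" where
  "simplicial_complex \<Delta> \<longleftrightarrow> {} \<in> \<Delta> \<and> (\<forall>F\<in>\<Delta>. \<forall>G. G \<subseteq> F \<longrightarrow> G \<in> \<Delta>)"

definition stanley_reisner_ideal :: "'v::finite set set \<Rightarrow> ('v, 'k::field) mpoly set" where
  "stanley_reisner_ideal \<Delta> = Idl\<^bsub>polynomial_ring\<^esub> {\<Prod>v\<in>F. mvar v | F. F \<notin> \<Delta>}"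

text \<open>The ring \<open>S/I\<close> for a monomial ideal \<open>I\<close>, graded by giving the residue classes of the variables
  in \<open>W\<close> degree \<open>1\<close> and those of the other variables degree \<open>0\<close>.\<close>

definition graded_monomial_quotient ::
  "'v::finite set \<Rightarrow> ('v, 'k::field) mpoly set \<Rightarrow> ('v, 'k) mpoly set graded_ring" where
  "graded_monomial_quotient W I =
    ring.extend (polynomial_ring Quot I)
      \<lparr>rgrade = (\<lambda>j. (\<lambda>p. I +>\<^bsub>polynomial_ring\<^esub> p) `
         {p. \<forall>m \<in> Poly_Mapping.keys p. int (\<Sum>v\<in>W. Poly_Mapping.lookup m v) = j})\<rparr>"

end

theory Submission
  imports Defs
begin

text \<open>Let \<open>\<Gamma>\<^sub>F\<close> denote the \<open>x\<^sub>F\<close>-power torsion, where \<open>x\<^sub>F\<close> is the product of the variables in \<open>F \<subseteq> W\<close>.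
  Baer's criterion for monomial ideals, together with squarefreeness, shows that \<open>E q / \<Gamma>\<^sub>F(E q)\<close> is already
  the localisation of \<open>E q\<close> at \<open>x\<^sub>F\<close>, and that
  \<open>V \<inter> \<Gamma>\<^bsub>F \<union> {v}\<^esub> = V \<inter> \<Gamma>\<^sub>F + V \<inter> \<Gamma>\<^bsub>{v}\<^esub>\<close> for every intersection \<open>V\<close> of modules \<open>\<Gamma>\<^bsub>{u}\<^esub>\<close> with \<open>u \<noteq> v\<close>. Hence in each degree the
  bicomplex \<open>\<Oplus>\<^sub>F E q / \<Gamma>\<^sub>F(E q)\<close> has exact rows and columns, and local cohomology vanishes in degree \<open>j\<close> iff
  Cech cohomology of \<open>R\<close> does. A Cech cocycle of degree \<open>j < 0\<close> consists of fractions each of whose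
  monomials has a negative exponent at some \<open>v \<in> W\<close>; sorting the monomials by such a \<open>v\<close> and dividing by \<open>v\<close>,
  which by squarefreeness preserves the cocycle condition, gives cocycles of degree \<open>j - 1\<close>. So vanishing in
  degree \<open>j - 1\<close> implies vanishing in degree \<open>j\<close>.\<close>

section \<open>Bicomplexes of Cech type\<close>

text \<open>No localisation is ever formed. An element of \<open>E q\<close> stands for its class
  modulo \<open>x\<^sub>F\<close>-torsion, and equality at \<open>F\<close> means that a difference
  is torsion. Enlarging \<open>F\<close> is then the identity on representatives, because torsion
  grows with \<open>F\<close>. The price is that every fraction needs a representative in
  \<open>E q\<close> itself. Injectivity supplies it: \<open>x\<^sub>F w\<close> is divisible by
  every power of \<open>x\<^sub>F\<close>, since membership of a monomial in \<open>I\<close>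
  depends on its support alone. Each such division costs a spare factor \<open>x\<^sub>F\<close>,
  whence denominators of exponent \<open>n + 1\<close> and \<open>n + 2\<close>.

  The choice of the variable \<open>v\<close> by which a monomial is sorted has to be compatible
  with enlarging denominators. It is, because it depends only on the set of variables with negative
  exponent, which does not change. If the piece sorted by \<open>v\<close> is \<open>v\<close> times
  a cocycle with primitive \<open>b\<^sub>v\<close>, then the sum of the \<open>v b\<^sub>v\<close>
  is a primitive of the original cocycle.

  Read contrapositively, a nonzero component in a negative degree forces all lower components to be
  nonzero; otherwise all negative components are zero. These are the two alternatives of
  tameness.\<close>

text \<open>The Cech differential as an iterated mapping cone along an enumeration of the index set; the
  recursion takes care of the signs.\<close>

fun cech :: "'v list \<Rightarrow> ('v set \<Rightarrow> 'g::ab_group_add) \<Rightarrow> 'v set \<Rightarrow> 'g" where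
  "cech [] c F = 0"
| "cech (x # xs) c F =
    (if x \<in> F then c (F - {x}) - cech xs (\<lambda>G. c (insert x G)) (F - {x}) else cech xs c F)"

text \<open>\<open>cech xs c F\<close> arises from 0 and the values of \<open>c\<close> at the
  facets \<open>F - {v}\<close> by subtraction alone. A relation in place of a subgroup makes
  membership, congruence and the compatibility of elements with their numerators instances of one
  induction.\<close>

lemma cech_rel:
  assumes "r 0 0" "\<And>a b a' b'. r a b \<Longrightarrow> r a' b' \<Longrightarrow> r (a - a') (b - b')"
    and "F \<subseteq> set xs" "\<And>v. v \<in> F \<Longrightarrow> r (c (F - {v})) (c' (F - {v}))"
  shows "r (cech xs c F) (cech xs c' F)"
  using assms(3,4)
proof (induction xs arbitrary: c c' F)
  case Nil
  then show ?case using assms(1) by simp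
next
  case (Cons x xs)
  show ?case
  proof (cases "x \<in> F")
    case True
    have "r (cech xs (\<lambda>G. c (insert x G)) (F - {x})) (cech xs (\<lambda>G. c' (insert x G)) (F - {x}))"
    proof (rule Cons.IH)
      show "F - {x} \<subseteq> set xs" using Cons.prems(1) by auto
      fix v assume v: "v \<in> F - {x}"
      then have "insert x (F - {x} - {v}) = F - {v}" using True by auto
      then show "r (c (insert x (F - {x} - {v}))) (c' (insert x (F - {x} - {v})))"
        using Cons.prems(2)[of v] v by simp
    qed
    then show ?thesis using True Cons.prems(2)[of x] assms(2) by simp
  next
    case False
    then show ?thesis using Cons by auto
  qed
qed

lemma cech_in:
  assumes "0 \<in> S" "\<And>a b. a \<in> S \<Longrightarrow> b \<in> S \<Longrightarrow> a - b \<in> S"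
    and "F \<subseteq> set xs" "\<And>v. v \<in> F \<Longrightarrow> c (F - {v}) \<in> S"
  shows "cech xs c F \<in> S"
  using cech_rel[of "\<lambda>a _. a \<in> S" F xs c c] assms by auto

lemma cech_cong:
  assumes "F \<subseteq> set xs" "\<And>v. v \<in> F \<Longrightarrow> c (F - {v}) = c' (F - {v})"
  shows "cech xs c F = cech xs c' F"
  using cech_rel[of "(=)" F xs c c'] assms by auto

lemma cech_diff: "cech xs (\<lambda>F. c F - c' F) F = cech xs c F - cech xs c' F"
  by (induction xs arbitrary: c c' F) (auto simp: algebra_simps)

lemma cech_add: "cech xs (\<lambda>F. c F + c' F) F = cech xs c F + cech xs c' F"
  by (induction xs arbitrary: c c' F) (auto simp: algebra_simps)

lemma cech_hom:
  assumes "\<And>a b. h (a - b) = h a - h b"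
  shows "cech xs (\<lambda>F. h (c F)) F = h (cech xs c F)"
proof -
  have "h 0 = 0" using assms[of 0 0] by simp
  then show ?thesis by (induction xs arbitrary: c F) (auto simp: assms)
qed

lemma cech_0: "cech xs (\<lambda>F. 0) F = 0"
  by (induction xs arbitrary: F) auto

text \<open>The cone of a complex is a complex: for \<open>x \<in> F\<close> the term
  \<open>cech xs c (F - {x})\<close> occurs twice with opposite signs, and what remains is the
  square of the differential for \<open>xs\<close>.\<close>

lemma cech_cech:
  assumes "distinct xs" "F \<subseteq> set xs"
  shows "cech xs (cech xs c) F = 0"
  using assms
proof (induction xs arbitrary: c F)
  case (Cons x xs)
  have x: "x \<notin> set xs" and d: "distinct xs" using Cons.prems by auto
  show ?case
  proof (cases "x \<in> F")
    case True
    let ?G = "F - {x}"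
    have G: "?G \<subseteq> set xs" using Cons.prems by auto
    have "cech xs (\<lambda>H. cech (x # xs) c (insert x H)) ?G
        = cech xs (\<lambda>H. c H - cech xs (\<lambda>K. c (insert x K)) H) ?G"
      by (rule cech_cong[OF G]) (auto simp: insert_absorb)
    also have "\<dots> = cech xs c ?G"
      by (simp add: cech_diff Cons.IH[OF d G])
    finally show ?thesis using True by simp
  next
    case False
    then have F: "F \<subseteq> set xs" using Cons.prems by auto
    have "cech xs (cech (x # xs) c) F = cech xs (cech xs c) F"
      by (rule cech_cong[OF F]) (use False in auto)
    moreover have "cech (x # xs) (cech (x # xs) c) F = cech xs (cech (x # xs) c) F"
      using False by (simp only: cech.simps if_False)
    ultimately show ?thesis using Cons.IH[OF d F] by (simp only:)
  qed
qed auto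

lemma cech_singleton: "x \<in> set xs \<Longrightarrow> distinct xs \<Longrightarrow> cech xs c {x} = c {}"
proof (induction xs arbitrary: c)
  case (Cons y xs)
  have e: "cech ys b {} = 0" for ys and b :: "'a set \<Rightarrow> 'b"
    by (induction ys arbitrary: b) auto
  show ?case using Cons e by auto
qed auto


text \<open>The entry of the bicomplex at \<open>(F, q)\<close> is \<open>A q\<close> modulo \<open>N q F\<close>; already \<open>A q\<close> is meant modulo \<open>N q {}\<close>.\<close>

locale torsion_bicomplex =
  fixes xs :: "'v list"
    and A :: "nat \<Rightarrow> 'g::ab_group_add set"
    and N :: "nat \<Rightarrow> 'v set \<Rightarrow> 'g set"
    and D :: "nat \<Rightarrow> 'g \<Rightarrow> 'g"
  assumes dist: "distinct xs"
    and A_0: "0 \<in> A q" and A_diff: "a \<in> A q \<Longrightarrow> b \<in> A q \<Longrightarrow> a - b \<in> A q"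
    and N_A: "F \<subseteq> set xs \<Longrightarrow> N q F \<subseteq> A q"
    and N_0: "F \<subseteq> set xs \<Longrightarrow> 0 \<in> N q F"
    and N_diff: "F \<subseteq> set xs \<Longrightarrow> a \<in> N q F \<Longrightarrow> b \<in> N q F \<Longrightarrow> a - b \<in> N q F"
    and N_mono: "F \<subseteq> G \<Longrightarrow> G \<subseteq> set xs \<Longrightarrow> N q F \<subseteq> N q G"
    and D_diff: "D q (a - b) = D q a - D q b"
    and D_A: "a \<in> A q \<Longrightarrow> D q a \<in> A (Suc q)"
    and D_N: "F \<subseteq> set xs \<Longrightarrow> a \<in> N q F \<Longrightarrow> D q a \<in> N (Suc q) F"
    and D_D: "a \<in> A q \<Longrightarrow> D (Suc q) (D q a) \<in> N (Suc (Suc q)) {}"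
    and N_split: "\<lbrakk>insert x F \<subseteq> set xs; T \<subseteq> set xs; x \<notin> F; x \<notin> T; a \<in> A q; \<forall>u\<in>T. a \<in> N q {u};
        a \<in> N q (insert x F)\<rbrakk> \<Longrightarrow> \<exists>t \<in> N q {x}. (\<forall>u\<in>T. t \<in> N q {u}) \<and> a - t \<in> N q F"
    and D_exact: "\<lbrakk>F \<subseteq> set xs; a \<in> A (Suc q); D (Suc q) a \<in> N (Suc (Suc q)) F\<rbrakk> \<Longrightarrow>
        \<exists>b \<in> A q. a - D q b \<in> N (Suc q) F"
begin

lemma A_add: "a \<in> A q \<Longrightarrow> b \<in> A q \<Longrightarrow> a + b \<in> A q"
  using A_diff[of a q "0 - b"] A_diff[OF A_0, of b] by simp

lemma N_add: "F \<subseteq> set xs \<Longrightarrow> a \<in> N q F \<Longrightarrow> b \<in> N q F \<Longrightarrow> a + b \<in> N q F"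
  using N_diff[of F a q "0 - b"] N_diff[of F 0 q b] N_0[of F q] by simp

lemma N_minus: "F \<subseteq> set xs \<Longrightarrow> a \<in> N q F \<Longrightarrow> - a \<in> N q F"
  using N_diff[of F 0 q a] N_0[of F q] by simp

lemma N_cong: "F \<subseteq> set xs \<Longrightarrow> a - b \<in> N q F \<Longrightarrow> a \<in> N q F \<longleftrightarrow> b \<in> N q F"
  using N_add[of F "a - b" q b] N_diff[of F a q "a - b"] by auto

section \<open>Cochains and congruence modulo \<open>N\<close>\<close>

definition cochains :: "nat \<Rightarrow> nat \<Rightarrow> ('v set \<Rightarrow> 'g) set" where
  "cochains p q = {c. \<forall>F \<subseteq> set xs. card F = p \<longrightarrow> c F \<in> A q}"

text \<open>These replace the zero cochain: an equation between cochains of the bicomplex is read as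
  membership of the difference in \<open>null\<close>.\<close>

definition null :: "nat \<Rightarrow> nat \<Rightarrow> ('v set \<Rightarrow> 'g) set" where
  "null p q = {c. \<forall>F \<subseteq> set xs. card F = p \<longrightarrow> c F \<in> N q F}"

lemma finite_sub: "F \<subseteq> set xs \<Longrightarrow> finite F"
  using finite_subset by blast

lemma card_Suc_diff: "F \<subseteq> set xs \<Longrightarrow> card F = Suc p \<Longrightarrow> v \<in> F \<Longrightarrow> card (F - {v}) = p"
  using finite_sub by auto

lemma cech_cochains: "c \<in> cochains p q \<Longrightarrow> cech xs c \<in> cochains (Suc p) q"
  unfolding cochains_def
proof (safe intro!: cech_in A_0 A_diff)
  fix F v
  assume c: "\<forall>F\<subseteq>set xs. card F = p \<longrightarrow> c F \<in> A q" and F: "F \<subseteq> set xs" "card F = Suc p" "v \<in> F"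
  then show "c (F - {v}) \<in> A q" using card_Suc_diff[OF F] by blast
qed

lemma cech_null: "c \<in> null p q \<Longrightarrow> cech xs c \<in> null (Suc p) q"
  unfolding null_def
proof (safe intro!: cech_in N_0 N_diff)
  fix F v
  assume c: "\<forall>F\<subseteq>set xs. card F = p \<longrightarrow> c F \<in> N q F" and F: "F \<subseteq> set xs" "card F = Suc p" "v \<in> F"
  then have "c (F - {v}) \<in> N q (F - {v})" using card_Suc_diff[OF F] by blast
  then show "c (F - {v}) \<in> N q F" using N_mono[of "F - {v}" F q] F by blast
qed

lemma nullI: "(\<And>F. F \<subseteq> set xs \<Longrightarrow> card F = p \<Longrightarrow> c F \<in> N q F) \<Longrightarrow> c \<in> null p q"
  and nullD: "c \<in> null p q \<Longrightarrow> F \<subseteq> set xs \<Longrightarrow> card F = p \<Longrightarrow> c F \<in> N q F"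
  unfolding null_def by blast+

lemma cochainsI: "(\<And>F. F \<subseteq> set xs \<Longrightarrow> card F = p \<Longrightarrow> c F \<in> A q) \<Longrightarrow> c \<in> cochains p q"
  and cochainsD: "c \<in> cochains p q \<Longrightarrow> F \<subseteq> set xs \<Longrightarrow> card F = p \<Longrightarrow> c F \<in> A q"
  unfolding cochains_def by blast+

lemma cochains_diff: "c \<in> cochains p q \<Longrightarrow> c' \<in> cochains p q \<Longrightarrow> (\<lambda>F. c F - c' F) \<in> cochains p q"
  by (rule cochainsI, rule A_diff) (erule (2) cochainsD)+

lemma null_cong:
  assumes "(\<lambda>F. c F - c' F) \<in> null p q"
  shows "c \<in> null p q \<longleftrightarrow> c' \<in> null p q"
proof
  assume c: "c \<in> null p q"
  have "c' F \<in> N q F" if F: "F \<subseteq> set xs" "card F = p" for F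
    using N_cong[OF F(1) nullD[OF assms F]] nullD[OF c F] by simp
  then show "c' \<in> null p q" by (rule nullI)
next
  assume c: "c' \<in> null p q"
  have "c F \<in> N q F" if F: "F \<subseteq> set xs" "card F = p" for F
    using N_cong[OF F(1) nullD[OF assms F]] nullD[OF c F] by simp
  then show "c \<in> null p q" by (rule nullI)
qed

lemma D_cochains: "c \<in> cochains p q \<Longrightarrow> (\<lambda>F. D q (c F)) \<in> cochains p (Suc q)"
  by (rule cochainsI, rule D_A) (erule (2) cochainsD)

lemma D_null: "c \<in> null p q \<Longrightarrow> (\<lambda>F. D q (c F)) \<in> null p (Suc q)"
  by (rule nullI, rule D_N, assumption) (erule (2) nullD)

lemma D_D_null: "c \<in> cochains p q \<Longrightarrow> (\<lambda>F. D (Suc q) (D q (c F))) \<in> null p (Suc (Suc q))"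
proof -
  assume c: "c \<in> cochains p q"
  have "D (Suc q) (D q (c F)) \<in> N (Suc (Suc q)) F" if "F \<subseteq> set xs" "card F = p" for F
    using D_D[OF cochainsD[OF c that]] N_mono[OF empty_subsetI that(1)] by blast
  then show ?thesis by (rule nullI)
qed

lemma cech_D: "cech xs (\<lambda>F. D q (c F)) = (\<lambda>F. D q (cech xs c F))"
  by (rule ext, rule cech_hom, rule D_diff)

lemma cech_cech_null: "cech xs (cech xs c) \<in> null p q"
proof -
  have "cech xs (cech xs c) F \<in> N q F" if "F \<subseteq> set xs" for F
    using cech_cech[OF dist that, of c] N_0[OF that] by simp
  then show ?thesis by (rule nullI)
qed

text \<open>This is the row over the variables \<open>ys\<close> with coefficients in the subgroup
  \<open>V\<close> of the elements lying in \<open>N q {u}\<close> for all \<open>u \<in> T\<close>.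
  Splitting off \<open>x\<close> leaves, for each \<open>F\<close> without \<open>x\<close>, an
  element of \<open>N q (insert x F)\<close>. Modulo \<open>N q F\<close> it comes from
  \<open>V \<inter> N q {x}\<close>, so what remains is a row over fewer variables with a smaller
  \<open>V\<close>. Hence \<open>T\<close> is carried through the induction, and
  \<open>N_split\<close> is required inside \<open>V\<close>.\<close>

lemma row_exact_aux:
  assumes "distinct ys" "set ys \<subseteq> set xs" "T \<subseteq> set xs" "set ys \<inter> T = {}"
    and "\<forall>F \<subseteq> set ys. card F = Suc p \<longrightarrow> c F \<in> A q \<and> (\<forall>u\<in>T. c F \<in> N q {u})"
    and "\<forall>F \<subseteq> set ys. card F = Suc (Suc p) \<longrightarrow> cech ys c F \<in> N q F"
  shows "\<exists>b. (\<forall>F \<subseteq> set ys. card F = p \<longrightarrow> b F \<in> A q \<and> (\<forall>u\<in>T. b F \<in> N q {u})) \<and>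
    (\<forall>F \<subseteq> set ys. card F = Suc p \<longrightarrow> c F - cech ys b F \<in> N q F)"
  using assms
proof (induction ys arbitrary: T c)
  case Nil
  have "{u} \<subseteq> set xs" if "u \<in> T" for u using Nil.prems(3) that by blast
  then have "0 \<in> A q \<and> (\<forall>u\<in>T. 0 \<in> N q {u})" using A_0 N_0 by simp
  then show ?case by (intro exI[of _ "\<lambda>_. 0"]) auto
next
  case (Cons x ys)
  let ?b = "\<lambda>G. c (insert x G)"
  have dx: "distinct ys" "x \<notin> set ys" "set ys \<subseteq> set xs" "x \<in> set xs" "x \<notin> T" "set ys \<inter> T = {}"
    using Cons.prems(1-4) by auto
  have fin: "finite F" if "F \<subseteq> set ys" for F
    using finite_subset[OF that finite_set] .
  have Nu: "u \<in> T \<Longrightarrow> {u} \<subseteq> set xs" for u using Cons.prems(3) by blast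
  have sub: "F \<subseteq> set ys \<Longrightarrow> F \<subseteq> set xs" for F using dx by blast
  have c1: "c F \<in> A q" "u \<in> T \<Longrightarrow> c F \<in> N q {u}" if "F \<subseteq> set ys" "card F = Suc p" for F u
  proof -
    have "F \<subseteq> set (x # ys)" using that by auto
    then show "c F \<in> A q" "u \<in> T \<Longrightarrow> c F \<in> N q {u}"
      using Cons.prems(5)[rule_format, of F] that(2) by blast+
  qed
  have b1: "?b F \<in> A q" "u \<in> T \<Longrightarrow> ?b F \<in> N q {u}" if "F \<subseteq> set ys" "card F = p" for F u
  proof -
    have "insert x F \<subseteq> set (x # ys)" "card (insert x F) = Suc p"
      using that dx fin[of F] by (auto simp: card_insert_if)
    then show "?b F \<in> A q" "u \<in> T \<Longrightarrow> ?b F \<in> N q {u}" using Cons.prems(5)[rule_format, of "insert x F"] by blast+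
  qed
  have crd: "card (F - {v}) = p" if "F \<subseteq> set ys" "card F = Suc p" "v \<in> F" for F v p
    using that fin by auto
  have db1: "cech ys ?b F \<in> A q" if F: "F \<subseteq> set ys" "card F = Suc p" for F
    by (rule cech_in[OF A_0 A_diff F(1)]) (use F crd[OF F] in \<open>auto intro!: b1(1)\<close>)
  have db2: "cech ys ?b F \<in> N q {u}" if F: "F \<subseteq> set ys" "card F = Suc p" and u: "u \<in> T" for F u
    by (rule cech_in[OF N_0[OF Nu[OF u]] N_diff[OF Nu[OF u]] F(1)])
      (use F crd[OF F] in \<open>auto intro!: b1(2) u\<close>)
  \<comment> \<open>The element to be split is \<open>cech (x # ys) c (insert x F)\<close>, which is
    null at \<open>insert x F\<close> by hypothesis.\<close>
  have "\<exists>t \<in> N q {x}. (\<forall>u\<in>T. t \<in> N q {u}) \<and> (c F - cech ys ?b F) - t \<in> N q F"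
    if F: "F \<subseteq> set ys" "card F = Suc p" for F
  proof (rule N_split)
    show "insert x F \<subseteq> set xs" "T \<subseteq> set xs" "x \<notin> F" "x \<notin> T" using F dx Cons.prems(3) by auto
    show "c F - cech ys ?b F \<in> A q" by (rule A_diff[OF c1(1)[OF F] db1[OF F]])
    show "\<forall>u\<in>T. c F - cech ys ?b F \<in> N q {u}" using N_diff[OF Nu c1(2)[OF F] db2[OF F]] by blast
    have "insert x F \<subseteq> set (x # ys)" "card (insert x F) = Suc (Suc p)"
      using F dx fin[of F] by (auto simp: card_insert_if)
    then have "cech (x # ys) c (insert x F) \<in> N q (insert x F)" using Cons.prems(6)[rule_format, of "insert x F"] by blast
    moreover have "insert x F - {x} = F" using F dx by auto
    ultimately show "c F - cech ys ?b F \<in> N q (insert x F)" by simp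
  qed
  then have "\<forall>F. \<exists>t. F \<subseteq> set ys \<and> card F = Suc p \<longrightarrow>
      t \<in> N q {x} \<and> (\<forall>u\<in>T. t \<in> N q {u}) \<and> (c F - cech ys ?b F) - t \<in> N q F"
    by blast
  from choice[OF this] obtain t where t: "\<And>F. F \<subseteq> set ys \<Longrightarrow> card F = Suc p \<Longrightarrow>
      t F \<in> N q {x} \<and> (\<forall>u\<in>T. t F \<in> N q {u}) \<and> (c F - cech ys ?b F) - t F \<in> N q F"
    by blast
  \<comment> \<open>Up to null terms \<open>t\<close> is \<open>c - cech ys ?b\<close>. On sets
    without \<open>x\<close> the cochain \<open>c\<close> is a cocycle, and
    \<open>cech ys ?b\<close> is one because the differential squares to zero.\<close>
  have tc: "\<forall>F \<subseteq> set ys. card F = Suc (Suc p) \<longrightarrow> cech ys t F \<in> N q F"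
  proof (intro allI impI)
    fix F assume F: "F \<subseteq> set ys" "card F = Suc (Suc p)"
    have "cech ys (\<lambda>F. (c F - cech ys ?b F) - t F) F \<in> N q F"
    proof (rule cech_in[OF N_0 N_diff])
      fix v assume "v \<in> F"
      then have "(c (F-{v}) - cech ys ?b (F-{v})) - t (F-{v}) \<in> N q (F-{v})"
        using t[of "F - {v}"] crd[OF F] F by blast
      then show "(c (F-{v}) - cech ys ?b (F-{v})) - t (F-{v}) \<in> N q F"
        using N_mono[of "F-{v}" F] sub[OF F(1)] by blast
    qed (use sub F in auto)
    then have "cech ys c F - cech ys t F \<in> N q F"
      by (simp add: cech_diff cech_cech[OF dx(1) F(1)])
    moreover have "cech ys c F \<in> N q F"
    proof -
      have "x \<notin> F" "F \<subseteq> set (x # ys)" using F dx by auto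
      then show ?thesis using Cons.prems(6)[rule_format, of F] F by simp
    qed
    ultimately show "cech ys t F \<in> N q F" using N_cong[OF sub[OF F(1)]] by blast
  qed
  have "\<exists>b. (\<forall>F \<subseteq> set ys. card F = p \<longrightarrow> b F \<in> A q \<and> (\<forall>u\<in>insert x T. b F \<in> N q {u})) \<and>
    (\<forall>F \<subseteq> set ys. card F = Suc p \<longrightarrow> t F - cech ys b F \<in> N q F)"
  proof (rule Cons.IH)
    have "N q {x} \<subseteq> A q" using N_A[of "{x}" q] dx by simp
    then show "\<forall>F\<subseteq>set ys. card F = Suc p \<longrightarrow> t F \<in> A q \<and> (\<forall>u\<in>insert x T. t F \<in> N q {u})"
      using t by blast
  qed (use dx Cons.prems(3) tc in \<open>simp_all\<close>)
  then obtain s where s: "\<And>F. F \<subseteq> set ys \<Longrightarrow> card F = p \<Longrightarrow>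
        s F \<in> A q \<and> (\<forall>u\<in>insert x T. s F \<in> N q {u})"
    and s2: "\<And>F. F \<subseteq> set ys \<Longrightarrow> card F = Suc p \<Longrightarrow> t F - cech ys s F \<in> N q F"
    by blast
  \<comment> \<open>On sets without \<open>x\<close>, \<open>cech ys ?e\<close> is congruent to
    \<open>t + (c - t)\<close>. On a set \<open>F\<close> containing \<open>x\<close> the error is
    \<open>- s (F - {x})\<close>, which is null because \<open>s\<close> was found inside
    \<open>N q {x}\<close>.\<close>
  let ?e = "\<lambda>F. if x \<in> F then 0 else s F + c (insert x F)"
  have e1: "?e F \<in> A q \<and> (\<forall>u\<in>T. ?e F \<in> N q {u})" if "F \<subseteq> set (x # ys)" "card F = p" for F
  proof (cases "x \<in> F")
    case True
    then show ?thesis using A_0 N_0[OF Nu] by simp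
  next
    case False
    then have "F \<subseteq> set ys" using that by auto
    then show ?thesis using that False s[of F] b1[of F] A_add N_add[OF Nu] by simp
  qed
  have e2: "c F - cech (x # ys) ?e F \<in> N q F" if F: "F \<subseteq> set (x # ys)" "card F = Suc p" for F
  proof (cases "x \<in> F")
    case False
    then have F': "F \<subseteq> set ys" using F by auto
    have "cech ys ?e F = cech ys (\<lambda>F. s F + ?b F) F"
      by (rule cech_cong[OF F']) (use False in auto)
    then have "cech ys ?e F = cech ys s F + cech ys ?b F" by (simp add: cech_add)
    then have "c F - cech (x # ys) ?e F = ((c F - cech ys ?b F) - t F) + (t F - cech ys s F)"
      using False by (simp add: algebra_simps)
    then show ?thesis using N_add[OF sub[OF F'] conjunct2[OF conjunct2[OF t[OF F' F(2)]]] s2[OF F' F(2)]]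
      by (simp only:)
  next
    case True
    let ?G = "F - {x}"
    have G: "?G \<subseteq> set ys" "card ?G = p" using F True finite_subset[OF F(1)] by auto
    have F': "F \<subseteq> set xs" using F(1) dx by auto
    have "c F - cech (x # ys) ?e F = - s ?G"
      using True by (simp add: insert_absorb cech_0)
    moreover have "s ?G \<in> N q F"
      using s[OF G] subsetD[OF N_mono[of "{x}" F q]] True F' by simp
    ultimately show ?thesis using N_minus[OF F'] by simp
  qed
  show ?case
  proof (intro exI[of _ ?e] conjI)
    show "\<forall>F\<subseteq>set (x # ys). card F = p \<longrightarrow> ?e F \<in> A q \<and> (\<forall>u\<in>T. ?e F \<in> N q {u})"
      using e1 by blast
    show "\<forall>F\<subseteq>set (x # ys). card F = Suc p \<longrightarrow> c F - cech (x # ys) ?e F \<in> N q F"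
      using e2 by blast
  qed
qed

lemma row_exact:
  assumes "c \<in> cochains (Suc p) q" "cech xs c \<in> null (Suc (Suc p)) q"
  obtains b where "b \<in> cochains p q" "(\<lambda>F. c F - cech xs b F) \<in> null (Suc p) q"
proof -
  have "\<exists>b. (\<forall>F \<subseteq> set xs. card F = p \<longrightarrow> b F \<in> A q \<and> (\<forall>u\<in>{}. b F \<in> N q {u})) \<and>
    (\<forall>F \<subseteq> set xs. card F = Suc p \<longrightarrow> c F - cech xs b F \<in> N q F)"
    using cochainsD[OF assms(1)] nullD[OF assms(2)] dist by (intro row_exact_aux) simp_all
  then obtain b where "\<And>F. F \<subseteq> set xs \<Longrightarrow> card F = p \<Longrightarrow> b F \<in> A q"
    "\<And>F. F \<subseteq> set xs \<Longrightarrow> card F = Suc p \<Longrightarrow> c F - cech xs b F \<in> N q F" by blast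
  then show ?thesis using that[of b] by (simp add: cochainsI nullI)
qed

lemma column_exact:
  assumes "c \<in> cochains p (Suc q)" "(\<lambda>F. D (Suc q) (c F)) \<in> null p (Suc (Suc q))"
  obtains b where "b \<in> cochains p q" "(\<lambda>F. c F - D q (b F)) \<in> null p (Suc q)"
proof -
  have "\<exists>b. b \<in> A q \<and> c F - D q b \<in> N (Suc q) F" if "F \<subseteq> set xs \<and> card F = p" for F
    using D_exact[OF _ cochainsD[OF assms(1)] nullD[OF assms(2)]] that by blast
  then have "\<forall>F. \<exists>b. F \<subseteq> set xs \<and> card F = p \<longrightarrow> b \<in> A q \<and> c F - D q b \<in> N (Suc q) F"
    by blast
  from choice[OF this] obtain b
    where "\<And>F. F \<subseteq> set xs \<and> card F = p \<Longrightarrow> b F \<in> A q \<and> c F - D q (b F) \<in> N (Suc q) F"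
    by blast
  then show ?thesis using that[of b] by (simp add: cochainsI nullI)
qed

section \<open>Cohomology along the two edges of the bicomplex\<close>

definition cocycle :: "nat \<Rightarrow> nat \<Rightarrow> ('v set \<Rightarrow> 'g) \<Rightarrow> bool" where
  "cocycle p q c \<longleftrightarrow> c \<in> cochains p q \<and> cech xs c \<in> null (Suc p) q \<and> (\<lambda>F. D q (c F)) \<in> null p (Suc q)"

text \<open>The kernels of the Cech differential in column \<open>p\<close> have no cohomology at
  \<open>q + 1\<close>. For \<open>p = 0\<close> these kernels will be the torsion submodules of the
  resolution, so that this concerns local cohomology in degree \<open>q + 1\<close>.\<close>

definition vertical_vanishing :: "nat \<Rightarrow> nat \<Rightarrow> bool" where
  "vertical_vanishing p q \<longleftrightarrow> (\<forall>c. cocycle p (Suc q) c \<longrightarrow>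
    (\<exists>b \<in> cochains p q. cech xs b \<in> null (Suc p) q \<and> (\<lambda>F. c F - D q (b F)) \<in> null p (Suc q)))"

text \<open>The kernels of \<open>D 0\<close> in row 0 have no cohomology at \<open>p + 1\<close>.
  In the application these kernels are the localisations of \<open>R\<close>, so that this concerns
  Cech cohomology of \<open>R\<close> in degree \<open>p + 1\<close>.\<close>

definition horizontal_vanishing :: "nat \<Rightarrow> bool" where
  "horizontal_vanishing p \<longleftrightarrow> (\<forall>c. cocycle (Suc p) 0 c \<longrightarrow>
    (\<exists>b \<in> cochains p 0. (\<lambda>F. D 0 (b F)) \<in> null p (Suc 0) \<and>
       (\<lambda>F. c F - cech xs b F) \<in> null (Suc p) 0))"

lemma null_trans:
  "(\<lambda>F. a F - b F) \<in> null p q \<Longrightarrow> (\<lambda>F. b F - c F) \<in> null p q \<Longrightarrow> (\<lambda>F. a F - c F) \<in> null p q"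
proof (rule nullI)
  fix F assume a: "(\<lambda>F. a F - b F) \<in> null p q" "(\<lambda>F. b F - c F) \<in> null p q"
    and F: "F \<subseteq> set xs" "card F = p"
  show "a F - c F \<in> N q F" using N_add[OF F(1) nullD[OF a(1) F] nullD[OF a(2) F]] by simp
qed

text \<open>The dimension shift: a step down a column is traded for a step to the right along a row.\<close>

lemma cech_of_primitive:
  assumes c: "cocycle p (Suc q) c" and b: "b \<in> cochains p q"
    and cb: "(\<lambda>F. c F - D q (b F)) \<in> null p (Suc q)"
  shows "cocycle (Suc p) q (cech xs b)"
proof -
  have "cech xs (\<lambda>F. c F - D q (b F)) \<in> null (Suc p) (Suc q)" using cech_null cb by blast
  then have "(\<lambda>F. cech xs c F - D q (cech xs b F)) \<in> null (Suc p) (Suc q)"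
    by (simp add: cech_diff[abs_def] cech_D)
  from null_cong[OF this] have "(\<lambda>F. D q (cech xs b F)) \<in> null (Suc p) (Suc q)"
    using c unfolding cocycle_def by simp
  then show ?thesis unfolding cocycle_def using cech_cochains[OF b] cech_cech_null by blast
qed

lemma D_of_primitive:
  assumes c: "cocycle (Suc p) q c" and b: "b \<in> cochains p q"
    and cb: "(\<lambda>F. c F - cech xs b F) \<in> null (Suc p) q"
  shows "cocycle p (Suc q) (\<lambda>F. D q (b F))"
proof -
  have "(\<lambda>F. D q (c F) - D q (cech xs b F)) \<in> null (Suc p) (Suc q)"
    using D_null[OF cb] by (simp add: D_diff)
  from null_cong[OF this] have "cech xs (\<lambda>F. D q (b F)) \<in> null (Suc p) (Suc q)"
    using c unfolding cocycle_def cech_D by simp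
  then show ?thesis unfolding cocycle_def using D_cochains[OF b] D_D_null[OF b] by blast
qed

text \<open>A cochain \<open>b\<close> at \<open>(p, q + 1)\<close> links the class of
  \<open>D b\<close> at \<open>(p, q + 2)\<close> with that of \<open>cech b\<close> at
  \<open>(p + 1, q + 1)\<close>. If one of them is trivial, \<open>b\<close> can be altered without
  changing the other, and exactness of a row or a column trivialises that one too.\<close>

lemma vertical_vanishing_Suc: "vertical_vanishing p (Suc q) \<longleftrightarrow> vertical_vanishing (Suc p) q"
proof
  assume V: "vertical_vanishing p (Suc q)"
  show "vertical_vanishing (Suc p) q"
    unfolding vertical_vanishing_def
  proof (intro allI impI)
    fix c assume c: "cocycle (Suc p) (Suc q) c"
    obtain b where b: "b \<in> cochains p (Suc q)" and cb: "(\<lambda>F. c F - cech xs b F) \<in> null (Suc p) (Suc q)"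
      using row_exact c unfolding cocycle_def by blast
    obtain b1 where b1: "b1 \<in> cochains p (Suc q)" "cech xs b1 \<in> null (Suc p) (Suc q)"
      "(\<lambda>F. D (Suc q) (b F) - D (Suc q) (b1 F)) \<in> null p (Suc (Suc q))"
      using V D_of_primitive[OF c b cb] unfolding vertical_vanishing_def by blast
    \<comment> \<open>Subtracting \<open>b1\<close> preserves the Cech differential and makes
      \<open>D\<close> null, so that column exactness applies to the difference.\<close>
    let ?b = "\<lambda>F. b F - b1 F"
    have "?b \<in> cochains p (Suc q)" using cochains_diff b b1 by blast
    moreover have "(\<lambda>F. D (Suc q) (?b F)) \<in> null p (Suc (Suc q))" using b1 by (simp add: D_diff)
    ultimately obtain b2 where b2: "b2 \<in> cochains p q" "(\<lambda>F. ?b F - D q (b2 F)) \<in> null p (Suc q)"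
      using column_exact by blast
    have "(\<lambda>F. (cech xs b F - cech xs b1 F) - D q (cech xs b2 F)) \<in> null (Suc p) (Suc q)"
      using cech_null[OF b2(2)] by (simp add: cech_diff[abs_def] cech_D)
    note b2' = this
    have "(\<lambda>F. cech xs b F - (cech xs b F - cech xs b1 F)) \<in> null (Suc p) (Suc q)"
      using b1 by simp
    from null_trans[OF cb null_trans[OF this b2']]
    have "(\<lambda>F. c F - D q (cech xs b2 F)) \<in> null (Suc p) (Suc q)" .
    then show "\<exists>b\<in>cochains (Suc p) q. cech xs b \<in> null (Suc (Suc p)) q \<and>
        (\<lambda>F. c F - D q (b F)) \<in> null (Suc p) (Suc q)"
      using cech_cochains[OF b2(1)] cech_cech_null by blast
  qed
next
  assume V: "vertical_vanishing (Suc p) q"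
  show "vertical_vanishing p (Suc q)"
    unfolding vertical_vanishing_def
  proof (intro allI impI)
    fix c assume c: "cocycle p (Suc (Suc q)) c"
    obtain b where b: "b \<in> cochains p (Suc q)" and cb: "(\<lambda>F. c F - D (Suc q) (b F)) \<in> null p (Suc (Suc q))"
      using column_exact c unfolding cocycle_def by blast
    obtain b1 where b1: "b1 \<in> cochains (Suc p) q" "cech xs b1 \<in> null (Suc (Suc p)) q"
      "(\<lambda>F. cech xs b F - D q (b1 F)) \<in> null (Suc p) (Suc q)"
      using V cech_of_primitive[OF c b cb] unfolding vertical_vanishing_def by blast
    obtain b2 where b2: "b2 \<in> cochains p q" "(\<lambda>F. b1 F - cech xs b2 F) \<in> null (Suc p) q"
      using row_exact b1 by blast
    \<comment> \<open>Subtracting \<open>D q b2\<close> preserves \<open>D (Suc q) b\<close>, while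
      the Cech differential of \<open>b\<close>, congruent to \<open>D q b1\<close> and hence to
      \<open>D q (cech xs b2)\<close>, is cancelled.\<close>
    let ?b = "\<lambda>F. b F - D q (b2 F)"
    have "?b \<in> cochains p (Suc q)" using cochains_diff b b2 D_cochains by blast
    moreover have "cech xs ?b \<in> null (Suc p) (Suc q)"
    proof -
      have "(\<lambda>F. D q (b1 F) - D q (cech xs b2 F)) \<in> null (Suc p) (Suc q)"
        using D_null[OF b2(2)] by (simp add: D_diff)
      from null_trans[OF b1(3) this]
      have "(\<lambda>F. cech xs b F - D q (cech xs b2 F)) \<in> null (Suc p) (Suc q)" .
      then show ?thesis by (simp add: cech_diff[abs_def] cech_D)
    qed
    moreover have "(\<lambda>F. c F - D (Suc q) (?b F)) \<in> null p (Suc (Suc q))"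
    proof (rule null_trans[OF cb])
      show "(\<lambda>F. D (Suc q) (b F) - D (Suc q) (?b F)) \<in> null p (Suc (Suc q))"
        using D_D_null[OF b2(1)] by (simp add: D_diff)
    qed
    ultimately show "\<exists>b\<in>cochains p (Suc q). cech xs b \<in> null (Suc p) (Suc q) \<and>
        (\<lambda>F. c F - D (Suc q) (b F)) \<in> null p (Suc (Suc q))" by blast
  qed
qed

text \<open>At the corner of the bicomplex \<open>b - b1\<close> is itself the primitive sought in
  both directions.\<close>

lemma vertical_vanishing_0: "vertical_vanishing p 0 \<longleftrightarrow> horizontal_vanishing p"
proof
  assume V: "vertical_vanishing p 0"
  show "horizontal_vanishing p"
    unfolding horizontal_vanishing_def
  proof (intro allI impI)
    fix c assume c: "cocycle (Suc p) 0 c"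
    obtain b where b: "b \<in> cochains p 0" and cb: "(\<lambda>F. c F - cech xs b F) \<in> null (Suc p) 0"
      using row_exact c unfolding cocycle_def by blast
    obtain b1 where b1: "b1 \<in> cochains p 0" "cech xs b1 \<in> null (Suc p) 0"
      "(\<lambda>F. D 0 (b F) - D 0 (b1 F)) \<in> null p (Suc 0)"
      using V D_of_primitive[OF c b cb] unfolding vertical_vanishing_def by blast
    let ?b = "\<lambda>F. b F - b1 F"
    have "(\<lambda>F. cech xs b F - cech xs ?b F) \<in> null (Suc p) 0"
      using b1 by (simp add: cech_diff)
    from null_trans[OF cb this] have "(\<lambda>F. c F - cech xs ?b F) \<in> null (Suc p) 0" .
    moreover have "(\<lambda>F. D 0 (?b F)) \<in> null p (Suc 0)" using b1 by (simp add: D_diff)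
    ultimately show "\<exists>b\<in>cochains p 0. (\<lambda>F. D 0 (b F)) \<in> null p (Suc 0) \<and>
       (\<lambda>F. c F - cech xs b F) \<in> null (Suc p) 0"
      by (intro bexI[OF _ cochains_diff[OF b b1(1)]] conjI)
  qed
next
  assume V: "horizontal_vanishing p"
  show "vertical_vanishing p 0"
    unfolding vertical_vanishing_def
  proof (intro allI impI)
    fix c assume c: "cocycle p (Suc 0) c"
    obtain b where b: "b \<in> cochains p 0" and cb: "(\<lambda>F. c F - D 0 (b F)) \<in> null p (Suc 0)"
      using column_exact c unfolding cocycle_def by blast
    obtain b1 where b1: "b1 \<in> cochains p 0" "(\<lambda>F. D 0 (b1 F)) \<in> null p (Suc 0)"
      "(\<lambda>F. cech xs b F - cech xs b1 F) \<in> null (Suc p) 0"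
      using V cech_of_primitive[OF c b cb] unfolding horizontal_vanishing_def by blast
    let ?b = "\<lambda>F. b F - b1 F"
    have "(\<lambda>F. D 0 (b F) - D 0 (?b F)) \<in> null p (Suc 0)" using b1 by (simp add: D_diff)
    from null_trans[OF cb this] have "(\<lambda>F. c F - D 0 (?b F)) \<in> null p (Suc 0)" .
    moreover have "cech xs ?b \<in> null (Suc p) 0" using b1 by (simp add: cech_diff[abs_def])
    ultimately show "\<exists>b\<in>cochains p 0. cech xs b \<in> null (Suc p) 0 \<and>
       (\<lambda>F. c F - D 0 (b F)) \<in> null p (Suc 0)"
      by (intro bexI[OF _ cochains_diff[OF b b1(1)]] conjI)
  qed
qed

lemma vertical_iff_horizontal: "vertical_vanishing 0 i \<longleftrightarrow> horizontal_vanishing i"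
proof -
  have "vertical_vanishing p i \<longleftrightarrow> horizontal_vanishing (p + i)" for p
    by (induction i arbitrary: p) (simp_all add: vertical_vanishing_0 vertical_vanishing_Suc)
  from this[of 0] show ?thesis by simp
qed

text \<open>Only the empty set has size 0, and the Cech differential copies the value there to every
  singleton. So Cech cocycles in column 0 are the elements lying in every
  \<open>N q {v}\<close>.\<close>

lemma vertical_vanishing_iff:
  "vertical_vanishing 0 i \<longleftrightarrow>
    (\<forall>z \<in> A (Suc i). (\<forall>v\<in>set xs. z \<in> N (Suc i) {v}) \<and> D (Suc i) z \<in> N (Suc (Suc i)) {} \<longrightarrow>
      (\<exists>w \<in> A i. (\<forall>v\<in>set xs. w \<in> N i {v}) \<and> z - D i w \<in> N (Suc i) {}))"
    (is "_ \<longleftrightarrow> ?R")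
proof -
  have 0: "F = {}" if "F \<subseteq> set xs" "card F = 0" for F using finite_sub[OF that(1)] that(2) by simp
  have co: "c \<in> cochains 0 q \<longleftrightarrow> c {} \<in> A q" for c q
  proof
    assume "c {} \<in> A q"
    then show "c \<in> cochains 0 q" by (intro cochainsI) (drule (1) 0, simp)
  qed (auto dest: cochainsD[OF _ empty_subsetI])
  have nu: "c \<in> null 0 q \<longleftrightarrow> c {} \<in> N q {}" for c q
  proof
    assume "c {} \<in> N q {}"
    then show "c \<in> null 0 q" by (intro nullI) (drule (1) 0, simp)
  qed (auto dest: nullD[OF _ empty_subsetI])
  have ce: "cech xs c \<in> null (Suc 0) q \<longleftrightarrow> (\<forall>v\<in>set xs. c {} \<in> N q {v})" for c q
  proof
    assume a: "cech xs c \<in> null (Suc 0) q"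
    show "\<forall>v\<in>set xs. c {} \<in> N q {v}"
    proof
      fix v assume "v \<in> set xs"
      then show "c {} \<in> N q {v}"
        using nullD[OF a, of "{v}"] cech_singleton[OF _ dist, of v c] by simp
    qed
  next
    assume a: "\<forall>v\<in>set xs. c {} \<in> N q {v}"
    show "cech xs c \<in> null (Suc 0) q"
    proof (rule nullI)
      fix F assume F: "F \<subseteq> set xs" "card F = Suc 0"
      then obtain v where "F = {v}" using card_1_singletonE by auto
      then show "cech xs c F \<in> N q F" using a F cech_singleton[OF _ dist, of v c] by simp
    qed
  qed
  show ?thesis
  proof
    assume V: "vertical_vanishing 0 i"
    show ?R
    proof (intro ballI impI)
      fix z assume "z \<in> A (Suc i)" "(\<forall>v\<in>set xs. z \<in> N (Suc i) {v}) \<and> D (Suc i) z \<in> N (Suc (Suc i)) {}"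
      then have "cocycle 0 (Suc i) (\<lambda>_. z)" unfolding cocycle_def co nu ce by simp
      then obtain b where "b \<in> cochains 0 i" "cech xs b \<in> null (Suc 0) i"
        "(\<lambda>F. z - D i (b F)) \<in> null 0 (Suc i)"
        using V[unfolded vertical_vanishing_def, rule_format, of "\<lambda>_. z"] by blast
      then show "\<exists>w\<in>A i. (\<forall>v\<in>set xs. w \<in> N i {v}) \<and> z - D i w \<in> N (Suc i) {}"
        unfolding co nu ce by blast
    qed
  next
    assume V: ?R
    show "vertical_vanishing 0 i"
      unfolding vertical_vanishing_def
    proof (intro allI impI)
      fix c assume "cocycle 0 (Suc i) c"
      then obtain w where "w \<in> A i" "\<forall>v\<in>set xs. w \<in> N i {v}" "c {} - D i w \<in> N (Suc i) {}"
        using V unfolding cocycle_def co nu ce by blast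
      then show "\<exists>b\<in>cochains 0 i. cech xs b \<in> null (Suc 0) i \<and> (\<lambda>F. c F - D i (b F)) \<in> null 0 (Suc i)"
        by (intro bexI[of _ "\<lambda>_. w"]) (simp_all add: co nu ce)
    qed
  qed
qed

end

section \<open>Graded modules and graded injectivity\<close>

text \<open>Only additivity is asked of \<open>h\<close>, so that homogeneous maps of any degree and
  the evaluation of constant sequences are covered alike.\<close>

lemma finsum_additive:
  assumes "abelian_group M" "abelian_group M'" "h \<in> carrier M \<rightarrow> carrier M'"
    and "\<And>x y. x \<in> carrier M \<Longrightarrow> y \<in> carrier M \<Longrightarrow> h (x \<oplus>\<^bsub>M\<^esub> y) = h x \<oplus>\<^bsub>M'\<^esub> h y"
    and "finite J" "f \<in> J \<rightarrow> carrier M"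
  shows "h (finsum M f J) = finsum M' (\<lambda>j. h (f j)) J"
proof -
  interpret M: abelian_group M by fact
  interpret M': abelian_group M' by fact
  have h0: "h \<zero>\<^bsub>M\<^esub> = \<zero>\<^bsub>M'\<^esub>"
  proof -
    have "h \<zero>\<^bsub>M\<^esub> = h \<zero>\<^bsub>M\<^esub> \<oplus>\<^bsub>M'\<^esub> h \<zero>\<^bsub>M\<^esub>" using assms(4)[of "\<zero>\<^bsub>M\<^esub>" "\<zero>\<^bsub>M\<^esub>"] by simp
    moreover have "h \<zero>\<^bsub>M\<^esub> \<in> carrier M'" using assms(3) by auto
    ultimately show ?thesis using M'.add.l_cancel_one' by metis
  qed
  from assms(5,6) show ?thesis
  proof (induction J)
    case (insert j J)
    have f: "f \<in> J \<rightarrow> carrier M" "f j \<in> carrier M" using insert.prems by auto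
    have hf: "(\<lambda>j. h (f j)) \<in> J \<rightarrow> carrier M'" "h (f j) \<in> carrier M'" using f assms(3) by auto
    show ?case
      using insert f hf by (simp add: M.finsum_insert M'.finsum_insert assms(4) M.finsum_closed)
  qed (simp add: h0)
qed

definition component :: "('a, 'm, 'x) graded_module_scheme \<Rightarrow> int \<Rightarrow> 'm \<Rightarrow> 'm" where
  "component M j x = (THE f. (\<forall>j. f j \<in> mgrade M j) \<and> finite {j. f j \<noteq> \<zero>\<^bsub>M\<^esub>} \<and>
     x = (\<Oplus>\<^bsub>M\<^esub>j\<in>{j. f j \<noteq> \<zero>\<^bsub>M\<^esub>}. f j)) j"

context graded_module
begin

lemma mgrade_closed: "x \<in> mgrade M j \<Longrightarrow> x \<in> carrier M"
  using additive_subgroup.a_Hcarr[OF mgrade_subgroup] by blast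

lemma mgrade_zero: "\<zero>\<^bsub>M\<^esub> \<in> mgrade M j"
  using additive_subgroup.zero_closed[OF mgrade_subgroup] .

lemma mgrade_add: "x \<in> mgrade M j \<Longrightarrow> y \<in> mgrade M j \<Longrightarrow> x \<oplus>\<^bsub>M\<^esub> y \<in> mgrade M j"
  using additive_subgroup.a_closed[OF mgrade_subgroup] .

lemma component_ex1:
  assumes "x \<in> carrier M"
  shows "(\<forall>j. component M j x \<in> mgrade M j) \<and> finite {j. component M j x \<noteq> \<zero>\<^bsub>M\<^esub>} \<and>
     x = (\<Oplus>\<^bsub>M\<^esub>j\<in>{j. component M j x \<noteq> \<zero>\<^bsub>M\<^esub>}. component M j x)"
  using theI'[OF mgrade_direct_sum[OF assms]] unfolding component_def .

lemma component_in: "x \<in> carrier M \<Longrightarrow> component M j x \<in> mgrade M j"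
  using component_ex1 by blast

lemma component_carrier: "x \<in> carrier M \<Longrightarrow> component M j x \<in> carrier M"
  using component_in mgrade_closed by blast

text \<open>\<open>J\<close> may exceed the support, which spares computing supports after a
  reindexing or an addition.\<close>

lemma component_unique:
  assumes J: "finite J" and f: "\<And>j. f j \<in> mgrade M j" "\<And>j. j \<notin> J \<Longrightarrow> f j = \<zero>\<^bsub>M\<^esub>"
    and x: "x = (\<Oplus>\<^bsub>M\<^esub>j\<in>J. f j)"
  shows "component M j x = f j"
proof -
  let ?K = "{j. f j \<noteq> \<zero>\<^bsub>M\<^esub>}"
  have K: "?K \<subseteq> J" using f(2) by auto
  have fc: "f \<in> J \<rightarrow> carrier M" for J using f(1) mgrade_closed by auto
  have "(\<Oplus>\<^bsub>M\<^esub>j\<in>?K. f j) = (\<Oplus>\<^bsub>M\<^esub>j\<in>J. f j)"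
    by (rule M.add.finprod_mono_neutral_cong_left[OF J K]) (use fc in auto)
  then have "(\<forall>j. f j \<in> mgrade M j) \<and> finite ?K \<and> x = (\<Oplus>\<^bsub>M\<^esub>j\<in>?K. f j)"
    using f K J x finite_subset by auto
  moreover have "x \<in> carrier M" using x fc M.finsum_closed by simp
  ultimately have "(THE f. (\<forall>j. f j \<in> mgrade M j) \<and> finite {j. f j \<noteq> \<zero>\<^bsub>M\<^esub>} \<and>
     x = (\<Oplus>\<^bsub>M\<^esub>j\<in>{j. f j \<noteq> \<zero>\<^bsub>M\<^esub>}. f j)) = f"
    using the1_equality[OF mgrade_direct_sum] by blast
  then show ?thesis unfolding component_def by simp
qed

lemma component_sum:
  assumes "x \<in> carrier M"
  shows "\<exists>J. finite J \<and> (\<forall>j. j \<notin> J \<longrightarrow> component M j x = \<zero>\<^bsub>M\<^esub>) \<and>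
    x = (\<Oplus>\<^bsub>M\<^esub>j\<in>J. component M j x)"
  using component_ex1[OF assms] by (intro exI[of _ "{j. component M j x \<noteq> \<zero>\<^bsub>M\<^esub>}"]) simp

lemma component_sum_superset:
  assumes "x \<in> carrier M" "finite J" "\<And>j. j \<notin> J \<Longrightarrow> component M j x = \<zero>\<^bsub>M\<^esub>"
  shows "x = (\<Oplus>\<^bsub>M\<^esub>j\<in>J. component M j x)"
proof -
  let ?K = "{j. component M j x \<noteq> \<zero>\<^bsub>M\<^esub>}"
  have "(\<Oplus>\<^bsub>M\<^esub>j\<in>?K. component M j x) = (\<Oplus>\<^bsub>M\<^esub>j\<in>J. component M j x)"
    by (rule M.add.finprod_mono_neutral_cong_left[OF assms(2)])
      (use assms component_carrier in auto)
  then show ?thesis using component_ex1[OF assms(1)] by simp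
qed

lemma component_homogeneous:
  assumes "x \<in> mgrade M j"
  shows "component M i x = (if i = j then x else \<zero>\<^bsub>M\<^esub>)"
proof (rule component_unique[where J="{j}"])
  show "x = (\<Oplus>\<^bsub>M\<^esub>i\<in>{j}. if i = j then x else \<zero>\<^bsub>M\<^esub>)"
    using assms mgrade_closed by simp
qed (use assms mgrade_zero in auto)

lemma component_add:
  assumes x: "x \<in> carrier M" and y: "y \<in> carrier M"
  shows "component M i (x \<oplus>\<^bsub>M\<^esub> y) = component M i x \<oplus>\<^bsub>M\<^esub> component M i y"
proof -
  obtain J where J: "finite J" "\<And>j. j \<notin> J \<Longrightarrow> component M j x = \<zero>\<^bsub>M\<^esub>" using component_sum[OF x] by blast
  obtain K where K: "finite K" "\<And>j. j \<notin> K \<Longrightarrow> component M j y = \<zero>\<^bsub>M\<^esub>" using component_sum[OF y] by blast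
  show ?thesis
  proof (rule component_unique[where J = "J \<union> K"])
    have "x = (\<Oplus>\<^bsub>M\<^esub>j\<in>J\<union>K. component M j x)" "y = (\<Oplus>\<^bsub>M\<^esub>j\<in>J\<union>K. component M j y)"
      by (rule component_sum_superset; use x y J K in simp)+
    then show "x \<oplus>\<^bsub>M\<^esub> y = (\<Oplus>\<^bsub>M\<^esub>j\<in>J\<union>K. component M j x \<oplus>\<^bsub>M\<^esub> component M j y)"
      using M.finsum_addf[of "\<lambda>j. component M j x" "J \<union> K" "\<lambda>j. component M j y"]
        component_carrier x y by simp
  qed (use J K x y in \<open>auto intro!: mgrade_add component_in\<close>)
qed

end

text \<open>\<open>h\<close> carries the decomposition of \<open>x\<close> to one of
  \<open>h x\<close> with indices shifted by \<open>k\<close>. The shift is 0 for morphisms and the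
  degree of the factor for multiplication by a homogeneous ring element.\<close>

lemma component_additive:
  assumes M: "graded_module R M" and M': "graded_module R M'"
    and h: "h \<in> carrier M \<rightarrow> carrier M'"
      "\<And>x y. x \<in> carrier M \<Longrightarrow> y \<in> carrier M \<Longrightarrow> h (x \<oplus>\<^bsub>M\<^esub> y) = h x \<oplus>\<^bsub>M'\<^esub> h y"
      "\<And>i x. x \<in> mgrade M i \<Longrightarrow> h x \<in> mgrade M' (i + k)"
    and x: "x \<in> carrier M"
  shows "component M' (i + k) (h x) = h (component M i x)"
proof -
  interpret M: graded_module R M by fact
  interpret M': graded_module R M' by fact
  have ab: "abelian_group M" "abelian_group M'"
    by (rule M.abelian_group_axioms M'.abelian_group_axioms)+
  obtain J where J: "finite J" "\<And>j. j \<notin> J \<Longrightarrow> component M j x = \<zero>\<^bsub>M\<^esub>"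
    "x = (\<Oplus>\<^bsub>M\<^esub>j\<in>J. component M j x)" using M.component_sum[OF x] by blast
  have h0: "h \<zero>\<^bsub>M\<^esub> = \<zero>\<^bsub>M'\<^esub>"
    using finsum_additive[OF ab h(1,2), of "{}" undefined] by simp
  let ?f = "\<lambda>j. h (component M (j - k) x)"
  have hc: "h (component M j x) \<in> carrier M'" for j using h(1) M.component_carrier[OF x] by auto
  have "component M' (i + k) (h x) = ?f (i + k)"
  proof (rule M'.component_unique[where J = "(\<lambda>j. j + k) ` J"])
    show "?f j \<in> mgrade M' j" for j
      using h(3)[OF M.component_in[OF x, of "j - k"]] by simp
    show "?f j = \<zero>\<^bsub>M'\<^esub>" if "j \<notin> (\<lambda>j. j + k) ` J" for j
    proof -
      have "j - k \<notin> J" using that by (auto simp: image_iff)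
      then show ?thesis using J(2) h0 by simp
    qed
    have "h x = (\<Oplus>\<^bsub>M'\<^esub>j\<in>J. h (component M j x))"
      by (subst J(3), rule finsum_additive[OF ab h(1,2) J(1)]) (auto simp: M.component_carrier[OF x])
    also have "\<dots> = (\<Oplus>\<^bsub>M'\<^esub>j\<in>(\<lambda>j. j + k) ` J. ?f j)"
      by (subst M'.M.finsum_reindex) (auto simp: hc)
    finally show "h x = (\<Oplus>\<^bsub>M'\<^esub>j\<in>(\<lambda>j. j + k) ` J. ?f j)" .
  qed (use J in auto)
  then show ?thesis by simp
qed

lemma component_graded_hom:
  assumes "graded_module R M" "graded_module R M'" "h \<in> graded_hom R M M'" "x \<in> carrier M"
  shows "component M' i (h x) = h (component M i x)"
proof -
  have h: "h \<in> carrier M \<rightarrow> carrier M'"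
    "\<And>x y. x \<in> carrier M \<Longrightarrow> y \<in> carrier M \<Longrightarrow> h (x \<oplus>\<^bsub>M\<^esub> y) = h x \<oplus>\<^bsub>M'\<^esub> h y"
    "\<And>i x. x \<in> mgrade M i \<Longrightarrow> h x \<in> mgrade M' (i + 0)"
    using assms(3) unfolding graded_hom_def by (auto simp: image_subset_iff)
  show ?thesis using component_additive[OF assms(1,2) h assms(4), of i] by simp
qed

lemma component_smult:
  assumes "graded_module R M" "a \<in> rgrade R s" "a \<in> carrier R" "x \<in> carrier M"
  shows "component M (i + s) (a \<odot>\<^bsub>M\<^esub> x) = a \<odot>\<^bsub>M\<^esub> component M i x"
proof -
  interpret graded_module R M by fact
  show ?thesis
    by (rule component_additive[OF assms(1,1)])
      (use assms mgrade_smult[OF assms(2)] in \<open>auto simp: smult_r_distr add.commute\<close>)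
qed

text \<open>The test modules of the injectivity property: a graded ideal, shifted in degree, carried by constant sequences.\<close>

definition shifted_ideal ::
  "('a, 'r) graded_ring_scheme \<Rightarrow> 'a set \<Rightarrow> int \<Rightarrow> ('a, nat \<Rightarrow> 'a) graded_module" where
  "shifted_ideal R U k =
    \<lparr>carrier = (\<lambda>r _. r) ` U, monoid.mult = (\<lambda>f g. f), one = (\<lambda>_. \<zero>\<^bsub>R\<^esub>), ring.zero = (\<lambda>_. \<zero>\<^bsub>R\<^esub>),
     ring.add = (\<lambda>f g _. f 0 \<oplus>\<^bsub>R\<^esub> g 0), module.smult = (\<lambda>a f _. a \<otimes>\<^bsub>R\<^esub> f 0),
     mgrade = (\<lambda>j. (\<lambda>r _. r) ` (U \<inter> rgrade R (j - k)))\<rparr>"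

lemma regular_module_simps [simp]:
  "carrier (regular_module R) = carrier R" "\<zero>\<^bsub>regular_module R\<^esub> = \<zero>\<^bsub>R\<^esub>"
  "x \<oplus>\<^bsub>regular_module R\<^esub> y = x \<oplus>\<^bsub>R\<^esub> y" "a \<odot>\<^bsub>regular_module R\<^esub> y = a \<otimes>\<^bsub>R\<^esub> y"
  "mgrade (regular_module R) = rgrade R"
  by (simp_all add: regular_module_def)

lemma shifted_ideal_simps [simp]:
  "carrier (shifted_ideal R U k) = (\<lambda>r _. r) ` U" "\<zero>\<^bsub>shifted_ideal R U k\<^esub> = (\<lambda>_. \<zero>\<^bsub>R\<^esub>)"
  "f \<oplus>\<^bsub>shifted_ideal R U k\<^esub> g = (\<lambda>_. f 0 \<oplus>\<^bsub>R\<^esub> g 0)" "a \<odot>\<^bsub>shifted_ideal R U k\<^esub> f = (\<lambda>_. a \<otimes>\<^bsub>R\<^esub> f 0)"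
  "mgrade (shifted_ideal R U k) = (\<lambda>j. (\<lambda>r _. r) ` (U \<inter> rgrade R (j - k)))"
  by (simp_all add: shifted_ideal_def)

text \<open>A constant sequence is determined by its value at 0, and evaluation at 0 is additive, so
  existence and uniqueness of homogeneous decompositions are inherited from \<open>R\<close>. The
  assumption \<open>comp\<close> says that \<open>U\<close> is a homogeneous ideal and keeps the
  components inside it.\<close>

lemma shifted_ideal_graded_module:
  fixes R :: "('a, 'r) graded_ring_scheme"
  assumes R: "graded_module R (regular_module R)" and U: "ideal U R"
    and comp: "\<And>r i. r \<in> U \<Longrightarrow> component (regular_module R) i r \<in> U"
  shows "graded_module R (shifted_ideal R U k)"
proof -
  interpret R: graded_module R "regular_module R" by fact
  interpret U: ideal U R by fact
  note U_0 = additive_subgroup.zero_closed[OF ideal.axioms(1)[OF U]]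
    and U_add = additive_subgroup.a_closed[OF ideal.axioms(1)[OF U]]
    and U_uminus = additive_subgroup.a_inv_closed[OF ideal.axioms(1)[OF U]]
  let ?A = "shifted_ideal R U k"
  have A: "abelian_group ?A"
  proof (rule abelian_groupI)
    fix x assume "x \<in> carrier ?A"
    then obtain r where r: "x = (\<lambda>_. r)" "r \<in> U" by auto
    show "\<exists>y\<in>carrier ?A. y \<oplus>\<^bsub>?A\<^esub> x = \<zero>\<^bsub>?A\<^esub>"
    proof -
      have "(\<lambda>_. \<ominus>\<^bsub>R\<^esub> r) \<in> carrier ?A" using r U_uminus by auto
      moreover have "\<ominus>\<^bsub>R\<^esub> r \<oplus>\<^bsub>R\<^esub> r = \<zero>\<^bsub>R\<^esub>" using r U.a_Hcarr R.R.l_neg by simp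
      ultimately show ?thesis using r by (intro bexI[of _ "\<lambda>_. \<ominus>\<^bsub>R\<^esub> r"]) simp_all
    qed
  qed (auto simp: U_add U.a_Hcarr R.R.a_assoc intro!: ext R.R.a_comm)
  have mod: "module R ?A"
    by (rule moduleI[OF R.R.is_cring A])
      (auto simp: U.I_l_closed U.a_Hcarr R.R.l_distr R.R.r_distr R.R.m_assoc)
  show ?thesis
  proof (rule graded_module.intro[OF mod], rule graded_module_axioms.intro)
    fix j
    show "additive_subgroup (mgrade ?A j) ?A"
    proof (rule additive_subgroup.intro, rule group.subgroupI)
      show "Group.group (add_monoid ?A)" using A abelian_group.a_group by blast
      show "mgrade ?A j \<subseteq> carrier (add_monoid ?A)" by auto
      have "\<zero>\<^bsub>R\<^esub> \<in> rgrade R (j - k)" using R.mgrade_zero[of "j - k"] by simp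
      then have "(\<lambda>_. \<zero>\<^bsub>R\<^esub>) \<in> mgrade ?A j" using U_0 by simp
      then show "mgrade ?A j \<noteq> {}" by blast
      interpret A: abelian_group ?A by fact
      show "inv\<^bsub>add_monoid ?A\<^esub> a \<in> mgrade ?A j" if am: "a \<in> mgrade ?A j" for a
      proof -
        obtain r where r: "a = (\<lambda>_. r)" "r \<in> U" "r \<in> rgrade R (j - k)" using am by auto
        have "\<ominus>\<^bsub>R\<^esub> r \<in> rgrade R (j - k)"
          using subgroup.m_inv_closed[OF additive_subgroup.a_subgroup[OF R.mgrade_subgroup[of "j - k"]], of r] r
          by (simp add: regular_module_def a_inv_def m_inv_def)
        then have m: "(\<lambda>_. \<ominus>\<^bsub>R\<^esub> r) \<in> mgrade ?A j" using r U_uminus by auto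
        have "(\<lambda>_. \<ominus>\<^bsub>R\<^esub> r) \<oplus>\<^bsub>?A\<^esub> a = \<zero>\<^bsub>?A\<^esub>" using r U.a_Hcarr R.R.l_neg by simp
        then have "\<ominus>\<^bsub>?A\<^esub> a = (\<lambda>_. \<ominus>\<^bsub>R\<^esub> r)"
          using A.minus_equality[of "\<lambda>_. \<ominus>\<^bsub>R\<^esub> r" a] r U_uminus by auto
        then show ?thesis using m by (simp add: a_inv_def)
      qed
      show "a \<otimes>\<^bsub>add_monoid ?A\<^esub> b \<in> mgrade ?A j" if ab: "a \<in> mgrade ?A j" "b \<in> mgrade ?A j" for a b
      proof -
        obtain r s where "a = (\<lambda>_. r)" "r \<in> U" "r \<in> rgrade R (j - k)" "b = (\<lambda>_. s)" "s \<in> U" "s \<in> rgrade R (j - k)"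
          using ab by auto
        then show ?thesis using R.mgrade_add[of r "j - k" s] U_add by auto
      qed
    qed
  next
    fix a i x j
    assume "a \<in> rgrade R i" "x \<in> mgrade ?A j"
    then obtain r where r: "x = (\<lambda>_. r)" "r \<in> U" "r \<in> rgrade R (j - k)" and a: "a \<in> rgrade R i" by auto
    have "a \<in> carrier R" using R.mgrade_closed[of a i] a by simp
    then have "a \<otimes>\<^bsub>R\<^esub> r \<in> U" using U.I_l_closed r by simp
    moreover have "a \<otimes>\<^bsub>R\<^esub> r \<in> rgrade R (i + j - k)" using R.mgrade_smult[OF a, of r "j - k"] r
      by (simp add: algebra_simps)
    ultimately show "a \<odot>\<^bsub>?A\<^esub> x \<in> mgrade ?A (i + j)" using r by auto
  next
    fix x assume "x \<in> carrier ?A"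
    then obtain r where r: "x = (\<lambda>_. r)" "r \<in> U" by auto
    have rc: "r \<in> carrier (regular_module R)" using r U.a_Hcarr by simp
    have ev: "(finsum ?A f J) 0 = finsum (regular_module R) (\<lambda>j. f j 0) J"
      if "finite J" "f \<in> J \<rightarrow> carrier ?A" for f :: "int \<Rightarrow> nat \<Rightarrow> 'a" and J
      by (rule finsum_additive[OF A R.M.abelian_group_axioms _ _ that]) (auto simp: U.a_Hcarr)
    have inj: "y = z" if "y \<in> carrier ?A" "z \<in> carrier ?A" "y 0 = z 0" for y z
      using that by auto
    interpret A: abelian_group ?A by fact
    let ?f = "\<lambda>j (_::nat). component (regular_module R) (j - k) r"
    obtain J where J: "finite J" "\<And>j. j \<notin> J \<Longrightarrow> component (regular_module R) j r = \<zero>\<^bsub>regular_module R\<^esub>"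
      "r = (\<Oplus>\<^bsub>regular_module R\<^esub>j\<in>J. component (regular_module R) j r)" using R.component_sum[OF rc] by blast
    have fU: "?f j \<in> mgrade ?A j" for j
      using comp[OF r(2)] R.component_in[OF rc, of "j - k"] by auto
    have fc: "?f j \<in> carrier ?A" for j using comp[OF r(2)] by auto
    let ?K = "{j. ?f j \<noteq> \<zero>\<^bsub>?A\<^esub>}"
    have K: "?K \<subseteq> (\<lambda>j. j + k) ` J"
    proof
      fix j assume "j \<in> ?K"
      then have "j - k \<in> J" using J(2)[of "j - k"] by (auto simp: fun_eq_iff)
      then show "j \<in> (\<lambda>j. j + k) ` J" by (auto intro!: image_eqI[of _ _ "j - k"])
    qed
    have finK: "finite ?K" using K J(1) finite_subset by blast
    have cc: "component (regular_module R) j r \<in> carrier R" for j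
      using R.component_carrier[OF rc] by simp
    have "finsum ?A ?f ?K = finsum ?A ?f ((\<lambda>j. j + k) ` J)"
      by (rule A.add.finprod_mono_neutral_cong_left[OF _ K]) (use J(1) comp[OF r(2)] in auto)
    then have "(finsum ?A ?f ?K) 0 = (\<Oplus>\<^bsub>regular_module R\<^esub>j\<in>(\<lambda>j. j + k) ` J. ?f j 0)"
      using J(1) fc by (subst ev[symmetric]) auto
    also have "\<dots> = (\<Oplus>\<^bsub>regular_module R\<^esub>j\<in>J. component (regular_module R) j r)"
      by (subst R.M.finsum_reindex) (auto simp: cc)
    finally have "(finsum ?A ?f ?K) 0 = r" using J(3) by simp
    then have sum: "x = finsum ?A ?f ?K"
      by (intro inj) (use r fc in \<open>auto intro!: A.finsum_closed[simplified]\<close>)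
    show "\<exists>!f. (\<forall>j. f j \<in> mgrade ?A j) \<and> finite {j. f j \<noteq> \<zero>\<^bsub>?A\<^esub>} \<and>
           x = (\<Oplus>\<^bsub>?A\<^esub>j\<in>{j. f j \<noteq> \<zero>\<^bsub>?A\<^esub>}. f j)"
    proof (rule ex1I[of _ ?f])
      show "(\<forall>j. ?f j \<in> mgrade ?A j) \<and> finite ?K \<and> x = (\<Oplus>\<^bsub>?A\<^esub>j\<in>?K. ?f j)"
        using fU finK sum by blast
    next
      fix f
      assume f: "(\<forall>j. f j \<in> mgrade ?A j) \<and> finite {j. f j \<noteq> \<zero>\<^bsub>?A\<^esub>} \<and>
           x = (\<Oplus>\<^bsub>?A\<^esub>j\<in>{j. f j \<noteq> \<zero>\<^bsub>?A\<^esub>}. f j)"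
      let ?L = "{j. f j \<noteq> \<zero>\<^bsub>?A\<^esub>}"
      have fm: "f j \<in> mgrade ?A j" for j using f by blast
      have fA: "f j \<in> carrier ?A" and fR: "f j 0 \<in> rgrade R (j - k)" for j using fm[of j] by auto
      have fR': "f j 0 \<in> carrier R" for j using R.mgrade_closed[of "f j 0" "j - k"] fR by simp
      have "component (regular_module R) i r = f (i + k) 0" for i
      proof (rule R.component_unique[where J = "(\<lambda>j. j - k) ` ?L"])
        show "finite ((\<lambda>j. j - k) ` ?L)" using f by blast
        show "f (j + k) 0 \<in> mgrade (regular_module R) j" for j using fR[of "j + k"] by simp
        show "f (j + k) 0 = \<zero>\<^bsub>regular_module R\<^esub>" if "j \<notin> (\<lambda>j. j - k) ` ?L" for j
        proof -
          have "j + k \<notin> ?L" using that by (auto simp: image_iff)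
          then show ?thesis by simp
        qed
        have "r = (finsum ?A f ?L) 0" using f r by (metis (no_types, lifting))
        also have "\<dots> = (\<Oplus>\<^bsub>regular_module R\<^esub>j\<in>?L. f j 0)"
          using f fA by (intro ev) auto
        also have "\<dots> = (\<Oplus>\<^bsub>regular_module R\<^esub>j\<in>(\<lambda>j. j - k) ` ?L. f (j + k) 0)"
          by (subst R.M.finsum_reindex) (auto simp: fR' inj_on_def)
        finally show "r = (\<Oplus>\<^bsub>regular_module R\<^esub>j\<in>(\<lambda>j. j - k) ` ?L. f (j + k) 0)" .
      qed
      then have "?f j 0 = f j 0" for j by simp
      then show "f = ?f" using inj[OF fA fc] by (intro ext) metis
    qed
  qed
qed

text \<open>Baer-type extension: the conditions say that \<open>t + a y \<mapsto> a w\<close> is a well-defined homogeneous map on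
  the ideal \<open>T + R y\<close>.\<close>

lemma graded_injective_solve:
  fixes R :: "('a, 'r) graded_ring_scheme"
  assumes E: "graded_injective R E" and R: "graded_module R (regular_module R)"
    and one: "\<one>\<^bsub>R\<^esub> \<in> rgrade R 0"
    and T: "ideal T R" and comp: "\<And>r i. r \<in> T \<Longrightarrow> component (regular_module R) i r \<in> T"
    and y: "y \<in> rgrade R s" and w: "w \<in> mgrade E (j + s)"
    and ann: "\<And>a. a \<in> carrier R \<Longrightarrow> a \<otimes>\<^bsub>R\<^esub> y \<in> T \<Longrightarrow> a \<odot>\<^bsub>E\<^esub> w = \<zero>\<^bsub>E\<^esub>"
  obtains x where "x \<in> mgrade E j" "y \<odot>\<^bsub>E\<^esub> x = w" "\<And>t. t \<in> T \<Longrightarrow> t \<odot>\<^bsub>E\<^esub> x = \<zero>\<^bsub>E\<^esub>"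
proof -
  interpret R: graded_module R "regular_module R" by fact
  interpret E: graded_module R E using E unfolding graded_injective_def by blast
  interpret T: ideal T R by fact
  note T_0 = additive_subgroup.zero_closed[OF ideal.axioms(1)[OF T]]
    and T_add = additive_subgroup.a_closed[OF ideal.axioms(1)[OF T]]
    and T_uminus = additive_subgroup.a_inv_closed[OF ideal.axioms(1)[OF T]]
  have yc: "y \<in> carrier R" using R.mgrade_closed[of y s] y by simp
  have wc: "w \<in> carrier E" using E.mgrade_closed w by blast
  define U where "U = {t \<oplus>\<^bsub>R\<^esub> a \<otimes>\<^bsub>R\<^esub> y | t a. t \<in> T \<and> a \<in> carrier R}"
  have UI: "t \<oplus>\<^bsub>R\<^esub> a \<otimes>\<^bsub>R\<^esub> y \<in> U" if "t \<in> T" "a \<in> carrier R" for t a using that unfolding U_def by blast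
  have U_eq: "U = T <+>\<^bsub>R\<^esub> PIdl\<^bsub>R\<^esub> y"
    unfolding U_def set_add_def' cgenideal_def by blast
  have U: "ideal U R"
    unfolding U_eq by (rule R.R.add_ideals[OF T R.R.cgenideal_ideal[OF yc]])
  interpret U: ideal U R by fact
  note U_0 = additive_subgroup.zero_closed[OF ideal.axioms(1)[OF U]]
    and U_add = additive_subgroup.a_closed[OF ideal.axioms(1)[OF U]]
    and U_uminus = additive_subgroup.a_inv_closed[OF ideal.axioms(1)[OF U]]
  have well: "a \<odot>\<^bsub>E\<^esub> w = b \<odot>\<^bsub>E\<^esub> w"
    if "t \<oplus>\<^bsub>R\<^esub> a \<otimes>\<^bsub>R\<^esub> y = t' \<oplus>\<^bsub>R\<^esub> b \<otimes>\<^bsub>R\<^esub> y" "t \<in> T" "t' \<in> T" "a \<in> carrier R" "b \<in> carrier R" for t a t' b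
  proof -
    have tc: "t \<in> carrier R" "t' \<in> carrier R" using that T.a_Hcarr by auto
    have "(a \<ominus>\<^bsub>R\<^esub> b) \<otimes>\<^bsub>R\<^esub> y = a \<otimes>\<^bsub>R\<^esub> y \<ominus>\<^bsub>R\<^esub> b \<otimes>\<^bsub>R\<^esub> y"
      using that(4,5) yc by algebra
    also have "\<dots> = (\<ominus>\<^bsub>R\<^esub> t) \<oplus>\<^bsub>R\<^esub> (t \<oplus>\<^bsub>R\<^esub> a \<otimes>\<^bsub>R\<^esub> y) \<ominus>\<^bsub>R\<^esub> b \<otimes>\<^bsub>R\<^esub> y"
      using that(4,5) tc yc by algebra
    also have "\<dots> = (\<ominus>\<^bsub>R\<^esub> t) \<oplus>\<^bsub>R\<^esub> (t' \<oplus>\<^bsub>R\<^esub> b \<otimes>\<^bsub>R\<^esub> y) \<ominus>\<^bsub>R\<^esub> b \<otimes>\<^bsub>R\<^esub> y"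
      using that(1) by simp
    also have "\<dots> = t' \<ominus>\<^bsub>R\<^esub> t"
      using that(4,5) tc yc by algebra
    finally have "(a \<ominus>\<^bsub>R\<^esub> b) \<otimes>\<^bsub>R\<^esub> y = t' \<ominus>\<^bsub>R\<^esub> t" .
    then have "(a \<ominus>\<^bsub>R\<^esub> b) \<otimes>\<^bsub>R\<^esub> y \<in> T"
      using T_add[OF that(3) T_uminus[OF that(2)]] by (simp only: a_minus_def)
    then have "(a \<ominus>\<^bsub>R\<^esub> b) \<odot>\<^bsub>E\<^esub> w = \<zero>\<^bsub>E\<^esub>" using ann that by simp
    moreover have "a \<odot>\<^bsub>E\<^esub> w = ((a \<ominus>\<^bsub>R\<^esub> b) \<oplus>\<^bsub>R\<^esub> b) \<odot>\<^bsub>E\<^esub> w"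
    proof -
      have "(a \<ominus>\<^bsub>R\<^esub> b) \<oplus>\<^bsub>R\<^esub> b = a" using that by algebra
      then show ?thesis by simp
    qed
    ultimately show ?thesis using that wc by (simp add: E.smult_l_distr)
  qed
  define f where "f r = (SOME z. \<exists>t a. r = t \<oplus>\<^bsub>R\<^esub> a \<otimes>\<^bsub>R\<^esub> y \<and> t \<in> T \<and> a \<in> carrier R \<and> z = a \<odot>\<^bsub>E\<^esub> w)" for r
  have f: "f (t \<oplus>\<^bsub>R\<^esub> a \<otimes>\<^bsub>R\<^esub> y) = a \<odot>\<^bsub>E\<^esub> w" if "t \<in> T" "a \<in> carrier R" for t a
    unfolding f_def
  proof (rule some_equality)
    show "\<exists>t' a'. t \<oplus>\<^bsub>R\<^esub> a \<otimes>\<^bsub>R\<^esub> y = t' \<oplus>\<^bsub>R\<^esub> a' \<otimes>\<^bsub>R\<^esub> y \<and> t' \<in> T \<and> a' \<in> carrier R \<and> a \<odot>\<^bsub>E\<^esub> w = a' \<odot>\<^bsub>E\<^esub> w"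
      by (rule exI[of _ t], rule exI[of _ a]) (simp add: that)
  next
    fix z assume "\<exists>t' a'. t \<oplus>\<^bsub>R\<^esub> a \<otimes>\<^bsub>R\<^esub> y = t' \<oplus>\<^bsub>R\<^esub> a' \<otimes>\<^bsub>R\<^esub> y \<and> t' \<in> T \<and> a' \<in> carrier R \<and> z = a' \<odot>\<^bsub>E\<^esub> w"
    then obtain t' a' where z: "t \<oplus>\<^bsub>R\<^esub> a \<otimes>\<^bsub>R\<^esub> y = t' \<oplus>\<^bsub>R\<^esub> a' \<otimes>\<^bsub>R\<^esub> y" "t' \<in> T" "a' \<in> carrier R" "z = a' \<odot>\<^bsub>E\<^esub> w"
      by blast
    show "z = a \<odot>\<^bsub>E\<^esub> w" using well[OF z(1) that(1) z(2) that(2) z(3)] z(4) by simp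
  qed
  let ?c = "\<lambda>r (_::nat). r"
  let ?A = "shifted_ideal R U j" and ?B = "shifted_ideal R (carrier R) j"
  have compU: "component (regular_module R) i r \<in> U" if rU: "r \<in> U" for r i
  proof -
    obtain t a where r: "r = t \<oplus>\<^bsub>R\<^esub> a \<otimes>\<^bsub>R\<^esub> y" "t \<in> T" "a \<in> carrier R" using rU unfolding U_def by blast
    have tc: "t \<in> carrier R" using r T.a_Hcarr by blast
    have c: "component (regular_module R) i (a \<otimes>\<^bsub>R\<^esub> y) = component (regular_module R) (i - s) a \<otimes>\<^bsub>R\<^esub> y"
    proof -
      have ac: "component (regular_module R) (i - s) a \<in> carrier R"
        using R.component_carrier[of a] r by simp
      have "component (regular_module R) ((i - s) + s) (y \<odot>\<^bsub>regular_module R\<^esub> a)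
          = y \<odot>\<^bsub>regular_module R\<^esub> component (regular_module R) (i - s) a"
        by (rule component_smult[OF R y yc]) (use r in simp)
      then show ?thesis using yc r ac by (simp add: R.R.m_comm)
    qed
    have "component (regular_module R) i r = component (regular_module R) i t \<oplus>\<^bsub>R\<^esub> component (regular_module R) i (a \<otimes>\<^bsub>R\<^esub> y)"
      using R.component_add[of t "a \<otimes>\<^bsub>R\<^esub> y" i] tc r yc by simp
    then show ?thesis using UI[OF comp[OF r(2), of i], of "component (regular_module R) (i - s) a"]
        R.component_carrier[of a] r unfolding c by simp
  qed
  have A: "graded_module R ?A" by (rule shifted_ideal_graded_module[OF R U compU])
  have B: "graded_module R ?B"
    by (rule shifted_ideal_graded_module[OF R R.R.oneideal]) (use R.component_carrier in simp)
  have u: "(\<lambda>x. x) \<in> graded_hom R ?A ?B"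
    unfolding graded_hom_def using U.a_Hcarr by auto
  have fg: "(\<lambda>g. f (g 0)) \<in> graded_hom R ?A E"
    unfolding graded_hom_def
  proof (intro CollectI conjI ballI allI funcsetI)
    fix x assume x: "x \<in> carrier ?A"
    then obtain t a where r: "x 0 = t \<oplus>\<^bsub>R\<^esub> a \<otimes>\<^bsub>R\<^esub> y" "t \<in> T" "a \<in> carrier R" unfolding U_def by auto
    have tc: "t \<in> carrier R" using r T.a_Hcarr by blast
    show "f (x 0) \<in> carrier E" using f r wc by simp
    show "f ((b \<odot>\<^bsub>?A\<^esub> x) 0) = b \<odot>\<^bsub>E\<^esub> f (x 0)" if b: "b \<in> carrier R" for b
    proof -
      have "b \<otimes>\<^bsub>R\<^esub> x 0 = (b \<otimes>\<^bsub>R\<^esub> t) \<oplus>\<^bsub>R\<^esub> (b \<otimes>\<^bsub>R\<^esub> a) \<otimes>\<^bsub>R\<^esub> y"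
        unfolding r(1) using r(3) tc yc b by algebra
      then show ?thesis using f r b wc T.I_l_closed by (simp add: E.smult_assoc1)
    qed
    fix x' assume x: "x' \<in> carrier ?A"
    then obtain t' a' where r': "x' 0 = t' \<oplus>\<^bsub>R\<^esub> a' \<otimes>\<^bsub>R\<^esub> y" "t' \<in> T" "a' \<in> carrier R" unfolding U_def by auto
    have tc': "t' \<in> carrier R" using r' T.a_Hcarr by blast
    have "x 0 \<oplus>\<^bsub>R\<^esub> x' 0 = (t \<oplus>\<^bsub>R\<^esub> t') \<oplus>\<^bsub>R\<^esub> (a \<oplus>\<^bsub>R\<^esub> a') \<otimes>\<^bsub>R\<^esub> y"
      unfolding r(1) r'(1) using r(3) r'(3) tc tc' yc by algebra
    then show "f ((x \<oplus>\<^bsub>?A\<^esub> x') 0) = f (x 0) \<oplus>\<^bsub>E\<^esub> f (x' 0)"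
      using f r r' wc T_add by (simp add: E.smult_l_distr)
  next
    fix i
    show "(\<lambda>g. f (g 0)) ` mgrade ?A i \<subseteq> mgrade E i"
    proof (rule image_subsetI)
      fix x assume "x \<in> mgrade ?A i"
      then have xU: "x 0 \<in> U" and xg: "x 0 \<in> rgrade R (i - j)" by auto
      from xU obtain t a where r: "x 0 = t \<oplus>\<^bsub>R\<^esub> a \<otimes>\<^bsub>R\<^esub> y" "t \<in> T" "a \<in> carrier R" unfolding U_def by auto
      have tc: "t \<in> carrier R" using r T.a_Hcarr by blast
      \<comment> \<open>Taking the component of degree \<open>i - j\<close> replaces the coefficient
        \<open>a\<close> by its component of degree \<open>i - j - s\<close>, so the value of
        \<open>f\<close> is homogeneous of degree \<open>i\<close>.\<close>
      have c: "component (regular_module R) (i - j) (a \<otimes>\<^bsub>R\<^esub> y) = component (regular_module R) (i - j - s) a \<otimes>\<^bsub>R\<^esub> y"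
      proof -
        have ac: "component (regular_module R) (i - j - s) a \<in> carrier R"
          using R.component_carrier[of a] r by simp
        have "component (regular_module R) ((i - j - s) + s) (y \<odot>\<^bsub>regular_module R\<^esub> a)
            = y \<odot>\<^bsub>regular_module R\<^esub> component (regular_module R) (i - j - s) a"
          by (rule component_smult[OF R y yc]) (use r in simp)
        then show ?thesis using yc r ac by (simp add: R.R.m_comm)
      qed
      let ?a = "component (regular_module R) (i - j - s) a"
      have ac: "?a \<in> carrier R" "?a \<in> rgrade R (i - j - s)"
        using R.component_carrier[of a] R.component_in[of a] r by simp_all
      have "x 0 = component (regular_module R) (i - j) (x 0)"
        using R.component_homogeneous[of "x 0" "i - j" "i - j"] xg by simp
      also have "\<dots> = component (regular_module R) (i - j) t \<oplus>\<^bsub>R\<^esub> ?a \<otimes>\<^bsub>R\<^esub> y"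
        using R.component_add[of t "a \<otimes>\<^bsub>R\<^esub> y" "i - j"] tc r yc unfolding c[symmetric] by simp
      finally have "f (x 0) = ?a \<odot>\<^bsub>E\<^esub> w" using f[OF comp[OF r(2)] ac(1)] by simp
      then show "f (x 0) \<in> mgrade E i"
        using E.mgrade_smult[OF ac(2) w] by (simp add: algebra_simps)
    qed
  qed
  obtain g where g: "g \<in> graded_hom R ?B E" and gf: "\<And>x. x \<in> carrier ?A \<Longrightarrow> g x = f (x 0)"
  proof -
    have "\<forall>(A :: ('a, nat \<Rightarrow> 'a) graded_module) (B :: ('a, nat \<Rightarrow> 'a) graded_module) u f.
       graded_module R A \<and> graded_module R B \<and>
       u \<in> graded_hom R A B \<and> inj_on u (carrier A) \<and> f \<in> graded_hom R A E \<longrightarrow>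
       (\<exists>g \<in> graded_hom R B E. \<forall>x\<in>carrier A. g (u x) = f x)"
      using E unfolding graded_injective_def by (rule conjunct2)
    from this[rule_format, OF conjI[OF A conjI[OF B conjI[OF u conjI[OF inj_on_id2 fg]]]]]
    show ?thesis using that by blast
  qed
  \<comment> \<open>A homomorphism out of the shifted ring is determined by the image of 1, and this
    image solves the equations.\<close>
  let ?x = "g (?c \<one>\<^bsub>R\<^esub>)"
  have oneB: "?c \<one>\<^bsub>R\<^esub> \<in> carrier ?B" by auto
  have gs: "r \<odot>\<^bsub>E\<^esub> ?x = g (?c r)" if "r \<in> carrier R" for r
  proof -
    have "g (r \<odot>\<^bsub>?B\<^esub> ?c \<one>\<^bsub>R\<^esub>) = r \<odot>\<^bsub>E\<^esub> ?x"
      using g oneB that unfolding graded_hom_def by blast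
    then show ?thesis using that by simp
  qed
  show ?thesis
  proof
    have "?c \<one>\<^bsub>R\<^esub> \<in> mgrade ?B j" using one by auto
    then show "?x \<in> mgrade E j" using g unfolding graded_hom_def by blast
    have "f y = f (\<zero>\<^bsub>R\<^esub> \<oplus>\<^bsub>R\<^esub> \<one>\<^bsub>R\<^esub> \<otimes>\<^bsub>R\<^esub> y)" using yc by simp
    then have fy: "f y = w" using f[of "\<zero>\<^bsub>R\<^esub>" "\<one>\<^bsub>R\<^esub>"] wc T_0 by simp
    have "y = \<zero>\<^bsub>R\<^esub> \<oplus>\<^bsub>R\<^esub> \<one>\<^bsub>R\<^esub> \<otimes>\<^bsub>R\<^esub> y" using yc by simp
    then have "y \<in> U" using UI[OF T_0 R.R.one_closed] by simp
    then show "y \<odot>\<^bsub>E\<^esub> ?x = w" using gs[OF yc] gf[of "?c y"] fy by auto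
    fix t assume t: "t \<in> T"
    then have tc: "t \<in> carrier R" using T.a_Hcarr by blast
    have te: "t = t \<oplus>\<^bsub>R\<^esub> \<zero>\<^bsub>R\<^esub> \<otimes>\<^bsub>R\<^esub> y" using tc yc by simp
    have "t \<in> U" using UI[OF t R.R.zero_closed] te by simp
    moreover have "f t = \<zero>\<^bsub>E\<^esub>" using f[OF t R.R.zero_closed] te wc by simp
    ultimately show "t \<odot>\<^bsub>E\<^esub> ?x = \<zero>\<^bsub>E\<^esub>" using gs[OF tc] gf[of "?c t"] by auto
  qed
qed

text \<open>Elements of an abelian group given by a record are represented in the free abelian group on its carrier,
  so that the type class \<open>ab_group_add\<close> becomes available.\<close>

definition frag_eval :: "('m, 'x) ring_scheme \<Rightarrow> ('m \<Rightarrow>\<^sub>0 int) \<Rightarrow> 'm" where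
  "frag_eval G z = (\<Oplus>\<^bsub>G\<^esub>m\<in>Poly_Mapping.keys z. [Poly_Mapping.lookup z m] \<cdot>\<^bsub>G\<^esub> m)"

context abelian_group
begin

lemma add_pow_int_0: "[(0::int)] \<cdot>\<^bsub>G\<^esub> x = \<zero>"
  and add_pow_int_1: "x \<in> carrier G \<Longrightarrow> [(1::int)] \<cdot>\<^bsub>G\<^esub> x = x"
  and add_pow_int_closed: "x \<in> carrier G \<Longrightarrow> [(k::int)] \<cdot>\<^bsub>G\<^esub> x \<in> carrier G"
  and add_pow_int_add: "x \<in> carrier G \<Longrightarrow> [(k + l::int)] \<cdot>\<^bsub>G\<^esub> x = [k] \<cdot>\<^bsub>G\<^esub> x \<oplus> [l] \<cdot>\<^bsub>G\<^esub> x"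
  using group.int_pow_1[OF a_group, of x] group.int_pow_closed[OF a_group, of x k]
    group.int_pow_mult[OF a_group, of x k l]
  by (simp_all add: add_pow_def)

lemma frag_eval_superset:
  assumes "finite J" "Poly_Mapping.keys z \<subseteq> J" "J \<subseteq> carrier G"
  shows "frag_eval G z = (\<Oplus>m\<in>J. [Poly_Mapping.lookup z m] \<cdot>\<^bsub>G\<^esub> m)"
  unfolding frag_eval_def
  by (rule add.finprod_mono_neutral_cong_left[OF assms(1,2)])
    (use assms(3) in \<open>auto simp: in_keys_iff add_pow_int_0 add_pow_int_closed\<close>)

lemma frag_eval_closed:
  assumes "additive_subgroup H G" "Poly_Mapping.keys z \<subseteq> H"
  shows "frag_eval G z \<in> H"
proof -
  interpret H: additive_subgroup H G by fact
  have fin: "finite J \<Longrightarrow> J \<subseteq> H \<Longrightarrow> (\<Oplus>m\<in>J. [k m] \<cdot>\<^bsub>G\<^esub> m) \<in> H" for J and k :: "'a \<Rightarrow> int"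
  proof (induction J rule: finite_induct)
    case (insert m J)
    have m: "m \<in> H" "m \<in> carrier G" using insert.prems H.a_Hcarr by auto
    have "[k m] \<cdot>\<^bsub>G\<^esub> m \<in> H"
      using group.subgroup_int_pow_closed[OF a_group H.a_subgroup m(1), of "k m"]
      by (simp add: add_pow_def)
    moreover have "(\<lambda>m. [k m] \<cdot>\<^bsub>G\<^esub> m) \<in> J \<rightarrow> carrier G" using insert.prems H.a_Hcarr by (auto intro!: add_pow_int_closed)
    ultimately show ?case using insert m H.a_Hcarr by (simp add: finsum_insert H.a_closed)
  qed (simp add: H.zero_closed)
  show ?thesis unfolding frag_eval_def by (rule fin) (use assms in auto)
qed

lemma frag_eval_0: "frag_eval G 0 = \<zero>"
  unfolding frag_eval_def by simp

lemma frag_eval_of: "x \<in> carrier G \<Longrightarrow> frag_eval G (frag_of x) = x"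
  unfolding frag_eval_def by (simp add: add_pow_int_1)

lemma frag_eval_carrier: "Poly_Mapping.keys z \<subseteq> carrier G \<Longrightarrow> frag_eval G z \<in> carrier G"
  by (rule frag_eval_closed) (simp add: additive_subgroup.intro add.subgroup_self)

lemma frag_eval_add:
  assumes "Poly_Mapping.keys z \<subseteq> carrier G" "Poly_Mapping.keys w \<subseteq> carrier G"
  shows "frag_eval G (z + w) = frag_eval G z \<oplus> frag_eval G w"
proof -
  let ?J = "Poly_Mapping.keys z \<union> Poly_Mapping.keys w"
  have J: "finite ?J" "?J \<subseteq> carrier G" using assms by auto
  have c: "(\<lambda>m. [Poly_Mapping.lookup u m] \<cdot>\<^bsub>G\<^esub> m) \<in> ?J \<rightarrow> carrier G" for u :: "'a \<Rightarrow>\<^sub>0 int"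
  proof (rule funcsetI)
    fix m assume "m \<in> ?J"
    then have "m \<in> carrier G" using J(2) by blast
    then show "[Poly_Mapping.lookup u m] \<cdot>\<^bsub>G\<^esub> m \<in> carrier G" by (rule add_pow_int_closed)
  qed
  have "frag_eval G (z + w) = (\<Oplus>m\<in>?J. [Poly_Mapping.lookup (z + w) m] \<cdot>\<^bsub>G\<^esub> m)"
    by (rule frag_eval_superset[OF J(1) _ J(2)]) (rule keys_add)
  also have "\<dots> = (\<Oplus>m\<in>?J. [Poly_Mapping.lookup z m] \<cdot>\<^bsub>G\<^esub> m \<oplus> [Poly_Mapping.lookup w m] \<cdot>\<^bsub>G\<^esub> m)"
  proof (rule finsum_cong'[OF refl])
    show "(\<lambda>m. [Poly_Mapping.lookup z m] \<cdot>\<^bsub>G\<^esub> m \<oplus> [Poly_Mapping.lookup w m] \<cdot>\<^bsub>G\<^esub> m) \<in> ?J \<rightarrow> carrier G"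
      by (rule funcsetI, rule a_closed) (erule funcset_mem[OF c])+
    fix m assume "m \<in> ?J"
    then have "m \<in> carrier G" using J(2) by blast
    then show "[Poly_Mapping.lookup (z + w) m] \<cdot>\<^bsub>G\<^esub> m
        = [Poly_Mapping.lookup z m] \<cdot>\<^bsub>G\<^esub> m \<oplus> [Poly_Mapping.lookup w m] \<cdot>\<^bsub>G\<^esub> m"
      unfolding lookup_add by (rule add_pow_int_add)
  qed
  also have "\<dots> = frag_eval G z \<oplus> frag_eval G w"
    unfolding finsum_addf[OF c c]
    using frag_eval_superset[OF J(1) _ J(2), of z] frag_eval_superset[OF J(1) _ J(2), of w] by simp
  finally show ?thesis .
qed

lemma frag_eval_diff:
  assumes "Poly_Mapping.keys z \<subseteq> carrier G" "Poly_Mapping.keys w \<subseteq> carrier G"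
  shows "frag_eval G (z - w) = frag_eval G z \<ominus> frag_eval G w"
proof -
  have k: "Poly_Mapping.keys (z - w) \<subseteq> carrier G" using keys_diff[of z w] assms by blast
  have "frag_eval G z = frag_eval G ((z - w) + w)" by simp
  also have "\<dots> = frag_eval G (z - w) \<oplus> frag_eval G w" by (rule frag_eval_add[OF k assms(2)])
  finally show ?thesis
    using frag_eval_carrier[OF k] frag_eval_carrier[OF assms(2)] by (simp add: a_minus_def a_assoc r_neg)
qed

end

lemma keys_frag_map: "Poly_Mapping.keys (frag_extend (frag_of \<circ> h) z) \<subseteq> h ` Poly_Mapping.keys z"
  using keys_frag_extend[of "frag_of \<circ> h" z] by (auto simp: keys_frag_of)

text \<open>Both sides are additive in \<open>z\<close> and agree on generators. This naturality
  brings computations with formal combinations back to the modules.\<close>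

lemma frag_eval_map:
  assumes "abelian_group M" "abelian_group M'" "h \<in> carrier M \<rightarrow> carrier M'"
    and "\<And>x y. x \<in> carrier M \<Longrightarrow> y \<in> carrier M \<Longrightarrow> h (x \<oplus>\<^bsub>M\<^esub> y) = h x \<oplus>\<^bsub>M'\<^esub> h y"
    and "Poly_Mapping.keys z \<subseteq> carrier M"
  shows "frag_eval M' (frag_extend (frag_of \<circ> h) z) = h (frag_eval M z)"
proof -
  interpret M: abelian_group M by fact
  interpret M': abelian_group M' by fact
  have keys: "Poly_Mapping.keys (frag_extend (frag_of \<circ> h) z) \<subseteq> carrier M'"
    if "Poly_Mapping.keys z \<subseteq> carrier M" for z
    using keys_frag_map[of h z] that assms(3) by blast
  have h0: "h \<zero>\<^bsub>M\<^esub> = \<zero>\<^bsub>M'\<^esub>"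
    using finsum_additive[OF assms(1-4), of "{}" undefined] by simp
  have hd: "h (x \<ominus>\<^bsub>M\<^esub> y) = h x \<ominus>\<^bsub>M'\<^esub> h y" if "x \<in> carrier M" "y \<in> carrier M" for x y
  proof -
    have c: "h x \<in> carrier M'" "h y \<in> carrier M'" "h (x \<ominus>\<^bsub>M\<^esub> y) \<in> carrier M'" using assms(3) that by auto
    have "h x = h ((x \<ominus>\<^bsub>M\<^esub> y) \<oplus>\<^bsub>M\<^esub> y)"
      using that by (simp add: a_minus_def M.a_assoc M.l_neg)
    also have "\<dots> = h (x \<ominus>\<^bsub>M\<^esub> y) \<oplus>\<^bsub>M'\<^esub> h y" using that assms(4) by simp
    finally show ?thesis using c by (simp add: a_minus_def M'.a_assoc M'.r_neg)
  qed
  have "Poly_Mapping.keys z \<subseteq> carrier M \<and> frag_eval M' (frag_extend (frag_of \<circ> h) z) = h (frag_eval M z)"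
    using assms(5)
  proof (induction z rule: frag_induction)
    case zero
    then show ?case by (simp add: M.frag_eval_0 M'.frag_eval_0 h0)
  next
    case (one x)
    then have "x \<in> carrier M" "h x \<in> carrier M'" using assms(3) by auto
    then show ?case by (simp add: M.frag_eval_of M'.frag_eval_of)
  next
    case (diff a b)
    then show ?case
      using keys_diff[of a b]
      by (auto simp only: frag_extend_diff M.frag_eval_diff M'.frag_eval_diff[OF keys keys] hd M.frag_eval_carrier)
  qed
  then show ?thesis by simp
qed

section \<open>Stanley--Reisner rings\<close>

text \<open>Serves to replace finitely many torsion exponents by a common one.\<close>

lemma uniform_bound:
  fixes Q :: "'a \<Rightarrow> nat \<Rightarrow> bool"
  assumes "finite A" "\<And>a. a \<in> A \<Longrightarrow> \<exists>n. Q a n" "\<And>a n m. Q a n \<Longrightarrow> n \<le> m \<Longrightarrow> Q a m"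
  shows "\<exists>n. \<forall>a\<in>A. Q a n"
  using assms(1,2)
proof (induction A)
  case (insert a A)
  obtain n where n: "\<forall>a\<in>A. Q a n" using insert by auto
  obtain k where k: "Q a k" using insert by auto
  have "\<forall>b\<in>insert a A. Q b (max n k)"
    using n k assms(3) max.cobounded1 max.cobounded2 by (metis insert_iff)
  then show ?case ..
qed simp

lemma poly_mapping_sum_single: "p = (\<Sum>m\<in>Poly_Mapping.keys p. Poly_Mapping.single m (Poly_Mapping.lookup p m))"
  by (rule poly_mapping_eqI) (simp add: lookup_sum lookup_single when_def in_keys_iff)

lemma poly_mapping_in_additive:
  fixes p :: "'a \<Rightarrow>\<^sub>0 'b::comm_monoid_add"
  assumes "0 \<in> A" "\<And>p q. p \<in> A \<Longrightarrow> q \<in> A \<Longrightarrow> p + q \<in> A"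
    and "\<And>m. m \<in> Poly_Mapping.keys p \<Longrightarrow> Poly_Mapping.single m (Poly_Mapping.lookup p m) \<in> A"
  shows "p \<in> A"
proof -
  have "(\<Sum>m\<in>K. Poly_Mapping.single m (Poly_Mapping.lookup p m)) \<in> A"
    if "finite K" "K \<subseteq> Poly_Mapping.keys p" for K
    using that by (induction K) (auto intro: assms)
  from this[of "Poly_Mapping.keys p"] show ?thesis by (simp flip: poly_mapping_sum_single)
qed

section \<open>Truncation of polynomials to a set of monomials\<close>

definition restrict_keys :: "'a set \<Rightarrow> ('a \<Rightarrow>\<^sub>0 'b::comm_monoid_add) \<Rightarrow> 'a \<Rightarrow>\<^sub>0 'b" where
  "restrict_keys T p = (\<Sum>m\<in>Poly_Mapping.keys p \<inter> T. Poly_Mapping.single m (Poly_Mapping.lookup p m))"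

lemma lookup_restrict_keys:
  "Poly_Mapping.lookup (restrict_keys T p) k = (if k \<in> T then Poly_Mapping.lookup p k else 0)"
  unfolding restrict_keys_def by (simp add: lookup_sum lookup_single when_def in_keys_iff)

lemma keys_restrict_keys: "Poly_Mapping.keys (restrict_keys T p) = Poly_Mapping.keys p \<inter> T"
  by (auto simp: in_keys_iff lookup_restrict_keys split: if_splits)

lemma restrict_keys_add: "restrict_keys T (p + q) = restrict_keys T p + restrict_keys T q"
  by (rule poly_mapping_eqI) (simp add: lookup_restrict_keys lookup_add)

lemma restrict_keys_diff:
  fixes p :: "'a \<Rightarrow>\<^sub>0 'b::ab_group_add"
  shows "restrict_keys T (p - q) = restrict_keys T p - restrict_keys T q"
  by (rule poly_mapping_eqI) (simp add: lookup_restrict_keys lookup_minus)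

lemma restrict_keys_single:
  "restrict_keys T (Poly_Mapping.single m c) = (if m \<in> T then Poly_Mapping.single m c else 0)"
  by (rule poly_mapping_eqI) (simp add: lookup_restrict_keys lookup_single when_def)

lemma restrict_keys_0 [simp]: "restrict_keys T 0 = 0"
  by (rule poly_mapping_eqI) (simp add: lookup_restrict_keys)

lemma monomial_mult: "monomial a * monomial b = monomial (a + b)"
  by (simp add: monomial_def mult_single)

lemma monomial_0: "monomial 0 = 1"
  by (simp add: monomial_def)

text \<open>Enlarging the denominator of a fraction multiplies the numerator by a monomial; this
  formula lets the sorting of monomials pass through that operation.\<close>

lemma restrict_keys_monomial_mult:
  "restrict_keys T (monomial a * p) = monomial a * restrict_keys {m. a + m \<in> T} p"
proof -
  have "p \<in> {p. restrict_keys T (monomial a * p) = monomial a * restrict_keys {m. a + m \<in> T} p}"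
    by (rule poly_mapping_in_additive)
      (auto simp: restrict_keys_add distrib_left restrict_keys_single monomial_def mult_single)
  then show ?thesis by simp
qed

text \<open>Multiplication by a monomial shifts exponents injectively, so nothing cancels.
  Truncation to the single monomial \<open>a + m\<close> isolates one coefficient.\<close>

lemma keys_monomial_mult: "Poly_Mapping.keys (monomial a * p) = (+) a ` Poly_Mapping.keys p"
proof
  show "Poly_Mapping.keys (monomial a * p) \<subseteq> (+) a ` Poly_Mapping.keys p"
    using keys_mult[of "monomial a" p] by (auto simp: monomial_def split: if_splits)
next
  show "(+) a ` Poly_Mapping.keys p \<subseteq> Poly_Mapping.keys (monomial a * p)"
  proof (rule image_subsetI)
    fix m assume m: "m \<in> Poly_Mapping.keys p"
    have "restrict_keys {m} p = Poly_Mapping.single m (Poly_Mapping.lookup p m)"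
      by (rule poly_mapping_eqI) (simp add: lookup_restrict_keys lookup_single when_def)
    moreover have "{k. a + k \<in> {a + m}} = {m}" by auto
    ultimately have "restrict_keys {a + m} (monomial a * p) = Poly_Mapping.single (a + m) (Poly_Mapping.lookup p m)"
      by (simp only: restrict_keys_monomial_mult) (simp add: monomial_def mult_single)
    then have "Poly_Mapping.lookup (monomial a * p) (a + m) = Poly_Mapping.lookup p m"
      using lookup_restrict_keys[of "{a + m}" "monomial a * p" "a + m"] by simp
    then show "a + m \<in> Poly_Mapping.keys (monomial a * p)" using m by (simp add: in_keys_iff)
  qed
qed

text \<open>The exponent vector of \<open>x\<^sub>F\<^sup>n\<close>.\<close>

definition expo :: "nat \<Rightarrow> 'v set \<Rightarrow> 'v::finite \<Rightarrow>\<^sub>0 nat" where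
  "expo n F = (\<Sum>v\<in>F. Poly_Mapping.single v n)"

lemma lookup_expo: "Poly_Mapping.lookup (expo n F) v = (if v \<in> F then n else 0)"
  unfolding expo_def by (simp add: lookup_sum lookup_single when_def)

lemma expo_le_decomp:
  assumes "\<And>v. v \<in> F \<Longrightarrow> n \<le> Poly_Mapping.lookup m v"
  shows "(m - expo n F) + expo n F = m"
  by (rule poly_mapping_eqI) (use assms in \<open>simp add: lookup_add lookup_minus lookup_expo\<close>)

lemma keys_add_nat: "Poly_Mapping.keys (a + b) = Poly_Mapping.keys a \<union> Poly_Mapping.keys (b :: 'v \<Rightarrow>\<^sub>0 nat)"
  by (auto simp: in_keys_iff lookup_add)

lemma keys_expo: "Poly_Mapping.keys (expo n F) = (if n = 0 then {} else F)"
  by (rule Set.set_eqI) (simp add: in_keys_iff lookup_expo)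

lemma prod_mvar: "(\<Prod>v\<in>F. mvar v) = monomial (expo 1 (F :: 'v::finite set))"
proof -
  have "finite F" by simp
  then show ?thesis
    by (induction F) (simp_all add: expo_def monomial_0 mvar_def monomial_mult)
qed

lemma polynomial_ring_simps [simp]:
  "carrier polynomial_ring = UNIV" "x \<otimes>\<^bsub>polynomial_ring\<^esub> y = x * y" "x \<oplus>\<^bsub>polynomial_ring\<^esub> y = x + y"
  "\<one>\<^bsub>polynomial_ring\<^esub> = 1" "\<zero>\<^bsub>polynomial_ring\<^esub> = 0"
  by (simp_all add: ring_of_type_algebra_def)

interpretation polynomial_ring: cring "polynomial_ring :: ('v, 'k::field) mpoly ring"
  by (rule cring_from_type_algebra)

lemma polynomial_ring_a_inv: "\<ominus>\<^bsub>polynomial_ring\<^esub> p = - (p :: ('v, 'k::field) mpoly)"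
  using polynomial_ring.minus_equality[of "- p" p] by simp

lemma polynomial_ring_idealI:
  fixes J :: "('v, 'k::field) mpoly set"
  assumes "0 \<in> J" "\<And>p q. p \<in> J \<Longrightarrow> q \<in> J \<Longrightarrow> p + q \<in> J" "\<And>p q. p \<in> J \<Longrightarrow> q * p \<in> J"
  shows "ideal J polynomial_ring"
proof (rule idealI)
  show "ring (polynomial_ring :: ('v, 'k) mpoly ring)" by (rule polynomial_ring.ring_axioms)
  show "subgroup J (add_monoid polynomial_ring)"
  proof (rule polynomial_ring.add.subgroupI)
    show "\<ominus>\<^bsub>polynomial_ring\<^esub> a \<in> J" if "a \<in> J" for a
      using assms(3)[OF that, of "-1"] polynomial_ring_a_inv[of a] by simp
  qed (use assms in auto)
qed (use assms in \<open>auto simp: mult.commute\<close>)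

text \<open>Since \<open>\<Delta>\<close> is closed under subsets, the right-hand side is an ideal,
  and it contains the generators. Conversely a monomial with support
  \<open>F \<notin> \<Delta>\<close> is a multiple of \<open>x\<^sub>F\<close>. That only supports
  matter is the form in which squarefreeness is used from here on.\<close>

lemma stanley_reisner_ideal_eq:
  assumes "simplicial_complex \<Delta>"
  shows "(stanley_reisner_ideal \<Delta> :: ('v::finite, 'k::field) mpoly set) =
    {p. \<forall>m \<in> Poly_Mapping.keys p. Poly_Mapping.keys m \<notin> \<Delta>}" (is "_ = ?J")
proof
  let ?G = "{\<Prod>v\<in>F. mvar v | F. F \<notin> \<Delta>} :: ('v, 'k) mpoly set"
  have mono: "G \<notin> \<Delta>" if "F \<notin> \<Delta>" "F \<subseteq> G" for F G
    using assms that unfolding simplicial_complex_def by blast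
  have J: "ideal ?J polynomial_ring"
  proof (rule polynomial_ring_idealI)
    show "p + q \<in> ?J" if "p \<in> ?J" "q \<in> ?J" for p q :: "('v, 'k) mpoly"
      using keys_add[of p q] that by blast
    show "q * p \<in> ?J" if p: "p \<in> ?J" for p q :: "('v, 'k) mpoly"
    proof (intro CollectI ballI)
      fix m assume "m \<in> Poly_Mapping.keys (q * p)"
      then obtain a b where m: "m = a + b" "b \<in> Poly_Mapping.keys p" using keys_mult[of q p] by blast
      then have "Poly_Mapping.keys b \<notin> \<Delta>" using p by blast
      then show "Poly_Mapping.keys m \<notin> \<Delta>" by (rule mono) (simp add: m(1) keys_add_nat)
    qed
  qed simp
  have "?G \<subseteq> ?J"
    by (auto simp: prod_mvar monomial_def keys_expo)
  then show "stanley_reisner_ideal \<Delta> \<subseteq> ?J"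
    unfolding stanley_reisner_ideal_def by (rule polynomial_ring.genideal_minimal[OF J])
  have G: "?G \<subseteq> carrier polynomial_ring" by simp
  interpret I: ideal "stanley_reisner_ideal \<Delta> :: ('v, 'k) mpoly set" polynomial_ring
    unfolding stanley_reisner_ideal_def by (rule polynomial_ring.genideal_ideal[OF G])
  show "?J \<subseteq> stanley_reisner_ideal \<Delta>"
  proof
    fix p assume p: "p \<in> ?J"
    show "p \<in> stanley_reisner_ideal \<Delta>"
    proof (rule poly_mapping_in_additive)
      show "0 \<in> (stanley_reisner_ideal \<Delta> :: ('v, 'k) mpoly set)"
        using additive_subgroup.zero_closed[OF I.additive_subgroup_axioms] by simp
      show "q + q' \<in> stanley_reisner_ideal \<Delta>"
        if "q \<in> stanley_reisner_ideal \<Delta>" "q' \<in> stanley_reisner_ideal \<Delta>" for q q' :: "('v, 'k) mpoly"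
        using additive_subgroup.a_closed[OF I.additive_subgroup_axioms that] by simp
      fix m assume m: "m \<in> Poly_Mapping.keys p"
      let ?F = "Poly_Mapping.keys m"
      let ?g = "monomial (expo 1 ?F) :: ('v, 'k) mpoly"
      have "?F \<notin> \<Delta>" using p m by blast
      then have "(\<Prod>v\<in>?F. mvar v) \<in> ?G" by blast
      then have "?g \<in> ?G" by (simp only: prod_mvar)
      then have g: "?g \<in> stanley_reisner_ideal \<Delta>"
        unfolding stanley_reisner_ideal_def by (rule subsetD[OF polynomial_ring.genideal_self[OF G]])
      have "(m - expo 1 ?F) + expo 1 ?F = m" by (rule expo_le_decomp) (simp add: in_keys_iff)
      then have "Poly_Mapping.single m (Poly_Mapping.lookup p m)
          = Poly_Mapping.single (m - expo 1 ?F) (Poly_Mapping.lookup p m) * monomial (expo 1 ?F)"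
        by (simp add: monomial_def mult_single)
      then show "Poly_Mapping.single m (Poly_Mapping.lookup p m) \<in> stanley_reisner_ideal \<Delta>"
        using I.I_l_closed[OF g] by simp
    qed
  qed
qed

text \<open>The assumption \<open>regular\<close> is supplied by the resolution, whose definition
  includes that the resolved module is graded. It also yields that \<open>R\<close> is a commutative
  ring.\<close>

locale stanley_reisner_ring =
  fixes \<Delta> :: "'v::finite set set" and W :: "'v set" and I :: "('v, 'k::field) mpoly set"
    and R :: "('v, 'k) mpoly set graded_ring"
  assumes complex: "simplicial_complex \<Delta>"
    and I_eq: "I = stanley_reisner_ideal \<Delta>"
    and R_eq: "R = graded_monomial_quotient W I"
    and regular: "graded_module R (regular_module R)"
begin

sublocale R: cring R
  using regular graded_module.axioms(1) module.axioms(1) by blast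

lemma mem_I: "p \<in> I \<longleftrightarrow> (\<forall>m \<in> Poly_Mapping.keys p. Poly_Mapping.keys m \<notin> \<Delta>)"
  unfolding I_eq stanley_reisner_ideal_eq[OF complex] by simp

lemma ideal_I: "ideal I polynomial_ring"
  unfolding I_eq stanley_reisner_ideal_def by (rule polynomial_ring.genideal_ideal) simp

definition cls :: "('v, 'k) mpoly \<Rightarrow> ('v, 'k) mpoly set" where
  "cls p = I +>\<^bsub>polynomial_ring\<^esub> p"

definition wdeg :: "('v \<Rightarrow>\<^sub>0 nat) \<Rightarrow> nat" where
  "wdeg m = (\<Sum>v\<in>W. Poly_Mapping.lookup m v)"

lemma wdeg_add: "wdeg (a + b) = wdeg a + wdeg b"
  unfolding wdeg_def by (simp add: lookup_add sum.distrib)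

lemma wdeg_expo: "F \<subseteq> W \<Longrightarrow> wdeg (expo n F) = n * card F"
  unfolding wdeg_def by (simp add: lookup_expo sum.If_cases Int_absorb1)

lemma R_simps:
  "carrier R = range cls" "cls p \<otimes>\<^bsub>R\<^esub> cls q = cls (p * q)" "cls p \<oplus>\<^bsub>R\<^esub> cls q = cls (p + q)"
  "\<one>\<^bsub>R\<^esub> = cls 1" "\<zero>\<^bsub>R\<^esub> = cls 0"
  "rgrade R j = cls ` {p. \<forall>m \<in> Poly_Mapping.keys p. int (wdeg m) = j}"
proof -
  interpret I: ideal I polynomial_ring by (rule ideal_I)
  let ?Q = "polynomial_ring Quot I"
  have h: "cls \<in> ring_hom polynomial_ring ?Q"
    using I.rcos_ring_hom unfolding cls_def[abs_def] .
  have e: "carrier R = carrier ?Q" "monoid.mult R = monoid.mult ?Q" "ring.add R = ring.add ?Q"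
    "one R = one ?Q" "ring.zero R = ring.zero ?Q"
    by (simp_all add: R_eq graded_monomial_quotient_def ring.defs)
  show "carrier R = range cls"
    unfolding e by (auto simp: FactRing_def A_RCOSETS_def' cls_def)
  show "cls p \<otimes>\<^bsub>R\<^esub> cls q = cls (p * q)" "cls p \<oplus>\<^bsub>R\<^esub> cls q = cls (p + q)"
    unfolding e using ring_hom_mult[OF h, of p q] ring_hom_add[OF h, of p q] by simp_all
  show "\<one>\<^bsub>R\<^esub> = cls 1" unfolding e using ring_hom_one[OF h] by simp
  show "\<zero>\<^bsub>R\<^esub> = cls 0"
    unfolding e cls_def using polynomial_ring.a_coset_add_zero[of I] by (simp add: FactRing_def)
  show "rgrade R j = cls ` {p. \<forall>m \<in> Poly_Mapping.keys p. int (wdeg m) = j}"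
    by (simp add: R_eq graded_monomial_quotient_def ring.defs cls_def[abs_def] wdeg_def)
qed

lemma cls_carrier [simp]: "cls p \<in> carrier R"
  by (simp add: R_simps)

lemma cls_uminus: "\<ominus>\<^bsub>R\<^esub> cls p = cls (- p)"
  by (rule R.minus_equality) (simp_all add: R_simps)

lemma cls_eq_zero: "cls p = \<zero>\<^bsub>R\<^esub> \<longleftrightarrow> p \<in> I"
proof -
  interpret I: ideal I polynomial_ring by (rule ideal_I)
  have z: "cls 0 = I" unfolding cls_def using polynomial_ring.a_coset_add_zero[of I] by simp
  show ?thesis
  proof
    assume "cls p = \<zero>\<^bsub>R\<^esub>"
    then show "p \<in> I" using I.a_rcos_self[of p] z unfolding R_simps cls_def by simp
  next
    assume "p \<in> I"
    then show "cls p = \<zero>\<^bsub>R\<^esub>" unfolding R_simps z unfolding cls_def using I.a_rcos_const by blast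
  qed
qed

lemma cls_eq_iff: "cls p = cls q \<longleftrightarrow> p - q \<in> I"
proof
  assume "cls p = cls q"
  then have "cls (p - q) = \<zero>\<^bsub>R\<^esub>" using R_simps(3)[of p "- q"] R_simps(3)[of q "- q"] R_simps(5) by simp
  then show "p - q \<in> I" by (simp only: cls_eq_zero)
next
  assume "p - q \<in> I"
  then have "cls (p - q) = \<zero>\<^bsub>R\<^esub>" by (simp only: cls_eq_zero)
  then show "cls p = cls q" using R_simps(3)[of "p - q" q] R.l_zero[of "cls q"] by simp
qed

text \<open>For \<open>T\<close> closed under multiplication by monomials this is a monomial ideal
  of \<open>R\<close>. Taking the ideal in the extension criterion of this form turns its hypothesis
  into a condition on monomials.\<close>

definition monomial_span :: "('v \<Rightarrow>\<^sub>0 nat) set \<Rightarrow> ('v, 'k) mpoly set set" where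
  "monomial_span T = cls ` {p. Poly_Mapping.keys p \<subseteq> T}"

lemma monomial_spanI: "Poly_Mapping.keys p \<subseteq> T \<Longrightarrow> cls p \<in> monomial_span T"
  unfolding monomial_span_def by blast

lemma monomial_spanE:
  assumes "r \<in> monomial_span T"
  obtains p where "r = cls p" "Poly_Mapping.keys p \<subseteq> T"
  using assms unfolding monomial_span_def by blast

lemma monomial_span_ideal:
  assumes "\<And>m l. m \<in> T \<Longrightarrow> l + m \<in> T"
  shows "ideal (monomial_span T) R"
proof (rule idealI)
  show "ring R" by (rule R.ring_axioms)
  show "subgroup (monomial_span T) (add_monoid R)"
  proof (rule R.add.subgroupI)
    show "monomial_span T \<subseteq> carrier R" unfolding monomial_span_def by auto
    show "monomial_span T \<noteq> {}" using monomial_spanI[of 0 T] by auto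
    show "\<ominus>\<^bsub>R\<^esub> a \<in> monomial_span T" if "a \<in> monomial_span T" for a
      using that by (rule monomial_spanE) (simp add: cls_uminus monomial_spanI)
    show "a \<oplus>\<^bsub>R\<^esub> b \<in> monomial_span T" if ab: "a \<in> monomial_span T" "b \<in> monomial_span T" for a b
    proof -
      obtain p where p: "a = cls p" "Poly_Mapping.keys p \<subseteq> T" using ab(1) by (rule monomial_spanE)
      obtain q where q: "b = cls q" "Poly_Mapping.keys q \<subseteq> T" using ab(2) by (rule monomial_spanE)
      have "Poly_Mapping.keys (p + q) \<subseteq> T" using keys_add[of p q] p(2) q(2) by blast
      then show ?thesis unfolding p(1) q(1) R_simps by (rule monomial_spanI)
    qed
  qed
  have l: "x \<otimes>\<^bsub>R\<^esub> a \<in> monomial_span T" if ax: "a \<in> monomial_span T" "x \<in> carrier R" for a x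
  proof -
    obtain p where p: "a = cls p" "Poly_Mapping.keys p \<subseteq> T" using ax(1) by (rule monomial_spanE)
    obtain q where q: "x = cls q" using ax(2) unfolding R_simps by blast
    have "Poly_Mapping.keys (q * p) \<subseteq> T"
    proof
      fix m assume "m \<in> Poly_Mapping.keys (q * p)"
      then obtain a b where "m = a + b" "b \<in> Poly_Mapping.keys p" using keys_mult[of q p] by blast
      then show "m \<in> T" using p(2) assms[of b a] by auto
    qed
    then show ?thesis unfolding p(1) q R_simps by (rule monomial_spanI)
  qed
  then show "x \<otimes>\<^bsub>R\<^esub> a \<in> monomial_span T" if "a \<in> monomial_span T" "x \<in> carrier R" for a x
    using that .
  show "a \<otimes>\<^bsub>R\<^esub> x \<in> monomial_span T" if "a \<in> monomial_span T" "x \<in> carrier R" for a x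
  proof -
    have "a \<in> carrier R" using that(1) by (rule monomial_spanE) simp
    then show ?thesis using l[OF that] R.m_comm[of a x] that(2) by simp
  qed
qed

lemma finsum_cls: "finite J \<Longrightarrow> finsum (regular_module R) (\<lambda>j. cls (g j)) J = cls (\<Sum>j\<in>J. g j)"
proof (induction J rule: finite_induct)
  interpret G: graded_module R "regular_module R" by (rule regular)
  {
    case empty
    then show ?case by (simp add: R_simps)
  next
    case (insert x F)
    then show ?case by (simp add: G.M.finsum_insert R_simps)
  }
qed

lemma component_cls: "component (regular_module R) i (cls p) = cls (restrict_keys {m. int (wdeg m) = i} p)"
proof -
  interpret G: graded_module R "regular_module R" by (rule regular)
  let ?f = "\<lambda>i. restrict_keys {m. int (wdeg m) = i} p"
  let ?J = "(\<lambda>m. int (wdeg m)) ` Poly_Mapping.keys p"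
  show ?thesis
  proof (rule G.component_unique)
    show "finite ?J" by simp
    show "cls (?f j) \<in> mgrade (regular_module R) j" for j
      unfolding regular_module_simps R_simps by (rule imageI) (simp add: keys_restrict_keys)
    show "cls (?f j) = \<zero>\<^bsub>regular_module R\<^esub>" if "j \<notin> ?J" for j
    proof -
      have "Poly_Mapping.keys (?f j) = {}" using that by (auto simp: keys_restrict_keys)
      then show ?thesis by (simp add: cls_eq_zero mem_I)
    qed
    have "p = (\<Sum>j\<in>?J. ?f j)"
      by (rule poly_mapping_eqI)
        (auto simp: lookup_sum lookup_restrict_keys in_keys_iff image_iff intro: ccontr)
    then show "cls p = (\<Oplus>\<^bsub>regular_module R\<^esub>j\<in>?J. cls (?f j))"
      by (simp add: finsum_cls)
  qed
qed

lemma monomial_span_component: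
  "r \<in> monomial_span T \<Longrightarrow> component (regular_module R) i r \<in> monomial_span T"
  by (erule monomial_spanE) (auto simp: component_cls keys_restrict_keys intro!: monomial_spanI)

text \<open>Acting through representatives in the polynomial ring permits arguments with monomials
  instead of cosets.\<close>

definition act :: "(('v, 'k) mpoly set, 'm, 'x) graded_module_scheme \<Rightarrow> ('v, 'k) mpoly \<Rightarrow> 'm \<Rightarrow> 'm" where
  "act M p x = cls p \<odot>\<^bsub>M\<^esub> x"

lemma act_hom: "f \<in> graded_hom R M N \<Longrightarrow> x \<in> carrier M \<Longrightarrow> f (act M p x) = act N p (f x)"
  unfolding graded_hom_def act_def using cls_carrier by blast

lemma act_regular: "act (regular_module R) p (cls q) = cls (p * q)"
  unfolding act_def by (simp add: R_simps)

abbreviation xpow :: "nat \<Rightarrow> 'v set \<Rightarrow> ('v, 'k) mpoly" where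
  "xpow n F \<equiv> monomial (expo n F)"

definition tors :: "(('v, 'k) mpoly set, 'm, 'x) graded_module_scheme \<Rightarrow> 'v set \<Rightarrow> 'm set" where
  "tors M F = {x \<in> carrier M. \<exists>n. act M (xpow n F) x = \<zero>\<^bsub>M\<^esub>}"

context
  fixes M :: "(('v, 'k) mpoly set, 'm, 'x) graded_module_scheme"
  assumes M: "graded_module R M"
begin

interpretation M: graded_module R M by (rule M)

lemma act_closed: "x \<in> carrier M \<Longrightarrow> act M p x \<in> carrier M"
  unfolding act_def by simp

lemma act_add: "x \<in> carrier M \<Longrightarrow> act M (p + q) x = act M p x \<oplus>\<^bsub>M\<^esub> act M q x"
  unfolding act_def by (simp add: M.smult_l_distr flip: R_simps(3))

lemma act_add_right: "x \<in> carrier M \<Longrightarrow> y \<in> carrier M \<Longrightarrow> act M p (x \<oplus>\<^bsub>M\<^esub> y) = act M p x \<oplus>\<^bsub>M\<^esub> act M p y"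
  unfolding act_def by (simp add: M.smult_r_distr)

lemma act_mult: "x \<in> carrier M \<Longrightarrow> act M (p * q) x = act M p (act M q x)"
  unfolding act_def by (simp add: M.smult_assoc1 flip: R_simps(2))

lemma act_1: "x \<in> carrier M \<Longrightarrow> act M 1 x = x"
  unfolding act_def by (simp flip: R_simps(4))

lemma act_I: "p \<in> I \<Longrightarrow> x \<in> carrier M \<Longrightarrow> act M p x = \<zero>\<^bsub>M\<^esub>"
  unfolding act_def cls_eq_zero[symmetric] by simp

lemma act_0: "x \<in> carrier M \<Longrightarrow> act M 0 x = \<zero>\<^bsub>M\<^esub>"
  by (rule act_I) (simp_all add: mem_I)

lemma act_zero: "act M p \<zero>\<^bsub>M\<^esub> = \<zero>\<^bsub>M\<^esub>"
  unfolding act_def by simp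

lemma act_minus_right:
  "x \<in> carrier M \<Longrightarrow> y \<in> carrier M \<Longrightarrow> act M p (x \<ominus>\<^bsub>M\<^esub> y) = act M p x \<ominus>\<^bsub>M\<^esub> act M p y"
  unfolding act_def by (simp add: M.smult_r_distr M.smult_r_minus a_minus_def)

lemma act_monomials:
  assumes "x \<in> carrier M" "\<And>m. m \<in> Poly_Mapping.keys p \<Longrightarrow> act M (monomial m) x = \<zero>\<^bsub>M\<^esub>"
  shows "act M p x = \<zero>\<^bsub>M\<^esub>"
proof -
  have "p \<in> {p. act M p x = \<zero>\<^bsub>M\<^esub>}"
  proof (rule poly_mapping_in_additive)
    fix m assume m: "m \<in> Poly_Mapping.keys p"
    have "Poly_Mapping.single m (Poly_Mapping.lookup p m) = Poly_Mapping.single 0 (Poly_Mapping.lookup p m) * monomial m"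
      by (simp add: monomial_def mult_single)
    then show "Poly_Mapping.single m (Poly_Mapping.lookup p m) \<in> {p. act M p x = \<zero>\<^bsub>M\<^esub>}"
      using assms(1) assms(2)[OF m] by (simp add: act_mult act_zero)
  qed (use assms(1) in \<open>simp_all add: act_0 act_add\<close>)
  then show ?thesis by simp
qed

lemma act_grade:
  assumes "x \<in> mgrade M j" "\<And>m. m \<in> Poly_Mapping.keys p \<Longrightarrow> int (wdeg m) = i"
  shows "act M p x \<in> mgrade M (i + j)"
proof -
  have "cls p \<in> rgrade R i" unfolding R_simps using assms(2) by blast
  then show ?thesis unfolding act_def using M.mgrade_smult assms(1) by blast
qed

lemma act_monomial_grade: "x \<in> mgrade M j \<Longrightarrow> act M (monomial m) x \<in> mgrade M (int (wdeg m) + j)"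
  by (rule act_grade) (simp_all add: monomial_def)

lemma act_X_dvd:
  assumes "x \<in> carrier M" "act M (xpow n F) x = \<zero>\<^bsub>M\<^esub>" "\<And>v. v \<in> F \<Longrightarrow> n \<le> Poly_Mapping.lookup m v"
  shows "act M (monomial m) x = \<zero>\<^bsub>M\<^esub>"
proof -
  have "monomial m = monomial (m - expo n F) * xpow n F"
    using expo_le_decomp[OF assms(3)] by (simp add: monomial_mult)
  then show ?thesis using assms(1,2) by (simp add: act_mult act_zero)
qed

lemma act_X_mono:
  "x \<in> carrier M \<Longrightarrow> act M (xpow n F) x = \<zero>\<^bsub>M\<^esub> \<Longrightarrow> F \<subseteq> G \<Longrightarrow> n \<le> k \<Longrightarrow> act M (xpow k G) x = \<zero>\<^bsub>M\<^esub>"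
  by (rule act_X_dvd) (auto simp: lookup_expo)

lemma tors_mono: "F \<subseteq> G \<Longrightarrow> tors M F \<subseteq> tors M G"
  unfolding tors_def using act_X_mono by blast

lemma tors_empty: "x \<in> tors M {} \<longleftrightarrow> x = \<zero>\<^bsub>M\<^esub>"
  unfolding tors_def by (auto simp: expo_def monomial_0 act_1)

lemma tors_subgroup: "additive_subgroup (tors M F) M"
proof (rule additive_subgroup.intro, rule M.M.add.subgroupI)
  show "tors M F \<subseteq> carrier M" unfolding tors_def by blast
  show "tors M F \<noteq> {}" unfolding tors_def using act_zero by blast
  show "\<ominus>\<^bsub>M\<^esub> a \<in> tors M F" if "a \<in> tors M F" for a
    using that unfolding tors_def act_def by (auto simp: M.smult_r_minus)
  show "a \<oplus>\<^bsub>M\<^esub> b \<in> tors M F" if ab: "a \<in> tors M F" "b \<in> tors M F" for a b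
  proof -
    obtain n k where n: "a \<in> carrier M" "act M (xpow n F) a = \<zero>\<^bsub>M\<^esub>" "b \<in> carrier M" "act M (xpow k F) b = \<zero>\<^bsub>M\<^esub>"
      using ab unfolding tors_def by blast
    have "act M (xpow (max n k) F) a = \<zero>\<^bsub>M\<^esub>" "act M (xpow (max n k) F) b = \<zero>\<^bsub>M\<^esub>"
      using act_X_mono[OF n(1,2) subset_refl] act_X_mono[OF n(3,4) subset_refl] by simp_all
    then have "act M (xpow (max n k) F) (a \<oplus>\<^bsub>M\<^esub> b) = \<zero>\<^bsub>M\<^esub>" using n by (simp add: act_add_right)
    then show ?thesis using n unfolding tors_def by blast
  qed
qed

text \<open>Multiplication by \<open>xpow n F\<close> is homogeneous, so if it annihilates
  \<open>x\<close>, it annihilates every component of \<open>x\<close>.\<close>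

lemma tors_component:
  assumes "x \<in> tors M F"
  shows "component M j x \<in> tors M F"
proof -
  obtain n where n: "x \<in> carrier M" "act M (xpow n F) x = \<zero>\<^bsub>M\<^esub>" using assms unfolding tors_def by blast
  have h: "cls (xpow n F) \<in> rgrade R (int (wdeg (expo n F)))"
    unfolding R_simps by (rule imageI) (simp add: monomial_def)
  have "act M (xpow n F) (component M j x) = component M (j + int (wdeg (expo n F))) (act M (xpow n F) x)"
    unfolding act_def using component_smult[OF M h cls_carrier n(1)] by simp
  also have "\<dots> = \<zero>\<^bsub>M\<^esub>" unfolding n(2) using M.component_homogeneous[OF M.mgrade_zero] by simp
  finally show ?thesis using M.component_carrier[OF n(1)] unfolding tors_def by blast
qed

end

lemma tors_hom:
  assumes "graded_module R M" "graded_module R N" "f \<in> graded_hom R M N" "x \<in> tors M F"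
  shows "f x \<in> tors N F"
proof -
  interpret M: graded_module R M by fact
  obtain n where n: "x \<in> carrier M" "act M (xpow n F) x = \<zero>\<^bsub>M\<^esub>" using assms(4) unfolding tors_def by blast
  have "act N (xpow n F) (f x) = f (act M 0 x)" using act_hom[OF assms(3) n(1)] n act_0[OF assms(1)] by metis
  also have "\<dots> = act N 0 (f x)" using act_hom[OF assms(3) n(1)] .
  moreover have "f x \<in> carrier N" using assms(3) n unfolding graded_hom_def by blast
  ultimately show ?thesis using act_0[OF assms(2)] unfolding tors_def by auto
qed

text \<open>Baer extension for a monomial ideal and a monomial. If \<open>r\<close> times
  \<open>monomial a\<close> lies in the ideal, this holds for each monomial of \<open>r\<close>
  separately, because \<open>I\<close> and the ideal are both spanned by monomials. So compatibility
  of the equations need only be tested on monomials.\<close>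

lemma injective_solve:
  assumes E: "graded_injective R M" and T: "\<And>m l. m \<in> T \<Longrightarrow> l + m \<in> T"
    and w: "w \<in> mgrade M (j + int (wdeg a))"
    and ann: "\<And>m. a + m \<in> T \<or> Poly_Mapping.keys (a + m) \<notin> \<Delta> \<Longrightarrow> act M (monomial m) w = \<zero>\<^bsub>M\<^esub>"
  obtains x where "x \<in> mgrade M j" "act M (monomial a) x = w" "\<And>m. m \<in> T \<Longrightarrow> act M (monomial m) x = \<zero>\<^bsub>M\<^esub>"
proof -
  have M: "graded_module R M" using E unfolding graded_injective_def by blast
  interpret M: graded_module R M by (rule M)
  have one: "\<one>\<^bsub>R\<^esub> \<in> rgrade R 0" unfolding R_simps by (rule imageI) (simp add: wdeg_def)
  have y: "cls (monomial a) \<in> rgrade R (int (wdeg a))" unfolding R_simps by (rule imageI) (simp add: monomial_def)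
  have ann': "r \<odot>\<^bsub>M\<^esub> w = \<zero>\<^bsub>M\<^esub>" if r: "r \<in> carrier R" "r \<otimes>\<^bsub>R\<^esub> cls (monomial a) \<in> monomial_span T" for r
  proof -
    obtain p where p: "r = cls p" using r(1) unfolding R_simps by blast
    then have "cls (monomial a * p) \<in> monomial_span T" using r(2) by (simp add: R_simps mult.commute)
    then obtain q where q: "cls (monomial a * p) = cls q" "Poly_Mapping.keys q \<subseteq> T" unfolding monomial_span_def by blast
    have "act M p w = \<zero>\<^bsub>M\<^esub>"
    proof (rule act_monomials[OF M M.mgrade_closed[OF w]], rule ann)
      fix m assume "m \<in> Poly_Mapping.keys p"
      then have "Poly_Mapping.lookup (monomial a * p) (a + m) \<noteq> 0"
        using keys_monomial_mult[of a p] by (metis imageI in_keys_iff)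
      \<comment> \<open>The monomial \<open>a + m\<close> occurs in \<open>q\<close>, and so lies in
        \<open>T\<close>, or it survives in the difference of the two representatives, which belongs
        to \<open>I\<close>.\<close>
      show "a + m \<in> T \<or> Poly_Mapping.keys (a + m) \<notin> \<Delta>"
      proof (cases "a + m \<in> Poly_Mapping.keys q")
        case True
        then show ?thesis using q by blast
      next
        case False
        then have "a + m \<in> Poly_Mapping.keys (monomial a * p - q)"
          using \<open>Poly_Mapping.lookup (monomial a * p) (a + m) \<noteq> 0\<close> by (simp add: in_keys_iff lookup_minus)
        then show ?thesis using q(1) unfolding cls_eq_iff mem_I by blast
      qed
    qed
    then show ?thesis unfolding p act_def .
  qed
  obtain x where x: "x \<in> mgrade M j" "cls (monomial a) \<odot>\<^bsub>M\<^esub> x = w" "\<And>t. t \<in> monomial_span T \<Longrightarrow> t \<odot>\<^bsub>M\<^esub> x = \<zero>\<^bsub>M\<^esub>"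
    using graded_injective_solve[OF E regular one monomial_span_ideal[OF T] monomial_span_component y w ann']
    by blast
  have "act M (monomial m) x = \<zero>\<^bsub>M\<^esub>" if "m \<in> T" for m
  proof -
    have "cls (monomial m) \<in> monomial_span T" unfolding monomial_span_def by (rule imageI) (simp add: monomial_def that)
    then show ?thesis using x(3) unfolding act_def by blast
  qed
  then show ?thesis using that x(1,2) unfolding act_def by blast
qed

text \<open>One solves for \<open>t\<close> with \<open>xpow n F\<close> acting on \<open>t\<close>
  as on \<open>x\<close> and with the \<open>n\<close>-th powers of \<open>v\<close> and of all
  \<open>u \<in> T\<close> annihilating \<open>t\<close>. The system is compatible: a multiple of
  \<open>xpow n F\<close> divisible by the \<open>n\<close>-th power of \<open>v\<close> is
  divisible by \<open>xpow n (insert v F)\<close>, and this annihilates \<open>x\<close>; one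
  divisible by the \<open>n\<close>-th power of some \<open>u \<in> T\<close> annihilates
  \<open>x\<close> as well.\<close>

lemma tors_split:
  assumes E: "graded_injective R M" and x: "x \<in> mgrade M j" and F: "F \<subseteq> W" "v \<notin> F" "v \<notin> T"
    and xT: "\<forall>u\<in>T. x \<in> tors M {u}" and xv: "x \<in> tors M (insert v F)"
  shows "\<exists>t \<in> mgrade M j. t \<in> tors M {v} \<and> (\<forall>u\<in>T. t \<in> tors M {u}) \<and> x \<ominus>\<^bsub>M\<^esub> t \<in> tors M F"
proof -
  have M: "graded_module R M" using E unfolding graded_injective_def by blast
  interpret M: graded_module R M by (rule M)
  have xc: "x \<in> carrier M" using M.mgrade_closed[OF x] .
  obtain n1 where n1: "act M (xpow n1 (insert v F)) x = \<zero>\<^bsub>M\<^esub>" using xv unfolding tors_def by blast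
  have "\<exists>n. \<forall>u\<in>T. act M (xpow n {u}) x = \<zero>\<^bsub>M\<^esub>"
    by (rule uniform_bound) (use xT act_X_mono[OF M xc _ subset_refl] in \<open>auto simp: tors_def\<close>)
  then obtain n2 where n2: "\<forall>u\<in>T. act M (xpow n2 {u}) x = \<zero>\<^bsub>M\<^esub>" by blast
  define n where "n = max n1 n2"
  have nv: "act M (xpow n (insert v F)) x = \<zero>\<^bsub>M\<^esub>"
    by (rule act_X_mono[OF M xc n1]) (simp_all add: n_def)
  have nT: "act M (xpow n {u}) x = \<zero>\<^bsub>M\<^esub>" if "u \<in> T" for u
    by (rule act_X_mono[OF M xc n2[rule_format, OF that]]) (simp_all add: n_def)
  \<comment> \<open>The monomials of the ideal generated by the \<open>n\<close>-th powers of
    \<open>v\<close> and of the variables in \<open>T\<close>.\<close>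
  let ?D = "{m. n \<le> Poly_Mapping.lookup m v \<or> (\<exists>u\<in>T. n \<le> Poly_Mapping.lookup m u)}"
  obtain t where t: "t \<in> mgrade M j" "act M (xpow n F) t = act M (xpow n F) x" "\<And>m. m \<in> ?D \<Longrightarrow> act M (monomial m) t = \<zero>\<^bsub>M\<^esub>"
  proof (rule injective_solve[OF E, of ?D "act M (xpow n F) x" j "expo n F"])
    show "l + m \<in> ?D" if "m \<in> ?D" for m l using that by (auto simp: lookup_add intro: trans_le_add2)
    show "act M (xpow n F) x \<in> mgrade M (j + int (wdeg (expo n F)))"
      using act_monomial_grade[OF M x] by (simp add: add.commute)
    fix m assume m: "expo n F + m \<in> ?D \<or> Poly_Mapping.keys (expo n F + m) \<notin> \<Delta>"
    have eq: "act M (monomial m) (act M (xpow n F) x) = act M (monomial (expo n F + m)) x"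
      using act_mult[OF M xc, of "monomial m" "xpow n F"] by (simp add: monomial_mult add.commute)
    show "act M (monomial m) (act M (xpow n F) x) = \<zero>\<^bsub>M\<^esub>"
      unfolding eq
    proof (cases "Poly_Mapping.keys (expo n F + m) \<notin> \<Delta>")
      case True
      then show "act M (monomial (expo n F + m)) x = \<zero>\<^bsub>M\<^esub>"
        by (intro act_I[OF M _ xc]) (simp add: mem_I monomial_def)
    next
      case False
      then consider "n \<le> Poly_Mapping.lookup (expo n F + m) v" | u where "u \<in> T" "n \<le> Poly_Mapping.lookup (expo n F + m) u"
        using m by blast
      then show "act M (monomial (expo n F + m)) x = \<zero>\<^bsub>M\<^esub>"
      proof cases
        case 1
        then show ?thesis
          by (intro act_X_dvd[OF M xc nv]) (auto simp: lookup_add lookup_expo)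
      next
        case 2
        show ?thesis by (rule act_X_dvd[OF M xc nT[OF 2(1)]]) (use 2 in auto)
      qed
    qed
  qed blast
  have tc: "t \<in> carrier M" using M.mgrade_closed[OF t(1)] .
  have "t \<in> tors M {v}" using t(3)[of "expo n {v}"] tc unfolding tors_def by (auto simp: lookup_expo)
  moreover have "t \<in> tors M {u}" if "u \<in> T" for u
  proof -
    have "expo n {u} \<in> ?D" using that by (auto simp: lookup_expo)
    then show ?thesis using t(3) tc unfolding tors_def by blast
  qed
  moreover have "x \<ominus>\<^bsub>M\<^esub> t \<in> tors M F"
  proof -
    have "act M (xpow n F) (x \<ominus>\<^bsub>M\<^esub> t) = \<zero>\<^bsub>M\<^esub>"
      using act_minus_right[OF M xc tc] t(2) act_closed[OF M xc] by (simp add: a_minus_def M.M.r_neg)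
    then show ?thesis unfolding tors_def using xc tc by blast
  qed
  ultimately show ?thesis using t(1) by blast
qed

text \<open>The element found represents \<open>w\<close> divided by \<open>xpow n F\<close>, modulo
  \<open>F\<close>-torsion. The spare factor \<open>xpow 1 F\<close> on both sides is what makes the
  equation solvable: it has the same support as \<open>xpow (Suc n) F\<close>, so any monomial that
  takes \<open>xpow (Suc n) F\<close> into \<open>I\<close> also takes \<open>xpow 1 F\<close> into
  \<open>I\<close>.\<close>

lemma divide:
  assumes E: "graded_injective R M" and F: "F \<subseteq> W" and w: "w \<in> mgrade M (j + int (n * card F))"
  obtains x where "x \<in> mgrade M j" "act M (xpow (Suc n) F) x = act M (xpow 1 F) w"
proof -
  have M: "graded_module R M" using E unfolding graded_injective_def by blast
  interpret M: graded_module R M by (rule M)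
  have wc: "w \<in> carrier M" using M.mgrade_closed[OF w] .
  show ?thesis
  proof (rule injective_solve[OF E, of "{}" "act M (xpow 1 F) w" j "expo (Suc n) F"])
    show "act M (xpow 1 F) w \<in> mgrade M (j + int (wdeg (expo (Suc n) F)))"
      using act_monomial_grade[OF M w, of "expo 1 F"] wdeg_expo[OF F] by (simp add: algebra_simps)
    fix m assume "expo (Suc n) F + m \<in> {} \<or> Poly_Mapping.keys (expo (Suc n) F + m) \<notin> \<Delta>"
    then have m: "Poly_Mapping.keys (expo 1 F + m) \<notin> \<Delta>" by (simp add: keys_add_nat keys_expo)
    have "act M (monomial m) (act M (xpow 1 F) w) = act M (monomial (expo 1 F + m)) w"
      using act_mult[OF M wc, of "monomial m" "xpow 1 F"] by (simp add: monomial_mult add.commute)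
    also have "\<dots> = \<zero>\<^bsub>M\<^esub>" using m by (intro act_I[OF M _ wc]) (simp add: mem_I monomial_def)
    finally show "act M (monomial m) (act M (xpow 1 F) w) = \<zero>\<^bsub>M\<^esub>" .
  qed (use that in auto)
qed

section \<open>Powers of \<open>P\<close> and torsion with respect to single variables\<close>

lemma ideal_power_subset:
  assumes P: "P = Idl\<^bsub>R\<^esub> ((\<lambda>v. cls (mvar v)) ` W)"
  shows "P [^]\<^bsub>ideals_set R\<^esub> (n::nat) \<subseteq> monomial_span {m. n \<le> wdeg m}"
proof (induction n)
  case 0
  then show ?case by (auto simp: ideals_set_def monomial_span_def R_simps)
next
  case (Suc n)
  have "(\<lambda>v. cls (mvar v)) ` W \<subseteq> monomial_span {m. 1 \<le> wdeg m}"
    unfolding monomial_span_def mvar_def monomial_def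
  proof (intro image_subsetI imageI)
    fix v assume "v \<in> W"
    then have "1 \<le> wdeg (Poly_Mapping.single v 1)"
      unfolding wdeg_def by (simp add: lookup_single when_def)
    then show "Poly_Mapping.single (Poly_Mapping.single v 1) 1 \<in> {p. Poly_Mapping.keys p \<subseteq> {m. 1 \<le> wdeg m}}" by simp
  qed
  moreover have "ideal (monomial_span {m. 1 \<le> wdeg m}) R"
    by (rule monomial_span_ideal) (simp add: wdeg_add)
  ultimately have P1: "P \<subseteq> monomial_span {m. 1 \<le> wdeg m}"
    unfolding P using R.genideal_minimal by blast
  show ?case
  proof
    fix x assume "x \<in> P [^]\<^bsub>ideals_set R\<^esub> Suc n"
    then have "x \<in> ideal_prod R (P [^]\<^bsub>ideals_set R\<^esub> n) P" by (simp add: ideals_set_def nat_pow_def)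
    then show "x \<in> monomial_span {m. Suc n \<le> wdeg m}"
    proof (induction rule: ideal_prod.induct)
      case (prod i j)
      obtain p q where p: "i = cls p" "Poly_Mapping.keys p \<subseteq> {m. n \<le> wdeg m}" and q: "j = cls q" "Poly_Mapping.keys q \<subseteq> {m. 1 \<le> wdeg m}"
        using subsetD[OF Suc.IH prod(1)] subsetD[OF P1 prod(2)] unfolding monomial_span_def by blast
      have "Poly_Mapping.keys (p * q) \<subseteq> {m. Suc n \<le> wdeg m}"
      proof
        fix m assume "m \<in> Poly_Mapping.keys (p * q)"
        then obtain a b where "m = a + b" "a \<in> Poly_Mapping.keys p" "b \<in> Poly_Mapping.keys q" using keys_mult[of p q] by blast
        then have "n \<le> wdeg a" "1 \<le> wdeg b" "wdeg m = wdeg a + wdeg b" using p q by (auto simp: wdeg_add)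
        then show "m \<in> {m. Suc n \<le> wdeg m}" by simp
      qed
      then show ?case unfolding monomial_span_def p q R_simps by blast
    next
      case (sum s1 s2)
      obtain p q where p: "s1 = cls p" "Poly_Mapping.keys p \<subseteq> {m. Suc n \<le> wdeg m}" "s2 = cls q" "Poly_Mapping.keys q \<subseteq> {m. Suc n \<le> wdeg m}"
        using sum.IH unfolding monomial_span_def by blast
      have "Poly_Mapping.keys (p + q) \<subseteq> {m. Suc n \<le> wdeg m}" using keys_add[of p q] p by blast
      then show ?case unfolding monomial_span_def p R_simps by blast
    qed
  qed
qed

lemma X_in_ideal_power:
  assumes P: "P = Idl\<^bsub>R\<^esub> ((\<lambda>v. cls (mvar v)) ` W)" and v: "v \<in> W"
  shows "cls (xpow n {v}) \<in> P [^]\<^bsub>ideals_set R\<^esub> (n::nat)"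
proof (induction n)
  case 0
  then show ?case by (simp add: ideals_set_def)
next
  case (Suc n)
  have "(\<lambda>v. cls (mvar v)) ` W \<subseteq> P" unfolding P by (rule R.genideal_self) auto
  then have "cls (mvar v) \<in> P" using v by blast
  then have "cls (xpow n {v}) \<otimes>\<^bsub>R\<^esub> cls (mvar v) \<in> ideal_prod R (P [^]\<^bsub>ideals_set R\<^esub> n) P"
    using Suc by (rule ideal_prod.prod[rotated])
  moreover have "xpow n {v} * mvar v = xpow (Suc n) {v}"
    by (simp add: mvar_def monomial_mult expo_def flip: single_add)
  ultimately show ?case by (simp add: R_simps ideals_set_def nat_pow_def)
qed

text \<open>The \<open>n\<close>-th power of \<open>P\<close> contains the \<open>n\<close>-th
  powers of the variables in \<open>W\<close>. The converse is a pigeonhole argument on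
  exponents.\<close>

lemma power_torsion_iff:
  assumes P: "P = Idl\<^bsub>R\<^esub> ((\<lambda>v. cls (mvar v)) ` W)" and M: "graded_module R M" and x: "x \<in> carrier M"
  shows "(\<exists>n::nat. \<forall>a \<in> P [^]\<^bsub>ideals_set R\<^esub> n. a \<odot>\<^bsub>M\<^esub> x = \<zero>\<^bsub>M\<^esub>) \<longleftrightarrow> (\<forall>v\<in>W. x \<in> tors M {v})"
proof
  assume "\<exists>n::nat. \<forall>a \<in> P [^]\<^bsub>ideals_set R\<^esub> n. a \<odot>\<^bsub>M\<^esub> x = \<zero>\<^bsub>M\<^esub>"
  then obtain n :: nat where "\<forall>a \<in> P [^]\<^bsub>ideals_set R\<^esub> n. a \<odot>\<^bsub>M\<^esub> x = \<zero>\<^bsub>M\<^esub>" ..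
  then have "act M (xpow n {v}) x = \<zero>\<^bsub>M\<^esub>" if "v \<in> W" for v
    unfolding act_def using X_in_ideal_power[OF P that, of n] by blast
  then show "\<forall>v\<in>W. x \<in> tors M {v}" unfolding tors_def using x by blast
next
  assume t: "\<forall>v\<in>W. x \<in> tors M {v}"
  have "\<exists>n. \<forall>v\<in>W. act M (xpow n {v}) x = \<zero>\<^bsub>M\<^esub>"
    by (rule uniform_bound) (use t act_X_mono[OF M x _ subset_refl] in \<open>auto simp: tors_def\<close>)
  then obtain n where n: "\<And>v. v \<in> W \<Longrightarrow> act M (xpow n {v}) x = \<zero>\<^bsub>M\<^esub>" by blast
  \<comment> \<open>If the \<open>W\<close>-degree exceeds \<open>card W * n\<close>, some variable
    of \<open>W\<close> has an exponent above \<open>n\<close>.\<close>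
  have "a \<odot>\<^bsub>M\<^esub> x = \<zero>\<^bsub>M\<^esub>" if a: "a \<in> P [^]\<^bsub>ideals_set R\<^esub> Suc (card W * n)" for a
  proof -
    obtain p where p: "a = cls p" "Poly_Mapping.keys p \<subseteq> {m. Suc (card W * n) \<le> wdeg m}"
      using subsetD[OF ideal_power_subset[OF P] a] by (rule monomial_spanE)
    have "act M p x = \<zero>\<^bsub>M\<^esub>"
    proof (rule act_monomials[OF M x])
      fix m assume "m \<in> Poly_Mapping.keys p"
      then have "\<not> wdeg m \<le> card W * n" using p by fastforce
      then obtain v where v: "v \<in> W" "\<not> Poly_Mapping.lookup m v \<le> n"
        unfolding wdeg_def using sum_bounded_above[of W "Poly_Mapping.lookup m" n] by auto
      show "act M (monomial m) x = \<zero>\<^bsub>M\<^esub>"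
        by (rule act_X_dvd[OF M x n[OF v(1)]]) (use v in auto)
    qed
    then show ?thesis unfolding p act_def .
  qed
  then show "\<exists>n::nat. \<forall>a \<in> P [^]\<^bsub>ideals_set R\<^esub> n. a \<odot>\<^bsub>M\<^esub> x = \<zero>\<^bsub>M\<^esub>" by blast
qed

end

section \<open>Local cohomology\<close>

locale stanley_reisner_resolution = stanley_reisner_ring \<Delta> W I R
  for \<Delta> :: "'v::finite set set" and W and I :: "('v, 'k::field) mpoly set" and R +
  fixes P :: "('v, 'k) mpoly set set"
    and E :: "nat \<Rightarrow> (('v, 'k) mpoly set, 'm) graded_module"
    and e :: "('v, 'k) mpoly set \<Rightarrow> 'm"
    and d :: "nat \<Rightarrow> 'm \<Rightarrow> 'm"
    and xs :: "'v list"
  assumes P: "P = Idl\<^bsub>R\<^esub> ((\<lambda>v. cls (mvar v)) ` W)"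
    and resolution: "graded_injective_resolution R (regular_module R) e E d"
    and xs: "distinct xs" "set xs = W"
begin

lemma injective: "graded_injective R (E q)"
  and e_hom: "e \<in> graded_hom R (regular_module R) (E 0)"
  and e_inj: "inj_on e (carrier R)"
  and d_hom: "d q \<in> graded_hom R (E q) (E (Suc q))"
  and e_exact: "e ` carrier R = a_kernel (E 0) (E 1) (d 0)"
  and d_exact: "d q ` carrier (E q) = a_kernel (E (Suc q)) (E (Suc (Suc q))) (d (Suc q))"
  using resolution unfolding graded_injective_resolution_def by auto

lemma E_module: "graded_module R (E q)"
  using injective unfolding graded_injective_def by blast

lemma E_group: "abelian_group (E q)"
  using E_module[of q] graded_module.axioms(1) module.axioms(2) by blast

lemma d_closed: "x \<in> carrier (E q) \<Longrightarrow> d q x \<in> carrier (E (Suc q))"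
  and d_add: "x \<in> carrier (E q) \<Longrightarrow> y \<in> carrier (E q) \<Longrightarrow> d q (x \<oplus>\<^bsub>E q\<^esub> y) = d q x \<oplus>\<^bsub>E (Suc q)\<^esub> d q y"
  and d_grade: "x \<in> mgrade (E q) j \<Longrightarrow> d q x \<in> mgrade (E (Suc q)) j"
  using d_hom[of q] unfolding graded_hom_def by (auto simp: image_subset_iff)

lemma e_closed: "e (cls p) \<in> carrier (E 0)"
  and e_add: "e (cls (p + p')) = e (cls p) \<oplus>\<^bsub>E 0\<^esub> e (cls p')"
  and e_grade: "(\<And>m. m \<in> Poly_Mapping.keys p \<Longrightarrow> int (wdeg m) = j) \<Longrightarrow> e (cls p) \<in> mgrade (E 0) j"
proof -
  show "e (cls p) \<in> carrier (E 0)" using e_hom unfolding graded_hom_def by auto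
  have "e (cls p \<oplus>\<^bsub>R\<^esub> cls p') = e (cls p) \<oplus>\<^bsub>E 0\<^esub> e (cls p')"
    using e_hom unfolding graded_hom_def by auto
  then show "e (cls (p + p')) = e (cls p) \<oplus>\<^bsub>E 0\<^esub> e (cls p')" by (simp add: R_simps)
  assume "\<And>m. m \<in> Poly_Mapping.keys p \<Longrightarrow> int (wdeg m) = j"
  then have "cls p \<in> mgrade (regular_module R) j" unfolding regular_module_simps R_simps by blast
  then show "e (cls p) \<in> mgrade (E 0) j" using e_hom unfolding graded_hom_def by blast
qed

lemma act_e: "act (E 0) p (e (cls p')) = e (cls (p * p'))"
  using act_hom[OF e_hom, of "cls p'" p] by (simp add: act_regular)

lemma act_d: "x \<in> carrier (E q) \<Longrightarrow> d q (act (E q) p x) = act (E (Suc q)) p (d q x)"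
  by (rule act_hom[OF d_hom])

lemma e_zero: "e (cls 0) = \<zero>\<^bsub>E 0\<^esub>"
  using act_e[of 0 0] act_0[OF E_module e_closed, of 0] by simp

lemma e_diff: "e (cls (p - p')) = e (cls p) \<ominus>\<^bsub>E 0\<^esub> e (cls p')"
proof -
  interpret E: abelian_group "E 0" by (rule E_group)
  have "e (cls p) = e (cls (p - p')) \<oplus>\<^bsub>E 0\<^esub> e (cls p')" using e_add[of "p - p'" p'] by simp
  then show ?thesis using e_closed by (simp add: a_minus_def E.a_assoc E.r_neg)
qed

lemma d_zero: "d q \<zero>\<^bsub>E q\<^esub> = \<zero>\<^bsub>E (Suc q)\<^esub>"
  using finsum_additive[OF E_group[of q] E_group[of "Suc q"], of "d q" "{}" undefined] d_closed d_add
  by (simp add: abelian_monoid.finsum_empty[OF abelian_group.axioms(1)[OF E_group]])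

lemma e_eq_zero: "e (cls p) = \<zero>\<^bsub>E 0\<^esub> \<longleftrightarrow> p \<in> I"
proof -
  have "e (cls p) = e (cls 0) \<longleftrightarrow> cls p = cls 0" using inj_on_eq_iff[OF e_inj] by simp
  also have "\<dots> \<longleftrightarrow> p \<in> I" by (simp add: cls_eq_iff)
  finally show ?thesis by (simp add: e_zero)
qed

lemma d_d: "x \<in> carrier (E q) \<Longrightarrow> d (Suc q) (d q x) = \<zero>\<^bsub>E (Suc (Suc q))\<^esub>"
  using d_exact[of q] unfolding a_kernel_def' by blast

lemma d_e: "d 0 (e (cls p)) = \<zero>\<^bsub>E (Suc 0)\<^esub>"
  using e_exact unfolding a_kernel_def' by auto

text \<open>Exactness is given for whole modules. As \<open>d q\<close> has degree 0, the degree
  \<open>j\<close> component of any primitive is again a primitive.\<close>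

lemma d_primitive:
  assumes z: "z \<in> mgrade (E (Suc q)) j" "d (Suc q) z = \<zero>\<^bsub>E (Suc (Suc q))\<^esub>"
  obtains w where "w \<in> mgrade (E q) j" "d q w = z"
proof -
  interpret E: graded_module R "E q" by (rule E_module)
  interpret E': graded_module R "E (Suc q)" by (rule E_module)
  have "z \<in> d q ` carrier (E q)"
    unfolding d_exact a_kernel_def' using z E'.mgrade_closed by simp
  then obtain w where w: "w \<in> carrier (E q)" "z = d q w" by blast
  have "d q (component (E q) j w) = component (E (Suc q)) j z"
    unfolding w(2) by (rule component_graded_hom[OF E_module E_module d_hom w(1), symmetric])
  also have "\<dots> = z" using E'.component_homogeneous[OF z(1)] by simp
  finally show ?thesis using that E.component_in[OF w(1)] by blast
qed

text \<open>The component is realised by truncating a representing polynomial. That all its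
  monomials have degree \<open>j\<close>, and not just its class, is needed later for counting
  exponents.\<close>

lemma e_primitive:
  assumes z: "z \<in> mgrade (E 0) j" "d 0 z = \<zero>\<^bsub>E (Suc 0)\<^esub>"
  obtains p where "\<And>m. m \<in> Poly_Mapping.keys p \<Longrightarrow> int (wdeg m) = j" "e (cls p) = z"
proof -
  interpret E: graded_module R "E 0" by (rule E_module)
  have "z \<in> e ` carrier R"
    unfolding e_exact a_kernel_def' using z E.mgrade_closed by simp
  then obtain p where p: "z = e (cls p)" unfolding R_simps by blast
  let ?p = "restrict_keys {m. int (wdeg m) = j} p"
  have "e (cls ?p) = component (E 0) j z"
    unfolding p component_cls[symmetric]
    by (rule component_graded_hom[OF regular E_module e_hom, symmetric]) simp
  also have "\<dots> = z" using E.component_homogeneous[OF z(1)] by simp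
  finally show ?thesis by (intro that[of ?p]) (auto simp: keys_restrict_keys)
qed

text \<open>Only elements of degree \<open>j\<close> occur as generators, so evaluation stays in
  degree \<open>j\<close> and each degree has a bicomplex of its own.\<close>

definition A :: "int \<Rightarrow> nat \<Rightarrow> ('m \<Rightarrow>\<^sub>0 int) set" where
  "A j q = {z. Poly_Mapping.keys z \<subseteq> mgrade (E q) j}"

text \<open>For \<open>F = {}\<close> these are the formal combinations evaluating to 0, so that
  \<open>A j q\<close> modulo \<open>N j q {}\<close> is the degree \<open>j\<close> component of
  \<open>E q\<close>.\<close>

definition N :: "int \<Rightarrow> nat \<Rightarrow> 'v set \<Rightarrow> ('m \<Rightarrow>\<^sub>0 int) set" where
  "N j q F = {z \<in> A j q. frag_eval (E q) z \<in> tors (E q) F}"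

text \<open>This lift of \<open>d q\<close> is additive on all formal combinations, as the bicomplex
  demands, whereas \<open>d q\<close> is additive on \<open>carrier (E q)\<close>.\<close>

definition D :: "nat \<Rightarrow> ('m \<Rightarrow>\<^sub>0 int) \<Rightarrow> 'm \<Rightarrow>\<^sub>0 int" where
  "D q = frag_extend (frag_of \<circ> d q)"

lemma A_keys: "z \<in> A j q \<Longrightarrow> Poly_Mapping.keys z \<subseteq> carrier (E q)"
  unfolding A_def using graded_module.mgrade_closed[OF E_module] by blast

lemma eval_grade: "z \<in> A j q \<Longrightarrow> frag_eval (E q) z \<in> mgrade (E q) j"
  unfolding A_def
  using abelian_group.frag_eval_closed[OF E_group graded_module.mgrade_subgroup[OF E_module]] by blast

lemma eval_closed: "z \<in> A j q \<Longrightarrow> frag_eval (E q) z \<in> carrier (E q)"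
  using eval_grade graded_module.mgrade_closed[OF E_module] by blast

lemma A_diff: "z \<in> A j q \<Longrightarrow> w \<in> A j q \<Longrightarrow> z - w \<in> A j q"
  unfolding A_def using keys_diff[of z w] by blast

lemma eval_diff: "z \<in> A j q \<Longrightarrow> w \<in> A j q \<Longrightarrow> frag_eval (E q) (z - w) = frag_eval (E q) z \<ominus>\<^bsub>E q\<^esub> frag_eval (E q) w"
  by (rule abelian_group.frag_eval_diff[OF E_group A_keys A_keys])

lemma frag_of_A: "x \<in> mgrade (E q) j \<Longrightarrow> frag_of x \<in> A j q"
  unfolding A_def by (simp add: keys_frag_of)

lemma eval_frag_of: "x \<in> mgrade (E q) j \<Longrightarrow> frag_eval (E q) (frag_of x) = x"
  by (rule abelian_group.frag_eval_of[OF E_group graded_module.mgrade_closed[OF E_module]])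

lemma D_A: "z \<in> A j q \<Longrightarrow> D q z \<in> A j (Suc q)"
  unfolding A_def D_def using keys_frag_map[of "d q" z] d_grade by blast

lemma eval_D: "z \<in> A j q \<Longrightarrow> frag_eval (E (Suc q)) (D q z) = d q (frag_eval (E q) z)"
  unfolding D_def by (rule frag_eval_map[OF E_group E_group _ _ A_keys]) (auto simp: d_closed d_add)

lemma D_frag_of: "D q (frag_of x) = frag_of (d q x)"
  unfolding D_def by simp

lemma N_empty: "z \<in> N j q {} \<longleftrightarrow> z \<in> A j q \<and> frag_eval (E q) z = \<zero>\<^bsub>E q\<^esub>"
  unfolding N_def tors_empty[OF E_module] by blast

lemma tors_minus: "x \<in> tors (E q) F \<Longrightarrow> y \<in> tors (E q) F \<Longrightarrow> x \<ominus>\<^bsub>E q\<^esub> y \<in> tors (E q) F"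
  unfolding a_minus_def
  using additive_subgroup.a_closed[OF tors_subgroup[OF E_module]]
    subgroup.m_inv_closed[OF additive_subgroup.a_subgroup[OF tors_subgroup[OF E_module]], of y]
  by (simp add: a_inv_def)

lemma zero_tors: "\<zero>\<^bsub>E q\<^esub> \<in> tors (E q) F"
  by (rule additive_subgroup.zero_closed[OF tors_subgroup[OF E_module]])

text \<open>Two conditions carry content, and both rest on injectivity: the splitting of torsion,
  which is \<open>tors_split\<close>, and exactness of the resolution modulo
  \<open>F\<close>-torsion, which is obtained from \<open>divide\<close>.\<close>

lemma bicomplex: "torsion_bicomplex xs (A j) (N j) D"
proof
  show "distinct xs" by (rule xs)
  fix q
  interpret E: graded_module R "E q" by (rule E_module)
  interpret E': graded_module R "E (Suc q)" by (rule E_module)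
  show A0: "0 \<in> A j q" unfolding A_def by simp
  show "a - b \<in> A j q" if "a \<in> A j q" "b \<in> A j q" for a b using that by (rule A_diff)
  show "D q (a - b) = D q a - D q b" for a b unfolding D_def by (rule frag_extend_diff)
  show "D q a \<in> A j (Suc q)" if "a \<in> A j q" for a using that by (rule D_A)
  show "D (Suc q) (D q a) \<in> N j (Suc (Suc q)) {}" if "a \<in> A j q" for a
    using eval_D[OF D_A[OF that]] eval_D[OF that] d_d[OF eval_closed[OF that]] D_A[OF D_A[OF that]]
    by (simp add: N_empty)
  fix F
  show "N j q F \<subseteq> A j q" unfolding N_def by blast
  show "0 \<in> N j q F" unfolding N_def using A0 E.M.frag_eval_0 zero_tors by simp
  show "a - b \<in> N j q F" if "a \<in> N j q F" "b \<in> N j q F" for a b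
  proof -
    have "a \<in> A j q" "b \<in> A j q" using that unfolding N_def by auto
    then show ?thesis using that eval_diff[of a j q b] A_diff[of a j q b] unfolding N_def by (simp add: tors_minus)
  qed
  show "N j q F \<subseteq> N j q G" if "F \<subseteq> G" for G
    unfolding N_def using tors_mono[OF E_module that] by blast
  show "D q a \<in> N j (Suc q) F" if "a \<in> N j q F" for a
  proof -
    have "a \<in> A j q" using that unfolding N_def by auto
    then show ?thesis using that eval_D[of a j q] D_A[of a j q] unfolding N_def
      by (simp add: tors_hom[OF E_module E_module d_hom])
  qed
  show "\<exists>t \<in> N j q {x}. (\<forall>u\<in>T. t \<in> N j q {u}) \<and> a - t \<in> N j q F"
    if s: "insert x F \<subseteq> set xs" "x \<notin> F" "x \<notin> T" and a: "a \<in> A j q" "\<forall>u\<in>T. a \<in> N j q {u}" "a \<in> N j q (insert x F)"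
    for x T a
  proof -
    have F: "F \<subseteq> W" using s xs by blast
    have aT: "\<forall>u\<in>T. frag_eval (E q) a \<in> tors (E q) {u}" and ax: "frag_eval (E q) a \<in> tors (E q) (insert x F)"
      using a unfolding N_def by blast+
    obtain t where t: "t \<in> mgrade (E q) j" "t \<in> tors (E q) {x}" "\<forall>u\<in>T. t \<in> tors (E q) {u}"
      "frag_eval (E q) a \<ominus>\<^bsub>E q\<^esub> t \<in> tors (E q) F"
      using tors_split[OF injective eval_grade[OF a(1)] F s(2,3) aT ax] by blast
    have "frag_of t \<in> N j q G" if "t \<in> tors (E q) G" for G
      unfolding N_def using that frag_of_A[OF t(1)] eval_frag_of[OF t(1)] by simp
    moreover have "a - frag_of t \<in> N j q F"
      unfolding N_def using A_diff[OF a(1) frag_of_A[OF t(1)]] eval_diff[OF a(1) frag_of_A[OF t(1)]]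
        eval_frag_of[OF t(1)] t(4) by simp
    ultimately show ?thesis using t by (intro bexI[of _ "frag_of t"]) simp_all
  qed
  show "\<exists>b \<in> A j q. a - D q b \<in> N j (Suc q) F"
    if F': "F \<subseteq> set xs" and a: "a \<in> A j (Suc q)" and da: "D (Suc q) a \<in> N j (Suc (Suc q)) F" for a
  proof -
    have F: "F \<subseteq> W" using F' xs by blast
    let ?a = "frag_eval (E (Suc q)) a"
    have ac: "?a \<in> carrier (E (Suc q))" using eval_closed[OF a] .
    have "d (Suc q) ?a \<in> tors (E (Suc (Suc q))) F" using da unfolding N_def by (simp add: eval_D[OF a])
    then obtain n where n: "act (E (Suc (Suc q))) (xpow n F) (d (Suc q) ?a) = \<zero>\<^bsub>E (Suc (Suc q))\<^esub>"
      unfolding tors_def by blast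
    have g: "act (E (Suc q)) (xpow n F) ?a \<in> mgrade (E (Suc q)) (j + int (n * card F))"
      using act_monomial_grade[OF E_module eval_grade[OF a], of "expo n F"] wdeg_expo[OF F] by (simp add: add.commute)
    \<comment> \<open>\<open>xpow n F\<close> makes \<open>?a\<close> a cycle, hence equal to some
      \<open>d q w\<close>. Dividing \<open>w\<close> by \<open>xpow n F\<close> gives
      \<open>b\<close> with \<open>xpow (Suc n) F\<close> annihilating \<open>?a\<close> minus
      \<open>d q b\<close>.\<close>
    obtain w where w: "w \<in> mgrade (E q) (j + int (n * card F))" "d q w = act (E (Suc q)) (xpow n F) ?a"
      using d_primitive[OF g] n act_d[OF ac] by metis
    obtain b where b: "b \<in> mgrade (E q) j" "act (E q) (xpow (Suc n) F) b = act (E q) (xpow 1 F) w"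
      using divide[OF injective F w(1)] by blast
    have bc: "b \<in> carrier (E q)" "w \<in> carrier (E q)" using b w E.mgrade_closed by blast+
    have x: "xpow (Suc n) F = xpow 1 F * xpow n F"
    proof -
      have "expo (Suc n) F = expo 1 F + expo n F" by (rule poly_mapping_eqI) (simp add: lookup_expo lookup_add)
      then show ?thesis by (simp add: monomial_mult)
    qed
    have "act (E (Suc q)) (xpow (Suc n) F) (?a \<ominus>\<^bsub>E (Suc q)\<^esub> d q b)
        = act (E (Suc q)) (xpow (Suc n) F) ?a \<ominus>\<^bsub>E (Suc q)\<^esub> d q (act (E q) (xpow (Suc n) F) b)"
      by (simp add: act_minus_right[OF E_module ac d_closed[OF bc(1)]] act_d[OF bc(1)])
    also have "d q (act (E q) (xpow (Suc n) F) b) = act (E (Suc q)) (xpow (Suc n) F) ?a"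
      unfolding b(2) act_d[OF bc(2)] w(2)
      using act_mult[OF E_module ac, of "xpow 1 F" "xpow n F"] by (simp only: x)
    finally have "act (E (Suc q)) (xpow (Suc n) F) (?a \<ominus>\<^bsub>E (Suc q)\<^esub> d q b) = \<zero>\<^bsub>E (Suc q)\<^esub>"
      using act_closed[OF E_module ac] by (simp add: a_minus_def E'.M.r_neg)
    then have t: "?a \<ominus>\<^bsub>E (Suc q)\<^esub> d q b \<in> tors (E (Suc q)) F"
      unfolding tors_def using ac d_closed[OF bc(1)] by blast
    have "a - D q (frag_of b) \<in> N j (Suc q) F"
      unfolding N_def D_frag_of
      using A_diff[OF a frag_of_A[OF d_grade[OF b(1)]]] eval_diff[OF a frag_of_A[OF d_grade[OF b(1)]]]
        eval_frag_of[OF d_grade[OF b(1)]] t by simp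
    then show ?thesis using frag_of_A[OF b(1)] by blast
  qed
qed

sublocale bicomplex: torsion_bicomplex xs "A j" "N j" D for j
  by (rule bicomplex)

section \<open>Local cohomology in a fixed degree\<close>

definition torsion :: "nat \<Rightarrow> 'm set" where
  "torsion q = {x \<in> carrier (E q). \<forall>v\<in>W. x \<in> tors (E q) {v}}"

lemma torsion_subgroup: "additive_subgroup (torsion q) (E q)"
proof (rule additive_subgroup.intro)
  interpret E: abelian_group "E q" by (rule E_group)
  note S = tors_subgroup[OF E_module, of q]
  show "subgroup (torsion q) (add_monoid (E q))"
  proof (rule E.add.subgroupI)
    show "torsion q \<noteq> {}" unfolding torsion_def using zero_tors by auto
    show "\<ominus>\<^bsub>E q\<^esub> a \<in> torsion q" if "a \<in> torsion q" for a
      using that additive_subgroup.a_inv_closed[OF S] unfolding torsion_def by auto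
    show "a \<oplus>\<^bsub>E q\<^esub> b \<in> torsion q" if "a \<in> torsion q" "b \<in> torsion q" for a b
      using that additive_subgroup.a_closed[OF S] unfolding torsion_def by auto
  qed (auto simp: torsion_def)
qed

lemma torsion_submodule_eq: "torsion_submodule R P (E q) = graded_restrict (E q) (torsion q)"
  unfolding torsion_submodule_def torsion_def
  using power_torsion_iff[OF P E_module, of _ q] by (metis (lifting))

lemma coboundaries_subgroup: "additive_subgroup (coboundaries (\<lambda>q. torsion_submodule R P (E q)) d i) (E i)"
proof (cases i)
  case 0
  interpret E: abelian_group "E 0" by (rule E_group)
  have "subgroup {\<zero>\<^bsub>E 0\<^esub>} (add_monoid (E 0))" by (rule E.add.subgroupI) auto
  then show ?thesis
    unfolding 0 by (simp add: torsion_submodule_eq graded_restrict_def additive_subgroup.intro)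
next
  case (Suc k)
  interpret E: abelian_group "E k" by (rule E_group)
  interpret E': abelian_group "E (Suc k)" by (rule E_group)
  interpret T: additive_subgroup "torsion k" "E k" by (rule torsion_subgroup)
  have "subgroup (d k ` torsion k) (add_monoid (E (Suc k)))"
  proof (rule E'.add.subgroupI)
    show "d k ` torsion k \<subseteq> carrier (E (Suc k))" using d_closed unfolding torsion_def by auto
    show "d k ` torsion k \<noteq> {}" using T.zero_closed by blast
    show "\<ominus>\<^bsub>E (Suc k)\<^esub> a \<in> d k ` torsion k" if aT: "a \<in> d k ` torsion k" for a
    proof -
      obtain x where x: "x \<in> torsion k" "a = d k x" using aT by blast
      have xc: "x \<in> carrier (E k)" using x unfolding torsion_def by blast
      have "d k (\<ominus>\<^bsub>E k\<^esub> x) \<oplus>\<^bsub>E (Suc k)\<^esub> a = \<zero>\<^bsub>E (Suc k)\<^esub>"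
        unfolding x(2) using d_add[of "\<ominus>\<^bsub>E k\<^esub> x" k x] xc d_zero by (simp add: E.l_neg)
      then have "\<ominus>\<^bsub>E (Suc k)\<^esub> a = d k (\<ominus>\<^bsub>E k\<^esub> x)"
        using E'.minus_equality d_closed xc x(2) by simp
      then show ?thesis using T.a_inv_closed[OF x(1)] by simp
    qed
    show "a \<oplus>\<^bsub>E (Suc k)\<^esub> b \<in> d k ` torsion k" if ab: "a \<in> d k ` torsion k" "b \<in> d k ` torsion k" for a b
    proof -
      obtain x y where x: "x \<in> torsion k" "a = d k x" "y \<in> torsion k" "b = d k y" using ab by blast
      have xc: "x \<in> carrier (E k)" "y \<in> carrier (E k)" using x unfolding torsion_def by blast+
      show ?thesis unfolding x(2,4) d_add[OF xc, symmetric] using T.a_closed[OF x(1,3)] by blast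
    qed
  qed
  then show ?thesis
    unfolding Suc by (simp add: torsion_submodule_eq graded_restrict_def additive_subgroup.intro)
qed

lemma graded_restrict_simps:
  "carrier (graded_restrict M U) = U" "\<zero>\<^bsub>graded_restrict M U\<^esub> = \<zero>\<^bsub>M\<^esub>"
  "mgrade (graded_restrict M U) j = mgrade M j \<inter> U" "H +>\<^bsub>graded_restrict M U\<^esub> x = H +>\<^bsub>M\<^esub> x"
  by (simp_all add: graded_restrict_def a_r_coset_def')

lemma graded_quotient_simps:
  "\<zero>\<^bsub>graded_quotient M H\<^esub> = H" "mgrade (graded_quotient M H) j = (\<lambda>x. H +>\<^bsub>M\<^esub> x) ` mgrade M j"
  by (simp_all add: graded_quotient_def)

lemma local_cohomology_eq_0:
  "mgrade (local_cohomology R P E d i) j = {\<zero>\<^bsub>local_cohomology R P E d i\<^esub>} \<longleftrightarrow>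
    (\<forall>x \<in> mgrade (E i) j. x \<in> torsion i \<longrightarrow> d i x = \<zero>\<^bsub>E (Suc i)\<^esub> \<longrightarrow>
       x \<in> coboundaries (\<lambda>q. torsion_submodule R P (E q)) d i)"
proof -
  interpret E: graded_module R "E i" by (rule E_module)
  let ?B = "coboundaries (\<lambda>q. torsion_submodule R P (E q)) d i"
  let ?Z = "{x \<in> mgrade (E i) j. x \<in> torsion i \<and> d i x = \<zero>\<^bsub>E (Suc i)\<^esub>}"
  have B: "additive_subgroup ?B (E i)" by (rule coboundaries_subgroup)
  have "mgrade (E i) j \<inter> torsion i \<inter> {x \<in> torsion i. d i x = \<zero>\<^bsub>E (Suc i)\<^esub>} = ?Z" by blast
  then have m: "mgrade (local_cohomology R P E d i) j = (\<lambda>x. ?B +>\<^bsub>E i\<^esub> x) ` ?Z"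
    unfolding local_cohomology_def cohomology_def graded_quotient_simps graded_restrict_simps
    unfolding torsion_submodule_eq graded_restrict_simps a_kernel_def' by simp
  have z: "\<zero>\<^bsub>local_cohomology R P E d i\<^esub> = ?B"
    unfolding local_cohomology_def cohomology_def graded_quotient_simps ..
  \<comment> \<open>Zero makes the set of cocycles nonempty; otherwise its image would be empty
    rather than \<open>{?B}\<close>.\<close>
  have zeroZ: "\<zero>\<^bsub>E i\<^esub> \<in> ?Z" using E.mgrade_zero d_zero additive_subgroup.zero_closed[OF torsion_subgroup] by simp
  have "?B +>\<^bsub>E i\<^esub> x = ?B \<longleftrightarrow> x \<in> ?B" if "x \<in> mgrade (E i) j" for x
  proof
    assume "?B +>\<^bsub>E i\<^esub> x = ?B"
    then show "x \<in> ?B" by (rule abelian_group.a_coset_join1[OF E_group _ E.mgrade_closed[OF that] additive_subgroup.a_subgroup[OF B]])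
  next
    assume "x \<in> ?B"
    then show "?B +>\<^bsub>E i\<^esub> x = ?B" by (rule abelian_group.a_coset_join2[OF E_group E.mgrade_closed[OF that] additive_subgroup.a_subgroup[OF B]])
  qed
  note coset = this
  show ?thesis
    unfolding m z
  proof
    assume a: "(\<lambda>x. ?B +>\<^bsub>E i\<^esub> x) ` ?Z = {?B}"
    show "\<forall>x\<in>mgrade (E i) j. x \<in> torsion i \<longrightarrow> d i x = \<zero>\<^bsub>E (Suc i)\<^esub> \<longrightarrow> x \<in> ?B"
    proof (intro ballI impI)
      fix x assume x: "x \<in> mgrade (E i) j" "x \<in> torsion i" "d i x = \<zero>\<^bsub>E (Suc i)\<^esub>"
      then have "?B +>\<^bsub>E i\<^esub> x \<in> (\<lambda>x. ?B +>\<^bsub>E i\<^esub> x) ` ?Z" by (intro imageI) simp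
      then show "x \<in> ?B" unfolding a using coset[OF x(1)] by simp
    qed
  next
    assume a: "\<forall>x\<in>mgrade (E i) j. x \<in> torsion i \<longrightarrow> d i x = \<zero>\<^bsub>E (Suc i)\<^esub> \<longrightarrow> x \<in> ?B"
    have "?B +>\<^bsub>E i\<^esub> x = ?B" if "x \<in> ?Z" for x using that a coset[of x] by simp
    then have "(\<lambda>x. ?B +>\<^bsub>E i\<^esub> x) ` ?Z = (\<lambda>x. ?B) ` ?Z" by (rule image_cong[OF refl])
    then show "(\<lambda>x. ?B +>\<^bsub>E i\<^esub> x) ` ?Z = {?B}" using zeroZ by (simp add: image_constant)
  qed
qed

text \<open>Column 0 of the bicomplex, restricted to Cech cocycles, is the degree \<open>j\<close>
  part of the torsion complex. The indices agree because \<open>horizontal_vanishing j k\<close>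
  concerns Cech degree \<open>k + 1\<close>.\<close>

lemma local_cohomology_Suc_eq_0:
  "mgrade (local_cohomology R P E d (Suc k)) j = {\<zero>\<^bsub>local_cohomology R P E d (Suc k)\<^esub>} \<longleftrightarrow>
    bicomplex.horizontal_vanishing j k"
proof -
  interpret E: graded_module R "E k" by (rule E_module)
  interpret E': graded_module R "E (Suc k)" by (rule E_module)
  have cob: "coboundaries (\<lambda>q. torsion_submodule R P (E q)) d (Suc k) = d k ` torsion k"
    by (simp add: torsion_submodule_eq graded_restrict_def)
  have N: "(\<forall>v\<in>set xs. z \<in> N j q {v}) \<longleftrightarrow> frag_eval (E q) z \<in> torsion q" if "z \<in> A j q" for z q
    unfolding N_def torsion_def xs(2) using that eval_closed[OF that] by blast
  let ?L = "\<forall>x \<in> mgrade (E (Suc k)) j. x \<in> torsion (Suc k) \<longrightarrow> d (Suc k) x = \<zero>\<^bsub>E (Suc (Suc k))\<^esub> \<longrightarrow> x \<in> d k ` torsion k"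
  let ?R = "\<forall>z \<in> A j (Suc k). (\<forall>v\<in>set xs. z \<in> N j (Suc k) {v}) \<and> D (Suc k) z \<in> N j (Suc (Suc k)) {} \<longrightarrow>
      (\<exists>w \<in> A j k. (\<forall>v\<in>set xs. w \<in> N j k {v}) \<and> z - D k w \<in> N j (Suc k) {})"
  have "?L \<longleftrightarrow> ?R"
  proof
    assume L: ?L
    show ?R
    proof (intro ballI impI, elim conjE)
      fix z assume z: "z \<in> A j (Suc k)" and zN: "\<forall>v\<in>set xs. z \<in> N j (Suc k) {v}" and dz: "D (Suc k) z \<in> N j (Suc (Suc k)) {}"
      let ?x = "frag_eval (E (Suc k)) z"
      have "?x \<in> d k ` torsion k"
        using L eval_grade[OF z] zN[unfolded N[OF z]] dz by (simp add: N_empty eval_D[OF z])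
      then obtain y where y: "y \<in> torsion k" "?x = d k y" by blast
      have yc: "y \<in> carrier (E k)" using y unfolding torsion_def by blast
      \<comment> \<open>A torsion primitive need not be homogeneous, but its component of degree
        \<open>j\<close> is torsion too and is still a primitive.\<close>
      let ?y = "component (E k) j y"
      have yj: "?y \<in> mgrade (E k) j" using E.component_in[OF yc] .
      have "?y \<in> torsion k"
        using y(1) E.component_carrier[OF yc] tors_component[OF E_module] unfolding torsion_def by blast
      then have yN: "\<forall>v\<in>set xs. frag_of ?y \<in> N j k {v}"
        unfolding N[OF frag_of_A[OF yj]] eval_frag_of[OF yj] .
      have "d k ?y = component (E (Suc k)) j ?x"
        unfolding y(2) by (rule component_graded_hom[OF E_module E_module d_hom yc, symmetric])
      then have dy: "d k ?y = ?x" using E'.component_homogeneous[OF eval_grade[OF z]] by simp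
      have "z - D k (frag_of ?y) \<in> N j (Suc k) {}"
        unfolding N_empty D_frag_of
        using A_diff[OF z frag_of_A[OF d_grade[OF yj]]] eval_diff[OF z frag_of_A[OF d_grade[OF yj]]]
          eval_frag_of[OF d_grade[OF yj]] dy eval_closed[OF z] by (simp add: a_minus_def E'.M.r_neg)
      then show "\<exists>w \<in> A j k. (\<forall>v\<in>set xs. w \<in> N j k {v}) \<and> z - D k w \<in> N j (Suc k) {}"
        using yN frag_of_A[OF yj] by blast
    qed
  next
    assume R: ?R
    show ?L
    proof (intro ballI impI)
      fix x assume x: "x \<in> mgrade (E (Suc k)) j" "x \<in> torsion (Suc k)" "d (Suc k) x = \<zero>\<^bsub>E (Suc (Suc k))\<^esub>"
      have xA: "frag_of x \<in> A j (Suc k)" using frag_of_A[OF x(1)] .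
      have "\<forall>v\<in>set xs. frag_of x \<in> N j (Suc k) {v}" unfolding N[OF xA] eval_frag_of[OF x(1)] by (rule x(2))
      moreover have "D (Suc k) (frag_of x) \<in> N j (Suc (Suc k)) {}"
        unfolding N_empty using D_A[OF xA] eval_D[OF xA] eval_frag_of[OF x(1)] x(3) by simp
      ultimately obtain w where w: "w \<in> A j k" "\<forall>v\<in>set xs. w \<in> N j k {v}" "frag_of x - D k w \<in> N j (Suc k) {}"
        using R xA by blast
      have wT: "frag_eval (E k) w \<in> torsion k" using w(2) unfolding N[OF w(1)] .
      have "x \<ominus>\<^bsub>E (Suc k)\<^esub> d k (frag_eval (E k) w) = \<zero>\<^bsub>E (Suc k)\<^esub>"
        using w(3) eval_diff[OF xA D_A[OF w(1)]] eval_D[OF w(1)] eval_frag_of[OF x(1)] unfolding N_empty by simp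
      moreover have "x = (x \<ominus>\<^bsub>E (Suc k)\<^esub> d k (frag_eval (E k) w)) \<oplus>\<^bsub>E (Suc k)\<^esub> d k (frag_eval (E k) w)"
        using E'.mgrade_closed[OF x(1)] d_closed[OF eval_closed[OF w(1)]] by (simp add: a_minus_def E'.M.a_assoc E'.M.l_neg)
      ultimately have "x = d k (frag_eval (E k) w)" using d_closed[OF eval_closed[OF w(1)]] by simp
      then show "x \<in> d k ` torsion k" using wT by blast
    qed
  qed
  then show ?thesis
    unfolding local_cohomology_eq_0 cob bicomplex.vertical_iff_horizontal[symmetric] bicomplex.vertical_vanishing_iff .
qed

text \<open>A cocycle in \<open>E 0\<close> comes from \<open>R\<close>, which has no nonzero
  elements of negative degree.\<close>

lemma local_cohomology_0_negative:
  assumes "j < 0"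
  shows "mgrade (local_cohomology R P E d 0) j = {\<zero>\<^bsub>local_cohomology R P E d 0\<^esub>}"
  unfolding local_cohomology_eq_0
proof (intro ballI impI)
  fix x assume x: "x \<in> mgrade (E 0) j" "x \<in> torsion 0" "d 0 x = \<zero>\<^bsub>E (Suc 0)\<^esub>"
  obtain p where p: "\<And>m. m \<in> Poly_Mapping.keys p \<Longrightarrow> int (wdeg m) = j" "e (cls p) = x"
    using e_primitive[OF x(1,3)] by blast
  have "Poly_Mapping.keys p = {}" using p(1) assms by fastforce
  then have "x = \<zero>\<^bsub>E 0\<^esub>" using p(2) e_zero by simp
  then show "x \<in> coboundaries (\<lambda>q. torsion_submodule R P (E q)) d 0"
    by (simp add: torsion_submodule_eq graded_restrict_def)
qed

section \<open>Fractions and their numerators\<close>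

lemma I_mult: "p \<in> I \<Longrightarrow> q * p \<in> I"
  using ideal.I_l_closed[OF ideal_I, of p q] by simp

text \<open>A relation among numerators can therefore be cut into relations by sorting its
  monomials.\<close>

lemma I_restrict_keys: "p \<in> I \<Longrightarrow> restrict_keys T p \<in> I"
  unfolding mem_I by (simp add: keys_restrict_keys)

text \<open>\<open>represents n F z p\<close>: the element \<open>z\<close>, modulo \<open>x\<^sub>F\<close>-torsion, is the fraction \<open>p / x\<^sub>F\<^sup>n\<close>.\<close>

definition represents :: "nat \<Rightarrow> 'v set \<Rightarrow> ('m \<Rightarrow>\<^sub>0 int) \<Rightarrow> ('v, 'k) mpoly \<Rightarrow> bool" where
  "represents n F z p \<longleftrightarrow> Poly_Mapping.keys z \<subseteq> carrier (E 0) \<and>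
     act (E 0) (xpow n F) (frag_eval (E 0) z) = e (cls p)"

lemma represents_0: "represents n F 0 0"
  unfolding represents_def
  using abelian_group.frag_eval_0[OF E_group] act_zero[OF E_module] e_zero by simp

lemma represents_diff:
  assumes "represents n F z p" "represents n F w q"
  shows "represents n F (z - w) (p - q)"
proof -
  interpret E: abelian_group "E 0" by (rule E_group)
  have k: "Poly_Mapping.keys z \<subseteq> carrier (E 0)" "Poly_Mapping.keys w \<subseteq> carrier (E 0)"
    using assms unfolding represents_def by auto
  have "Poly_Mapping.keys (z - w) \<subseteq> carrier (E 0)" using keys_diff[of z w] k by blast
  moreover have "act (E 0) (xpow n F) (frag_eval (E 0) (z - w)) = e (cls (p - q))"
    unfolding E.frag_eval_diff[OF k] e_diff
    using act_minus_right[OF E_module E.frag_eval_carrier[OF k(1)] E.frag_eval_carrier[OF k(2)]] assms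
    unfolding represents_def by simp
  ultimately show ?thesis unfolding represents_def by blast
qed

lemma represents_sum:
  assumes "finite V" "\<And>v. v \<in> V \<Longrightarrow> represents n F (z v) (p v)"
  shows "represents n F (\<Sum>v\<in>V. z v) (\<Sum>v\<in>V. p v)"
  using assms
proof (induction V)
  case (insert v V)
  then have a: "represents n F (z v) (p v)" "represents n F (\<Sum>v\<in>V. z v) (\<Sum>v\<in>V. p v)" by auto
  have "represents n F (z v - (0 - (\<Sum>v\<in>V. z v))) (p v - (0 - (\<Sum>v\<in>V. p v)))"
    by (rule represents_diff[OF a(1) represents_diff[OF represents_0 a(2)]])
  then show ?case using insert.hyps by simp
qed (simp add: represents_0)

lemma represents_tors: "represents n F z p \<Longrightarrow> p \<in> I \<Longrightarrow> frag_eval (E 0) z \<in> tors (E 0) F"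
  unfolding represents_def tors_def
  using abelian_group.frag_eval_carrier[OF E_group, of z 0] e_eq_zero[of p] by auto

lemma represents_N: "z \<in> A j 0 \<Longrightarrow> represents n F z p \<Longrightarrow> p \<in> I \<Longrightarrow> z \<in> N j 0 F"
  unfolding N_def using represents_tors by blast

lemma xpow_mult: "xpow a F * xpow b F = xpow (a + b) F"
proof -
  have "expo a F + expo b F = expo (a + b) F" by (rule poly_mapping_eqI) (simp add: lookup_add lookup_expo)
  then show ?thesis by (simp add: monomial_mult)
qed

lemma xpow_diff_mult: "F \<subseteq> G \<Longrightarrow> xpow n (G - F) * xpow n F = xpow n G"
proof -
  assume "F \<subseteq> G"
  then have "expo n (G - F) + expo n F = expo n G" by (intro poly_mapping_eqI) (auto simp: lookup_add lookup_expo)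
  then show ?thesis by (simp add: monomial_mult)
qed

lemma represents_extend:
  assumes "represents n F z p" "F \<subseteq> G"
  shows "represents n G z (xpow n (G - F) * p)"
proof -
  have "act (E 0) (xpow n G) (frag_eval (E 0) z) = act (E 0) (xpow n (G - F)) (act (E 0) (xpow n F) (frag_eval (E 0) z))"
    using act_mult[OF E_module abelian_group.frag_eval_carrier[OF E_group], of z 0 "xpow n (G - F)" "xpow n F"]
      assms xpow_diff_mult[OF assms(2)] unfolding represents_def by simp
  then show ?thesis using assms unfolding represents_def by (simp add: act_e)
qed

text \<open>Over the common denominator \<open>xpow n F\<close> the fraction at \<open>G\<close> has
  numerator \<open>xpow n (F - G) * r G\<close>; \<open>represents n F\<close> is compatible with
  subtraction.\<close>

lemma represents_cech:
  assumes "F \<subseteq> W" "\<And>v. v \<in> F \<Longrightarrow> represents n (F - {v}) (c (F - {v})) (r (F - {v}))"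
  shows "represents n F (cech xs c F) (cech xs (\<lambda>G. xpow n (F - G) * r G) F)"
  by (rule cech_rel[where r = "represents n F", OF represents_0 represents_diff])
    (use assms xs represents_extend in auto)

section \<open>Multiplication by a variable on formal combinations\<close>

definition var_mult :: "'v \<Rightarrow> ('m \<Rightarrow>\<^sub>0 int) \<Rightarrow> 'm \<Rightarrow>\<^sub>0 int" where
  "var_mult v = frag_extend (frag_of \<circ> act (E 0) (mvar v))"

lemma var_mult_diff: "var_mult v (z - w) = var_mult v z - var_mult v w"
  unfolding var_mult_def by (rule frag_extend_diff)

lemma mvar_grade: "v \<in> W \<Longrightarrow> x \<in> mgrade (E 0) (j - 1) \<Longrightarrow> act (E 0) (mvar v) x \<in> mgrade (E 0) j"
  using act_monomial_grade[OF E_module, of x 0 "j - 1" "Poly_Mapping.single v 1"]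
  by (simp add: mvar_def wdeg_def lookup_single when_def)

lemma var_mult_A: "v \<in> W \<Longrightarrow> z \<in> A (j - 1) 0 \<Longrightarrow> var_mult v z \<in> A j 0"
  unfolding A_def var_mult_def using keys_frag_map[of "act (E 0) (mvar v)" z] mvar_grade by blast

lemma eval_var_mult:
  assumes "Poly_Mapping.keys z \<subseteq> carrier (E 0)"
  shows "frag_eval (E 0) (var_mult v z) = act (E 0) (mvar v) (frag_eval (E 0) z)"
  unfolding var_mult_def
  by (rule frag_eval_map[OF E_group E_group _ _ assms])
    (auto simp: act_closed[OF E_module] act_add_right[OF E_module])

lemma keys_var_mult:
  "Poly_Mapping.keys z \<subseteq> carrier (E 0) \<Longrightarrow> Poly_Mapping.keys (var_mult v z) \<subseteq> carrier (E 0)"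
  using keys_frag_map[of "act (E 0) (mvar v)" z] act_closed[OF E_module] unfolding var_mult_def by blast

lemma act_comm: "x \<in> carrier (E q) \<Longrightarrow> act (E q) p (act (E q) p' x) = act (E q) p' (act (E q) p x)"
  using act_mult[OF E_module, of x q p p'] act_mult[OF E_module, of x q p' p] by (simp add: mult.commute)

lemma represents_var_mult:
  assumes "represents n F z p"
  shows "represents n F (var_mult v z) (mvar v * p)"
proof -
  have k: "Poly_Mapping.keys z \<subseteq> carrier (E 0)" using assms unfolding represents_def by blast
  have zc: "frag_eval (E 0) z \<in> carrier (E 0)" by (rule abelian_group.frag_eval_carrier[OF E_group k])
  show ?thesis
    unfolding represents_def eval_var_mult[OF k] act_comm[OF zc, of "xpow n F"]
    using assms keys_var_mult[OF k] unfolding represents_def by (simp add: act_e)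
qed

lemma act_tors:
  assumes "x \<in> tors (E q) F"
  shows "act (E q) p x \<in> tors (E q) F"
proof -
  obtain n where n: "x \<in> carrier (E q)" "act (E q) (xpow n F) x = \<zero>\<^bsub>E q\<^esub>" using assms unfolding tors_def by blast
  have "act (E q) (xpow n F) (act (E q) p x) = \<zero>\<^bsub>E q\<^esub>"
    using act_comm[OF n(1), of "xpow n F" p] n(2) act_zero[OF E_module] by simp
  then show ?thesis unfolding tors_def using act_closed[OF E_module n(1)] by blast
qed

lemma var_mult_N: "v \<in> W \<Longrightarrow> z \<in> N (j - 1) 0 F \<Longrightarrow> var_mult v z \<in> N j 0 F"
  unfolding N_def using var_mult_A eval_var_mult[OF A_keys] act_tors by auto

lemma D_var_mult_N:
  assumes v: "v \<in> W" and z: "z \<in> A (j - 1) 0" and Dz: "D 0 z \<in> N (j - 1) (Suc 0) F"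
  shows "D 0 (var_mult v z) \<in> N j (Suc 0) F"
proof -
  have m: "var_mult v z \<in> A j 0" by (rule var_mult_A[OF v z])
  have "frag_eval (E (Suc 0)) (D 0 (var_mult v z)) = act (E (Suc 0)) (mvar v) (frag_eval (E (Suc 0)) (D 0 z))"
    unfolding eval_D[OF m] eval_D[OF z] eval_var_mult[OF A_keys[OF z]] act_d[OF eval_closed[OF z]] ..
  then show ?thesis using Dz D_A[OF m] act_tors unfolding N_def by auto
qed

lemma A_sum: "finite V \<Longrightarrow> (\<And>v. v \<in> V \<Longrightarrow> z v \<in> A j q) \<Longrightarrow> (\<Sum>v\<in>V. z v) \<in> A j q"
  by (induction V rule: finite_induct) (simp_all add: bicomplex.A_0 bicomplex.A_add)

lemma N_sum: "finite V \<Longrightarrow> F \<subseteq> set xs \<Longrightarrow> (\<And>v. v \<in> V \<Longrightarrow> z v \<in> N j q F) \<Longrightarrow> (\<Sum>v\<in>V. z v) \<in> N j q F"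
  by (induction V rule: finite_induct) (simp_all add: bicomplex.N_0 bicomplex.N_add)

lemma D_sum: "D q (\<Sum>v\<in>V. z v) = (\<Sum>v\<in>V. D q (z v))"
  unfolding D_def by (induction V rule: infinite_finite_induct) (simp_all add: frag_extend_add)

lemma cech_sum: "cech xs (\<lambda>F. \<Sum>v\<in>V. c v F) F = (\<Sum>v\<in>V. cech xs (c v) F)"
  by (induction V rule: infinite_finite_induct) (simp_all add: cech_0 cech_add)

text \<open>Among the monomials of the numerator over \<open>x\<^sub>F\<^sup>n\<close>, those whose selected variable with negative exponent
  in the fraction is \<open>v\<close>.\<close>

definition negative_part :: "nat \<Rightarrow> 'v \<Rightarrow> 'v set \<Rightarrow> ('v \<Rightarrow>\<^sub>0 nat) set" where
  "negative_part n v F = {m. (\<exists>u\<in>F. Poly_Mapping.lookup m u < n) \<and> v = (SOME u. u \<in> F \<and> Poly_Mapping.lookup m u < n)}"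

lemma negative_part_in: "m \<in> negative_part n v F \<Longrightarrow> v \<in> F"
  unfolding negative_part_def using someI_ex[of "\<lambda>u. u \<in> F \<and> Poly_Mapping.lookup m u < n"] by blast

text \<open>Passing from denominator \<open>xpow n G\<close> to \<open>xpow n F\<close> raises the
  exponents at \<open>F - G\<close> to at least \<open>n\<close> and leaves those at
  \<open>G\<close> alone. The set of variables with negative exponent is unchanged, and so is the
  variable \<open>SOME\<close> selects from it.\<close>

lemma negative_part_shift:
  assumes "G \<subseteq> F"
  shows "{m. expo n (F - G) + m \<in> negative_part n v F} = negative_part n v G"
proof -
  have "u \<in> F \<and> Poly_Mapping.lookup (expo n (F - G) + m) u < n \<longleftrightarrow> u \<in> G \<and> Poly_Mapping.lookup m u < n" for u m
    using assms by (auto simp: lookup_add lookup_expo)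
  then show ?thesis unfolding negative_part_def Bex_def by simp
qed

text \<open>By the degree bound not all exponents at \<open>F\<close> can reach \<open>n\<close>, so
  each monomial of \<open>p\<close> lies in exactly one part.\<close>

lemma sum_negative_parts:
  assumes "F \<subseteq> W" "\<And>m. m \<in> Poly_Mapping.keys p \<Longrightarrow> wdeg m < n * card F"
  shows "(\<Sum>v\<in>W. restrict_keys (negative_part n v F) p) = p"
proof (rule poly_mapping_eqI)
  fix m
  have lk: "Poly_Mapping.lookup (\<Sum>v\<in>W. restrict_keys (negative_part n v F) p) m =
      (\<Sum>v\<in>W. if m \<in> negative_part n v F then Poly_Mapping.lookup p m else 0)"
    by (simp add: lookup_sum lookup_restrict_keys)
  show "Poly_Mapping.lookup (\<Sum>v\<in>W. restrict_keys (negative_part n v F) p) m = Poly_Mapping.lookup p m"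
  proof (cases "m \<in> Poly_Mapping.keys p")
    case False
    then have "Poly_Mapping.lookup p m = 0" by (simp add: in_keys_iff)
    then show ?thesis unfolding lk by (auto intro: sum.neutral)
  next
    case True
    have ex: "\<exists>u\<in>F. Poly_Mapping.lookup m u < n"
    proof (rule ccontr)
      assume "\<not> ?thesis"
      then have "n * card F \<le> (\<Sum>v\<in>F. Poly_Mapping.lookup m v)"
        using sum_bounded_below[of F n "Poly_Mapping.lookup m"] by (simp add: not_less mult.commute)
      also have "\<dots> \<le> wdeg m" unfolding wdeg_def by (rule sum_mono2) (use assms(1) in auto)
      finally show False using assms(2)[OF True] by simp
    qed
    define s where "s = (SOME u. u \<in> F \<and> Poly_Mapping.lookup m u < n)"
    have m: "m \<in> negative_part n v F \<longleftrightarrow> v = s" for v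
      unfolding negative_part_def s_def using ex by simp
    have "s \<in> W" using negative_part_in[of m n s F] m[of s] assms(1) by blast
    then show ?thesis unfolding lk m by simp
  qed
qed

text \<open>A suitable \<open>xpow n F\<close> annihilates \<open>D 0 (c F)\<close>, so multiplying
  \<open>c F\<close> by it gives an element coming from \<open>R\<close>. As there are finitely many
  \<open>F\<close>, one \<open>n\<close> serves all of them and also the cocycle condition, which
  injectivity of \<open>e\<close> turns into membership in \<open>I\<close>.\<close>

lemma numerators:
  assumes c: "bicomplex.cocycle j (Suc k) 0 c"
  shows "\<exists>n r. (\<forall>F \<subseteq> W. card F = Suc k \<longrightarrow>
        represents n F (c F) (r F) \<and> (\<forall>m \<in> Poly_Mapping.keys (r F). int (wdeg m) = j + int (n * card F))) \<and>
      (\<forall>F \<subseteq> W. card F = Suc (Suc k) \<longrightarrow> cech xs (\<lambda>G. xpow n (F - G) * r G) F \<in> I)"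
proof -
  have c': "c \<in> bicomplex.cochains j (Suc k) 0" "cech xs c \<in> bicomplex.null j (Suc (Suc k)) 0"
    "(\<lambda>F. D 0 (c F)) \<in> bicomplex.null j (Suc k) (Suc 0)"
    using c unfolding bicomplex.cocycle_def by blast+
  have cA: "c F \<in> A j 0" and Dc: "D 0 (c F) \<in> N j (Suc 0) F" if "F \<subseteq> W" "card F = Suc k" for F
    using bicomplex.cochainsD[OF c'(1)] bicomplex.nullD[OF c'(3)] that xs by simp_all
  have cc: "cech xs c F \<in> N j 0 F" if "F \<subseteq> W" "card F = Suc (Suc k)" for F
    using bicomplex.nullD[OF c'(2)] that xs by simp
  let ?S1 = "{F. F \<subseteq> W \<and> card F = Suc k}" and ?S2 = "{F. F \<subseteq> W \<and> card F = Suc (Suc k)}"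
  have "\<exists>n. \<forall>F\<in>?S1. act (E (Suc 0)) (xpow n F) (frag_eval (E (Suc 0)) (D 0 (c F))) = \<zero>\<^bsub>E (Suc 0)\<^esub> \<and>
      frag_eval (E (Suc 0)) (D 0 (c F)) \<in> carrier (E (Suc 0))"
  proof (rule uniform_bound)
    show "\<exists>n. act (E (Suc 0)) (xpow n F) (frag_eval (E (Suc 0)) (D 0 (c F))) = \<zero>\<^bsub>E (Suc 0)\<^esub> \<and>
      frag_eval (E (Suc 0)) (D 0 (c F)) \<in> carrier (E (Suc 0))" if "F \<in> ?S1" for F
      using Dc[of F] that unfolding N_def tors_def by blast
  qed (auto intro: act_X_mono[OF E_module _ _ subset_refl])
  then obtain n1 where n1: "\<And>F. F \<in> ?S1 \<Longrightarrow> act (E (Suc 0)) (xpow n1 F) (frag_eval (E (Suc 0)) (D 0 (c F))) = \<zero>\<^bsub>E (Suc 0)\<^esub>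
      \<and> frag_eval (E (Suc 0)) (D 0 (c F)) \<in> carrier (E (Suc 0))" by blast
  have "\<exists>n. \<forall>F\<in>?S2. act (E 0) (xpow n F) (frag_eval (E 0) (cech xs c F)) = \<zero>\<^bsub>E 0\<^esub> \<and>
      frag_eval (E 0) (cech xs c F) \<in> carrier (E 0)"
  proof (rule uniform_bound)
    show "\<exists>n. act (E 0) (xpow n F) (frag_eval (E 0) (cech xs c F)) = \<zero>\<^bsub>E 0\<^esub> \<and>
      frag_eval (E 0) (cech xs c F) \<in> carrier (E 0)" if "F \<in> ?S2" for F
      using cc[of F] that unfolding N_def tors_def by blast
  qed (auto intro: act_X_mono[OF E_module _ _ subset_refl])
  then obtain n2 where n2: "\<And>F. F \<in> ?S2 \<Longrightarrow> act (E 0) (xpow n2 F) (frag_eval (E 0) (cech xs c F)) = \<zero>\<^bsub>E 0\<^esub>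
      \<and> frag_eval (E 0) (cech xs c F) \<in> carrier (E 0)" by blast
  define n where "n = max n1 n2"
  have "\<exists>r. represents n F (c F) r \<and> (\<forall>m \<in> Poly_Mapping.keys r. int (wdeg m) = j + int (n * card F))"
    if F: "F \<subseteq> W" "card F = Suc k" for F
  proof -
    let ?x = "frag_eval (E 0) (c F)"
    have "act (E (Suc 0)) (xpow n F) (frag_eval (E (Suc 0)) (D 0 (c F))) = \<zero>\<^bsub>E (Suc 0)\<^esub>"
      using n1[of F] F act_X_mono[OF E_module _ _ subset_refl, of _ "Suc 0" n1 F n] by (simp add: n_def)
    then have "d 0 (act (E 0) (xpow n F) ?x) = \<zero>\<^bsub>E (Suc 0)\<^esub>"
      using eval_D[OF cA[OF F]] act_d[OF eval_closed[OF cA[OF F]]] by simp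
    moreover have "act (E 0) (xpow n F) ?x \<in> mgrade (E 0) (j + int (n * card F))"
      using act_monomial_grade[OF E_module eval_grade[OF cA[OF F]], of "expo n F"] wdeg_expo[OF F(1), of n]
      by (simp add: add.commute)
    ultimately obtain r where "\<And>m. m \<in> Poly_Mapping.keys r \<Longrightarrow> int (wdeg m) = j + int (n * card F)"
      "e (cls r) = act (E 0) (xpow n F) ?x"
      using e_primitive by metis
    then show ?thesis unfolding represents_def using A_keys[OF cA[OF F]] by (intro exI[of _ r]) simp
  qed
  then have "\<forall>F. \<exists>r. F \<subseteq> W \<and> card F = Suc k \<longrightarrow>
      represents n F (c F) r \<and> (\<forall>m \<in> Poly_Mapping.keys r. int (wdeg m) = j + int (n * card F))" by blast
  from choice[OF this] obtain r where r: "\<And>F. F \<subseteq> W \<Longrightarrow> card F = Suc k \<Longrightarrow>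
      represents n F (c F) (r F) \<and> (\<forall>m \<in> Poly_Mapping.keys (r F). int (wdeg m) = j + int (n * card F))" by blast
  have "cech xs (\<lambda>G. xpow n (F - G) * r G) F \<in> I" if F: "F \<subseteq> W" "card F = Suc (Suc k)" for F
  proof -
    have "represents n F (cech xs c F) (cech xs (\<lambda>G. xpow n (F - G) * r G) F)"
    proof (rule represents_cech[OF F(1)])
      fix v assume "v \<in> F"
      then have "F - {v} \<subseteq> W" "card (F - {v}) = Suc k" using F by auto
      then show "represents n (F - {v}) (c (F - {v})) (r (F - {v}))" using r by blast
    qed
    moreover have "act (E 0) (xpow n F) (frag_eval (E 0) (cech xs c F)) = \<zero>\<^bsub>E 0\<^esub>"
      using n2[of F] F act_X_mono[OF E_module _ _ subset_refl, of _ 0 n2 F n] by (simp add: n_def)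
    ultimately show ?thesis unfolding represents_def e_eq_zero[symmetric] by simp
  qed
  then show ?thesis using r by blast
qed

lemma horizontal_vanishing_step:
  assumes j: "j < 0" and H: "bicomplex.horizontal_vanishing (j - 1) k"
  shows "bicomplex.horizontal_vanishing j k"
  unfolding bicomplex.horizontal_vanishing_def
proof (intro allI impI)
  fix c assume c: "bicomplex.cocycle j (Suc k) 0 c"
  have cA: "c F \<in> A j 0" if "F \<subseteq> W" "card F = Suc k" for F
  proof -
    have "c \<in> bicomplex.cochains j (Suc k) 0" using c unfolding bicomplex.cocycle_def by blast
    from bicomplex.cochainsD[OF this] show ?thesis using that xs by simp
  qed
  from numerators[OF c] obtain n r where
    nr: "\<forall>F \<subseteq> W. card F = Suc k \<longrightarrow>
        represents n F (c F) (r F) \<and> (\<forall>m \<in> Poly_Mapping.keys (r F). int (wdeg m) = j + int (n * card F))"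
      "\<forall>F \<subseteq> W. card F = Suc (Suc k) \<longrightarrow> cech xs (\<lambda>G. xpow n (F - G) * r G) F \<in> I"
    by (elim exE conjE)
  have r: "represents n F (c F) (r F)"
    and r_deg: "m \<in> Poly_Mapping.keys (r F) \<Longrightarrow> int (wdeg m) = j + int (n * card F)"
    if "F \<subseteq> W" "card F = Suc k" for F m
    using nr(1) that by blast+
  have r_cech: "cech xs (\<lambda>G. xpow n (F - G) * r G) F \<in> I" if "F \<subseteq> W" "card F = Suc (Suc k)" for F
    using nr(2) that by blast
  define s where "s v F = restrict_keys (negative_part n v F) (r F)" for v F
  define t where "t v F = xpow 1 F * (xpow 1 (F - {v}) * s v F)" for v F
  have s0: "s v F = 0" if "v \<notin> F" for v F
  proof -
    have "negative_part n v F = {}" using negative_part_in that by blast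
    then show ?thesis unfolding s_def by (simp add: restrict_keys_def)
  qed
  have mvar_t: "mvar v * t v F = xpow 2 F * s v F" for v F
  proof (cases "v \<in> F")
    case True
    have "mvar v = xpow 1 {v}" by (simp add: mvar_def expo_def)
    then have "mvar v * xpow 1 (F - {v}) = xpow 1 F" using xpow_diff_mult[of "{v}" F 1] True by (simp add: mult.commute)
    note mv = this
    have "mvar v * t v F = xpow 1 F * ((mvar v * xpow 1 (F - {v})) * s v F)" unfolding t_def by (simp only: mult_ac)
    also have "\<dots> = (xpow 1 F * xpow 1 F) * s v F" unfolding mv by (simp only: mult_ac)
    finally show ?thesis unfolding xpow_mult by (simp add: numeral_2_eq_2)
  qed (simp add: t_def s0)
  \<comment> \<open>Degrees: \<open>card F - 1\<close> from \<open>xpow 1 (F - {v})\<close> and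
    \<open>j + n * card F\<close> from \<open>s v F\<close> add up to
    \<open>j - 1 + (n + 1) * card F\<close>, so dividing by \<open>xpow (n + 1) F\<close> lands in
    degree \<open>j - 1\<close>.\<close>
  have "\<exists>x. x \<in> mgrade (E 0) (j - 1) \<and> act (E 0) (xpow (n + 2) F) x = e (cls (t v F))"
    if v: "v \<in> W" and F: "F \<subseteq> W" "card F = Suc k" for v F
  proof -
    have "e (cls (xpow 1 (F - {v}) * s v F)) \<in> mgrade (E 0) (j - 1 + int ((n + 1) * card F))"
    proof (rule e_grade)
      fix m assume "m \<in> Poly_Mapping.keys (xpow 1 (F - {v}) * s v F)"
      then obtain m' where m: "m = expo 1 (F - {v}) + m'" "m' \<in> Poly_Mapping.keys (s v F)"
        unfolding keys_monomial_mult by blast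
      then have m': "m' \<in> Poly_Mapping.keys (r F)" "v \<in> F"
        using negative_part_in[of m' n v F] unfolding s_def by (auto simp: keys_restrict_keys)
      have "wdeg (expo 1 (F - {v})) = card (F - {v})" using wdeg_expo[of "F - {v}" 1] F(1) by auto
      then have "int (wdeg m) = int (card (F - {v})) + (j + int (n * card F))"
        unfolding m(1) wdeg_add using r_deg[OF F m'(1)] by simp
      also have "int (card (F - {v})) = int (card F) - 1" using m'(2) F(2) by simp
      finally show "int (wdeg m) = j - 1 + int ((n + 1) * card F)" by (simp add: algebra_simps)
    qed
    then obtain x where "x \<in> mgrade (E 0) (j - 1)"
      "act (E 0) (xpow (Suc (n + 1)) F) x = act (E 0) (xpow 1 F) (e (cls (xpow 1 (F - {v}) * s v F)))"
      using divide[OF injective F(1)] by blast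
    then show ?thesis unfolding act_e t_def by auto
  qed
  then have "\<forall>v. \<forall>F. \<exists>x. v \<in> W \<and> F \<subseteq> W \<and> card F = Suc k \<longrightarrow>
      x \<in> mgrade (E 0) (j - 1) \<and> act (E 0) (xpow (n + 2) F) x = e (cls (t v F))" by blast
  then obtain x where x: "\<And>v F. v \<in> W \<Longrightarrow> F \<subseteq> W \<Longrightarrow> card F = Suc k \<Longrightarrow>
      x v F \<in> mgrade (E 0) (j - 1) \<and> act (E 0) (xpow (n + 2) F) (x v F) = e (cls (t v F))"
    by metis
  let ?c = "\<lambda>v F. frag_of (x v F)"
  have cA': "?c v F \<in> A (j - 1) 0" if "v \<in> W" "F \<subseteq> W" "card F = Suc k" for v F
    using frag_of_A x that by blast
  have rep: "represents (n + 2) F (?c v F) (t v F)" if "v \<in> W" "F \<subseteq> W" "card F = Suc k" for v F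
    using x[OF that] A_keys[OF cA'[OF that]] eval_frag_of[of "x v F" 0 "j - 1"] unfolding represents_def by simp
  have cocycle: "bicomplex.cocycle (j - 1) (Suc k) 0 (?c v)" if v: "v \<in> W" for v
    unfolding bicomplex.cocycle_def
  proof (intro conjI)
    show "?c v \<in> bicomplex.cochains (j - 1) (Suc k) 0"
      by (rule bicomplex.cochainsI) (use cA' v xs in blast)
    show "(\<lambda>F. D 0 (?c v F)) \<in> bicomplex.null (j - 1) (Suc k) (Suc 0)"
    proof (rule bicomplex.nullI)
      fix F assume F: "F \<subseteq> set xs" "card F = Suc k"
      then have F': "F \<subseteq> W" using xs by simp
      have xg: "x v F \<in> mgrade (E 0) (j - 1)" using x[OF v F' F(2)] by blast
      have xc: "x v F \<in> carrier (E 0)" using graded_module.mgrade_closed[OF E_module xg] .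
      have "act (E (Suc 0)) (xpow (n + 2) F) (d 0 (x v F)) = \<zero>\<^bsub>E (Suc 0)\<^esub>"
        using act_d[OF xc, of "xpow (n + 2) F"] x[OF v F' F(2)] d_e by simp
      then have "d 0 (x v F) \<in> tors (E (Suc 0)) F" unfolding tors_def using d_closed[OF xc] by blast
      then show "D 0 (?c v F) \<in> N (j - 1) (Suc 0) F"
        unfolding N_def D_frag_of using frag_of_A[OF d_grade[OF xg]] eval_frag_of[OF d_grade[OF xg]] by simp
    qed
    show "cech xs (?c v) \<in> bicomplex.null (j - 1) (Suc (Suc k)) 0"
    proof (rule bicomplex.nullI)
      fix F assume F0: "F \<subseteq> set xs" and F2: "card F = Suc (Suc k)"
      have F1: "F \<subseteq> W" using F0 xs by simp
      have sub: "F - {u} \<subseteq> W" "card (F - {u}) = Suc k" if "u \<in> F" for u using F1 F2 that by auto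
      have "represents (n + 2) F (cech xs (?c v) F) (cech xs (\<lambda>G. xpow (n + 2) (F - G) * t v G) F)"
        by (rule represents_cech[OF F1]) (use rep v sub in blast)
      moreover have "cech xs (\<lambda>G. xpow (n + 2) (F - G) * t v G) F \<in> I"
      proof (cases "v \<in> F")
        case False
        have "cech xs (\<lambda>G. xpow (n + 2) (F - G) * t v G) F = cech xs (\<lambda>G. 0) F"
          by (rule cech_cong[OF F0]) (use False in \<open>simp add: t_def s0\<close>)
        then show ?thesis by (simp add: cech_0 mem_I)
      next
        case True
        \<comment> \<open>This additive map is the same for all \<open>G\<close>, so the Cech sum of
          the new numerators is \<open>?h\<close> of the old one, which lies in
          \<open>I\<close>.\<close>
        let ?h = "\<lambda>p. (xpow 1 F * xpow 1 (F - {v})) * restrict_keys (negative_part n v F) p"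
        \<comment> \<open>Both sides vanish if \<open>v \<notin> G\<close>, as
          \<open>s v G = 0\<close>. If \<open>v \<in> G\<close>, the two added factors
          \<open>xpow 1 (F - G)\<close> complete \<open>xpow 1 G\<close> to \<open>xpow 1 F\<close>
          and \<open>xpow 1 (G - {v})\<close> to \<open>xpow 1 (F - {v})\<close>.\<close>
        have eq: "xpow (n + 2) (F - G) * t v G = ?h (xpow n (F - G) * r G)" if G: "G \<subseteq> F" for G
        proof (cases "v \<in> G")
          case False
          have "restrict_keys (negative_part n v F) (xpow n (F - G) * r G) = xpow n (F - G) * s v G"
            unfolding restrict_keys_monomial_mult negative_part_shift[OF G] s_def ..
          then show ?thesis using False by (simp add: t_def s0)
        next
          case v: True
          have a: "restrict_keys (negative_part n v F) (xpow n (F - G) * r G) = xpow n (F - G) * s v G"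
            unfolding restrict_keys_monomial_mult negative_part_shift[OF G] s_def ..
          have b: "xpow 1 (F - G) * xpow 1 G = xpow 1 F" by (rule xpow_diff_mult[OF G])
          have "(F - {v}) - (G - {v}) = F - G" using v by blast
          then have b': "xpow 1 (F - G) * xpow 1 (G - {v}) = xpow 1 (F - {v})"
            using xpow_diff_mult[of "G - {v}" "F - {v}" 1] G by auto
          have "xpow (n + 2) (F - G) = xpow n (F - G) * (xpow 1 (F - G) * xpow 1 (F - G))"
            by (simp add: xpow_mult numeral_2_eq_2)
          then show ?thesis unfolding a t_def b[symmetric] b'[symmetric] by (simp add: algebra_simps)
        qed
        have "cech xs (\<lambda>G. xpow (n + 2) (F - G) * t v G) F = cech xs (\<lambda>G. ?h (xpow n (F - G) * r G)) F"
          by (rule cech_cong[OF F0], rule eq) blast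
        also have "\<dots> = ?h (cech xs (\<lambda>G. xpow n (F - G) * r G) F)"
          by (rule cech_hom) (simp add: restrict_keys_diff right_diff_distrib)
        finally show ?thesis using I_mult I_restrict_keys r_cech[OF F1 F2] by simp
      qed
      moreover have "cech xs (?c v) F \<in> A (j - 1) 0"
      proof (rule cech_in[OF bicomplex.A_0 bicomplex.A_diff F0])
        show "?c v (F - {u}) \<in> A (j - 1) 0" if "u \<in> F" for u by (rule cA'[OF v sub[OF that]])
      qed
      ultimately show "cech xs (?c v) F \<in> N (j - 1) 0 F" by (intro represents_N)
    qed
  qed
  have "\<forall>v. \<exists>b. v \<in> W \<longrightarrow> b \<in> bicomplex.cochains (j - 1) k 0 \<and> (\<lambda>F. D 0 (b F)) \<in> bicomplex.null (j - 1) k (Suc 0) \<and>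
       (\<lambda>F. ?c v F - cech xs b F) \<in> bicomplex.null (j - 1) (Suc k) 0"
    using H[unfolded bicomplex.horizontal_vanishing_def, rule_format, OF cocycle] by blast
  from choice[OF this] obtain b where b: "\<And>v. v \<in> W \<Longrightarrow> b v \<in> bicomplex.cochains (j - 1) k 0"
    and Db: "\<And>v. v \<in> W \<Longrightarrow> (\<lambda>F. D 0 (b v F)) \<in> bicomplex.null (j - 1) k (Suc 0)"
    and cb: "\<And>v. v \<in> W \<Longrightarrow> (\<lambda>F. ?c v F - cech xs (b v) F) \<in> bicomplex.null (j - 1) (Suc k) 0"
    by blast
  \<comment> \<open>Multiplying the primitives by their variables undoes the divisions and returns
    to degree \<open>j\<close>.\<close>
  let ?b = "\<lambda>F. \<Sum>v\<in>W. var_mult v (b v F)"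
  have bA: "b v F \<in> A (j - 1) 0" if "v \<in> W" "F \<subseteq> set xs" "card F = k" for v F
    using bicomplex.cochainsD[OF b[OF that(1)] that(2,3)] .
  show "\<exists>b\<in>bicomplex.cochains j k 0. (\<lambda>F. D 0 (b F)) \<in> bicomplex.null j k (Suc 0) \<and>
       (\<lambda>F. c F - cech xs b F) \<in> bicomplex.null j (Suc k) 0"
  proof (intro bexI[of _ ?b] conjI)
    show "?b \<in> bicomplex.cochains j k 0"
      by (rule bicomplex.cochainsI, rule A_sum) (use bA var_mult_A in auto)
    show "(\<lambda>F. D 0 (?b F)) \<in> bicomplex.null j k (Suc 0)"
    proof (rule bicomplex.nullI)
      fix F assume F: "F \<subseteq> set xs" "card F = k"
      have "D 0 (var_mult v (b v F)) \<in> N j (Suc 0) F" if "v \<in> W" for v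
        by (rule D_var_mult_N[OF that bA[OF that F] bicomplex.nullD[OF Db[OF that] F]])
      then show "D 0 (?b F) \<in> N j (Suc 0) F" unfolding D_sum by (intro N_sum[OF _ F(1)]) auto
    qed
    show "(\<lambda>F. c F - cech xs ?b F) \<in> bicomplex.null j (Suc k) 0"
    proof (rule bicomplex.nullI)
      fix F assume F: "F \<subseteq> set xs" "card F = Suc k"
      have F': "F \<subseteq> W" using F xs by simp
      have cech_b: "cech xs ?b F = (\<Sum>v\<in>W. var_mult v (cech xs (b v) F))"
        unfolding cech_sum by (intro sum.cong refl cech_hom var_mult_diff)
      have part1: "c F - (\<Sum>v\<in>W. var_mult v (?c v F)) \<in> N j 0 F"
      proof (rule represents_N)
        show "c F - (\<Sum>v\<in>W. var_mult v (?c v F)) \<in> A j 0"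
          by (rule A_diff[OF cA[OF F' F(2)] A_sum]) (use var_mult_A cA' F' F in auto)
        have "represents (n + 2) F (c F) (xpow 2 F * r F)"
        proof -
          have k: "Poly_Mapping.keys (c F) \<subseteq> carrier (E 0)" using A_keys[OF cA[OF F' F(2)]] .
          have "xpow (n + 2) F = xpow 2 F * xpow n F" using xpow_mult[of 2 F n] by (simp add: add.commute)
          then show ?thesis
            using r[OF F' F(2)] k act_mult[OF E_module abelian_group.frag_eval_carrier[OF E_group k], of "xpow 2 F" "xpow n F"]
            unfolding represents_def by (simp add: act_e)
        qed
        moreover have "represents (n + 2) F (\<Sum>v\<in>W. var_mult v (?c v F)) (\<Sum>v\<in>W. mvar v * t v F)"
          by (rule represents_sum) (use represents_var_mult rep F' F in auto)
        ultimately show "represents (n + 2) F (c F - (\<Sum>v\<in>W. var_mult v (?c v F))) (xpow 2 F * r F - (\<Sum>v\<in>W. mvar v * t v F))"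
          by (rule represents_diff)
        \<comment> \<open>Here \<open>j < 0\<close> enters: monomials of degree
          \<open>j + n * card F\<close> have too small a degree for all exponents at
          \<open>F\<close> to reach \<open>n\<close>.\<close>
        have "(\<Sum>v\<in>W. s v F) = r F"
          unfolding s_def
        proof (rule sum_negative_parts[OF F'])
          fix m assume "m \<in> Poly_Mapping.keys (r F)"
          then have "int (wdeg m) < int (n * card F)" using r_deg[OF F' F(2)] j by simp
          then show "wdeg m < n * card F" by linarith
        qed
        then have "(\<Sum>v\<in>W. mvar v * t v F) = xpow 2 F * r F"
          by (simp add: mvar_t flip: sum_distrib_left)
        then show "xpow 2 F * r F - (\<Sum>v\<in>W. mvar v * t v F) \<in> I" by (simp add: mem_I)
      qed
      have "(\<Sum>v\<in>W. var_mult v (?c v F - cech xs (b v) F)) \<in> N j 0 F"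
        by (rule N_sum[OF _ F(1)]) (auto intro!: var_mult_N bicomplex.nullD[OF cb _ F(2)] F)
      from bicomplex.N_add[OF F(1) part1 this] show "c F - cech xs ?b F \<in> N j 0 F"
        unfolding cech_b by (simp add: var_mult_diff sum_subtractf)
    qed
  qed
qed

lemma local_cohomology_tame: "tame (local_cohomology R P E d i)"
proof (cases i)
  case 0
  then show ?thesis unfolding tame_def using local_cohomology_0_negative by (intro exI[of _ "-1"]) simp
next
  case (Suc k)
  show ?thesis
  proof (cases "\<forall>j < 0. bicomplex.horizontal_vanishing j k")
    case True
    then show ?thesis unfolding tame_def Suc local_cohomology_Suc_eq_0 by (intro exI[of _ "-1"]) simp
  next
    case False
    then obtain j0 where j0: "j0 < 0" "\<not> bicomplex.horizontal_vanishing j0 k" by blast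
    \<comment> \<open>The contrapositive of the step lemma carries nonvanishing downwards from
      \<open>j0\<close>.\<close>
    have "\<not> bicomplex.horizontal_vanishing j k" if "j \<le> j0" for j
      using that
    proof (induction j rule: int_le_induct)
      case base
      then show ?case using j0 by simp
    next
      case (step i)
      then show ?case using horizontal_vanishing_step[of i k] j0 by auto
    qed
    then show ?thesis unfolding tame_def Suc local_cohomology_Suc_eq_0 by blast
  qed
qed

end

theorem corollary1p11:
  fixes I :: "('v::finite, 'k::field) mpoly set"
    and \<Delta> :: "'v set set"
    and W :: "'v set"
    and R :: "('v, 'k) mpoly set graded_ring"
    and P :: "('v, 'k) mpoly set set"
    and E :: "nat \<Rightarrow> (('v, 'k) mpoly set, 'm) graded_module"
    and e :: "('v, 'k) mpoly set \<Rightarrow> 'm"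
    and d :: "nat \<Rightarrow> 'm \<Rightarrow> 'm"
  assumes "squarefree_monomial_ideal I"
    and "simplicial_complex \<Delta>"
    and "I = stanley_reisner_ideal \<Delta>"
    and "R = graded_monomial_quotient W I"
    and "primeideal P R"
    and "P = Idl\<^bsub>R\<^esub> ((\<lambda>v. I +>\<^bsub>polynomial_ring\<^esub> mvar v) ` W)"
    and "graded_injective_resolution R (regular_module R) e E d"
  shows "\<forall>i. tame (local_cohomology R P E d i)"
proof -
  \<comment> \<open>The enumeration only fixes the signs in the Cech differential.\<close>
  obtain xs where xs: "set xs = W" "distinct xs"
    using finite_distinct_list[of W] by auto
  have ring: "stanley_reisner_ring \<Delta> W I R"
    using assms(2,3,4,7) unfolding graded_injective_resolution_def by (intro stanley_reisner_ring.intro) blast+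
  have "stanley_reisner_resolution \<Delta> W I R P E e d xs"
    using assms(6,7) xs ring
    by (intro stanley_reisner_resolution.intro stanley_reisner_resolution_axioms.intro)
      (simp_all add: stanley_reisner_ring.cls_def[OF ring])
  then show ?thesis using stanley_reisner_resolution.local_cohomology_tame by blast
qed

end
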